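(* Let $\mathbf F$, $\lambda$, $\bar\mu$, $(\bar\mu_h)$, $(\tau(h))$, $T,L$, $(M_h,\mathbf F_h,\boldsymbol\eta_h)$, $\hat{\mathbf F}$ be as follows: $\mathbf F\subset\mathcal P_2(\mathsf{TX})$ is an MPVF whose barycentric field $\bar{\mathbf F}$ is totally $\lambda$-dissipative; $\bar\mu,\bar\mu_h\in D(\mathbf F)$ with $W_2(\bar\mu_h,\bar\mu)\to0$; $\tau(h)>0$, $\tau(h)\to0$; $T,L>0$; $(M_h,\mathbf F_h,\boldsymbol\eta_h)\in\mathscr T(\bar\mu_h,\tau(h),T,L)$; $\hat{\mathbf F}$ is a maximal totally $\lambda$-dissipative extension of $\bar{\mathbf F}$; and the Explicit Euler scheme for $\mathbf F$ is approximately solvable at $\bar\mu$ up to time $T$. Let $(\Omega,\mathcal B)$ be a standard Borel space with a non-atomic probability measure $\mathbb P$. Let $\bar X,\bar X_h\in L^2(\Omega,\mathcal B,\mathbb P;\mathsf X)$ with $\bar X_\sharp\mathbb P=\bar\mu$, $(\bar X_h)_\sharp\mathbb P=\bar\mu_h$, and let $\mathrm Z_h\in L^2(\Omega,\mathcal B,\mathbb P;\mathrm C([0,T];\mathsf X))$ with $(\mathrm Z_h)_\sharp\mathbb P=\boldsymbol\eta_h$ for every $h$. If $\bar X_h\to\bar X$ $\mathbb P$-a.s. and $\mathsf e_0\circ\mathrm Z_h=\bar X_h$ for every $h$, then $\mathrm Z_h\to\mathrm X$ in $L^2(\Omega,\mathcal B,\mathbb P;\mathrm C([0,T];\mathsf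 X))$, where $\mathrm X$ is the Lagrangian solution of $\hat{\mathbf F}$ starting from $\bar X$.
   Context: $\mathsf X$ separable Hilbert space; $\mathsf{TX}=\mathsf X\times\mathsf X$; $\mathcal P_2$, $W_2$, $\Gamma(\mu,\nu)$ as usual; $\mathsf x(x,v)=x$, $\exp^t(x,v)=x+tv$, $\mathsf e_t(\gamma)=\gamma(t)$, $|\Phi|_2^2=\int|v|^2d\Phi$. MPVF: nonempty $\mathbf F\subset\mathcal P_2(\mathsf{TX})$, $D(\mathbf F)=\{\mathsf x_\sharp\Phi:\Phi\in\mathbf F\}$, $\mathbf F[\mu]=\{\Phi\in\mathbf F:\mathsf x_\sharp\Phi=\mu\}$. Barycenter $b_\Phi(x)=\int v\,d\Phi_x(v)$ ($\{\Phi_x\}$ disintegration w.r.t. $\mathsf x_\sharp\Phi$), $\bar{\mathbf F}[\mu]=\{(\mathrm{id},b_\Phi)_\sharp\mu:\Phi\in\mathbf F[\mu]\}$. Totally $\lambda$-dissipative: $\int\langle v_1-v_0,x_1-x_0\rangle d\vartheta\le\lambda\int|x_1-x_0|^2d\vartheta$ for all $\Phi_0,\Phi_1$ in the MPVF and all $\vartheta\in\Gamma(\Phi_0,\Phi_1)$; maximal = maximal w.r.t. inclusion in this class. Explicit Euler scheme: for $\tau>0$, $N=\lceil T/\tau\rceil$, an $L$-stable solution from $\bar\mu$ is $(M^n,\Phi^n)_{0\le n\le N}$ with $M^0=\bar\mu$, $\Phi^n\in\mathbf F[M^n]$, $|\Phi^n|_2\le L$ ($n<N$), $M^n=(\exp^\tau)_\sharp\Phi^{n-1}$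 ($n\ge1$). $M_\tau(t)=(\exp^{t-n\tau})_\sharp\Phi^n$ on $[n\tau,(n+1)\tau]$, $\mathbf F_\tau(t)=\Phi^{\lfloor t/\tau\rfloor}$. With $T^n=(\mathsf x,\exp^\tau)_\sharp\Phi^n$ disintegrated as $\{T^n_x\}$ w.r.t. first marginal, $\alpha^1=T^0$, $\alpha^n=\int\delta_{(x_0,\dots,x_{n-1})}\otimes T^{n-1}_{x_{n-1}}d\alpha^{n-1}$, $\boldsymbol\eta_\tau=G_\sharp\alpha^N$ where $G$ maps $(x_0,\dots,x_N)$ to the curve on $[0,T]$ affine on each $[n\tau,(n+1)\tau]\cap[0,T]$ with value $x_n$ at $n\tau$. $\mathscr E(\bar\mu,\tau,T,L)$ / $\mathscr T(\bar\mu,\tau,T,L)$: sets of pairs $(M_\tau,\mathbf F_\tau)$ / triples $(M_\tau,\mathbf F_\tau,\boldsymbol\eta_\tau)$ from $L$-stable solutions. Approximate solvability at $\bar\mu$ up to $T$: there exist $\bar\tau,L'>0$ and finitely supported $\bar\mu^j\in D(\mathbf F)$ with $W_2(\bar\mu^j,\bar\mu)\to0$ and $\mathscr E(\bar\mu^j,\tau,T,L')\neq\emptyset$ for all $0<\tau<\bar\tau$, $j\in\mathbb N$. Lagrangian solution: the Lagrangian representation of $\hat{\mathbf F}$ is the operator $\mathbf B=\{(X,V)\in L^2(\Omega;\mathsf X)^2:(X,V)_\sharp\mathbb P\in\hat{\mathbf F}\}$, which is maximal $\lambda$-dissipative; since $\bar\mu\in D(\hat{\mathbf F})$, there is a unique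 locally Lipschitz curve $t\mapsto X_t\in L^2(\Omega;\mathsf X)$ with $X_0=\bar X$ and $\dot X_t\in\mathbf B X_t$ for a.e. $t$; the map $\omega\mapsto(t\mapsto X_t(\omega))$ has a version $\mathrm X:\Omega\to H^1(0,T;\mathsf X)\subset\mathrm C([0,T];\mathsf X)$ (it is $\mathrm s_{\bar\mu}\circ\bar X$, where $\mathrm s_{\bar\mu}[x](t)$ is the Lagrangian flow map of $\hat{\mathbf F}$ at time $t$ evaluated at $(x,\bar\mu)$). *)

theory Defs
  imports "HOL-Probability.Probability"
begin

text \<open>Ambient space: a separable real Hilbert space, i.e. a type of sort
  {real_inner, complete_space, second_countable_topology}.  Probability
  measures are Borel measures on the relevant type.\<close>

definition P2 :: "'c::real_normed_vector measure set" where
  "P2 = {M. prob_space M \<and> sets M = sets borel \<and> (\<integral>\<^sup>+x. ennreal ((norm x)\<^sup>2) \<partial>M) < \<infinity>}"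

definition Gamma :: "'c::topological_space measure \<Rightarrow> 'd::topological_space measure
    \<Rightarrow> ('c \<times> 'd) measure set" where
  "Gamma \<mu> \<nu> = {\<gamma>. prob_space \<gamma> \<and> sets \<gamma> = sets borel
      \<and> distr \<gamma> borel fst = \<mu> \<and> distr \<gamma> borel snd = \<nu>}"

definition W2 :: "'c::{real_normed_vector, second_countable_topology} measure \<Rightarrow> 'c measure \<Rightarrow> real" where
  "W2 \<mu> \<nu> = sqrt (Inf {(\<integral>p. (norm (fst p - snd p))\<^sup>2 \<partial>\<gamma>) | \<gamma>. \<gamma> \<in> Gamma \<mu> \<nu>})"

definition norm2 :: "('a::real_normed_vector \<times> 'a) measure \<Rightarrow> real" where
  "norm2 \<Phi> = sqrt (\<integral>p. (norm (snd p))\<^sup>2 \<partial>\<Phi>)"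

definition is_MPVF :: "('a::real_normed_vector \<times> 'a) measure set \<Rightarrow> bool" where
  "is_MPVF F \<longleftrightarrow> F \<noteq> {} \<and> F \<subseteq> P2"

definition dom_F :: "('a::{real_normed_vector,second_countable_topology} \<times> 'a) measure set \<Rightarrow> 'a measure set" where
  "dom_F F = (\<lambda>\<Phi>. distr \<Phi> borel fst) ` F"

definition fiber :: "('a::{real_normed_vector,second_countable_topology} \<times> 'a) measure set \<Rightarrow> 'a measure
    \<Rightarrow> ('a \<times> 'a) measure set" where
  "fiber F \<mu> = {\<Phi> \<in> F. distr \<Phi> borel fst = \<mu>}"

definition disint :: "'c::topological_space measure \<Rightarrow> ('c \<times> 'd::topological_space) measure
    \<Rightarrow> ('c \<Rightarrow> 'd measure) \<Rightarrow> bool" where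
  "disint \<mu> \<Phi> K \<longleftrightarrow> (\<forall>x. prob_space (K x) \<and> sets (K x) = sets borel)
     \<and> (\<forall>B \<in> sets borel. (\<lambda>x. emeasure (K x) B) \<in> borel_measurable \<mu>)
     \<and> (\<forall>C \<in> sets borel. emeasure \<Phi> C = (\<integral>\<^sup>+x. emeasure (K x) (Pair x -` C) \<partial>\<mu>))"

definition barF :: "('a::{real_inner,complete_space,second_countable_topology} \<times> 'a) measure set
    \<Rightarrow> ('a \<times> 'a) measure set" where
  "barF F = {distr \<mu> borel (\<lambda>x. (x, \<integral>v. v \<partial>(K x))) | \<mu> \<Phi> K.
       \<Phi> \<in> F \<and> \<mu> = distr \<Phi> borel fst \<and> disint \<mu> \<Phi> K}"

definition tdiss :: "real \<Rightarrow> ('a::{real_inner,complete_space,second_countable_topology} \<times> 'a) measure set \<Rightarrow> bool" where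
  "tdiss lam F \<longleftrightarrow> (\<forall>\<Phi>0\<in>F. \<forall>\<Phi>1\<in>F. \<forall>\<theta>\<in>Gamma \<Phi>0 \<Phi>1.
      (\<integral>q. inner (snd (snd q) - snd (fst q)) (fst (snd q) - fst (fst q)) \<partial>\<theta>)
        \<le> lam * (\<integral>q. (norm (fst (snd q) - fst (fst q)))\<^sup>2 \<partial>\<theta>))"

definition max_tdiss :: "real \<Rightarrow> ('a::{real_inner,complete_space,second_countable_topology} \<times> 'a) measure set \<Rightarrow> bool" where
  "max_tdiss lam F \<longleftrightarrow> is_MPVF F \<and> tdiss lam F \<and>
     (\<forall>G. is_MPVF G \<and> tdiss lam G \<and> F \<subseteq> G \<longrightarrow> G = F)"

definition stepN :: "real \<Rightarrow> real \<Rightarrow> nat" where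
  "stepN \<tau> T = nat \<lceil>T / \<tau>\<rceil>"

definition Lstable :: "('a::{real_inner,complete_space,second_countable_topology} \<times> 'a) measure set
    \<Rightarrow> 'a measure \<Rightarrow> real \<Rightarrow> real \<Rightarrow> real \<Rightarrow> (nat \<Rightarrow> 'a measure) \<Rightarrow> (nat \<Rightarrow> ('a \<times> 'a) measure) \<Rightarrow> bool" where
  "Lstable F \<mu> \<tau> T L M \<Phi> \<longleftrightarrow> M 0 = \<mu>
     \<and> (\<forall>n \<le> stepN \<tau> T. \<Phi> n \<in> fiber F (M n))
     \<and> (\<forall>n < stepN \<tau> T. norm2 (\<Phi> n) \<le> L)
     \<and> (\<forall>n. 1 \<le> n \<and> n \<le> stepN \<tau> T \<longrightarrow> M n = distr (\<Phi> (n - 1)) borel (\<lambda>p. fst p + \<tau> *\<^sub>R snd p))"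

definition Mtau :: "real \<Rightarrow> (nat \<Rightarrow> ('a::{real_inner,complete_space,second_countable_topology} \<times> 'a) measure)
    \<Rightarrow> real \<Rightarrow> 'a measure" where
  "Mtau \<tau> \<Phi> t = distr (\<Phi> (nat \<lfloor>t / \<tau>\<rfloor>)) borel
      (\<lambda>p. fst p + (t - real (nat \<lfloor>t / \<tau>\<rfloor>) * \<tau>) *\<^sub>R snd p)"

definition Ftau :: "real \<Rightarrow> (nat \<Rightarrow> ('a \<times> 'a) measure) \<Rightarrow> real \<Rightarrow> ('a \<times> 'a) measure" where
  "Ftau \<tau> \<Phi> t = \<Phi> (nat \<lfloor>t / \<tau>\<rfloor>)"

definition Tn :: "real \<Rightarrow> ('a::{real_inner,complete_space,second_countable_topology} \<times> 'a) measure \<Rightarrow> ('a \<times> 'a) measure" where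
  "Tn \<tau> \<Phi> = distr \<Phi> borel (\<lambda>p. (fst p, fst p + \<tau> *\<^sub>R snd p))"

abbreviation seqM :: "nat \<Rightarrow> (nat \<Rightarrow> 'a::topological_space) measure" where
  "seqM n \<equiv> Pi\<^sub>M {0..n} (\<lambda>_. borel)"

text \<open>alpha Ts K m is \<open>\<alpha>^{m+1}\<close>: \<open>\<alpha>^1 = T^0\<close>, and
  \<open>\<alpha>^{m+2} = \<integral> \<delta>_{(x_0..x_{m+1})} \<otimes> T^{m+1}_{x_{m+1}} d\<alpha>^{m+1}\<close>,
  where K n is a disintegration of Ts n w.r.t. its first marginal.\<close>
fun alpha :: "(nat \<Rightarrow> ('a::topological_space \<times> 'a) measure) \<Rightarrow> (nat \<Rightarrow> 'a \<Rightarrow> 'a measure)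
    \<Rightarrow> nat \<Rightarrow> (nat \<Rightarrow> 'a) measure" where
  "alpha Ts K 0 = distr (Ts 0) (seqM 1) (\<lambda>p. \<lambda>i\<in>{0..1}. if i = 0 then fst p else snd p)"
| "alpha Ts K (Suc m) = measure_of (space (seqM (Suc (Suc m)))) (sets (seqM (Suc (Suc m))))
      (\<lambda>C. \<integral>\<^sup>+x. emeasure (K (Suc m) (x (Suc m))) {y. x(Suc (Suc m) := y) \<in> C} \<partial>(alpha Ts K m))"

text \<open>Path space \<open>C([0,T];X)\<close> modelled by extensional functions on \<open>[0,T]\<close>
  with the (product = Borel on continuous paths) \<sigma>-algebra.\<close>
abbreviation pathM :: "real \<Rightarrow> (real \<Rightarrow> 'a::topological_space) measure" where
  "pathM T \<equiv> Pi\<^sub>M {0..T} (\<lambda>_. borel)"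

definition Gmap :: "real \<Rightarrow> real \<Rightarrow> (nat \<Rightarrow> 'a::real_vector) \<Rightarrow> real \<Rightarrow> 'a" where
  "Gmap \<tau> T x = (\<lambda>t\<in>{0..T}. let n = min (nat \<lfloor>t / \<tau>\<rfloor>) (stepN \<tau> T - 1) in
      x n + ((t - real n * \<tau>) / \<tau>) *\<^sub>R (x (Suc n) - x n))"

definition eta :: "real \<Rightarrow> real \<Rightarrow> (nat \<Rightarrow> ('a::{real_inner,complete_space,second_countable_topology} \<times> 'a) measure)
    \<Rightarrow> (nat \<Rightarrow> 'a \<Rightarrow> 'a measure) \<Rightarrow> (real \<Rightarrow> 'a) measure" where
  "eta \<tau> T \<Phi> K = distr (alpha (\<lambda>n. Tn \<tau> (\<Phi> n)) K (stepN \<tau> T - 1)) (pathM T) (Gmap \<tau> T)"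

definition Esol :: "('a::{real_inner,complete_space,second_countable_topology} \<times> 'a) measure set
    \<Rightarrow> 'a measure \<Rightarrow> real \<Rightarrow> real \<Rightarrow> real \<Rightarrow> ((real \<Rightarrow> 'a measure) \<times> (real \<Rightarrow> ('a \<times> 'a) measure)) set" where
  "Esol F \<mu> \<tau> T L = {(Mtau \<tau> \<Phi>, Ftau \<tau> \<Phi>) | M \<Phi>. Lstable F \<mu> \<tau> T L M \<Phi>}"

definition Tsol :: "('a::{real_inner,complete_space,second_countable_topology} \<times> 'a) measure set
    \<Rightarrow> 'a measure \<Rightarrow> real \<Rightarrow> real \<Rightarrow> real
    \<Rightarrow> ((real \<Rightarrow> 'a measure) \<times> (real \<Rightarrow> ('a \<times> 'a) measure) \<times> (real \<Rightarrow> 'a) measure) set" where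
  "Tsol F \<mu> \<tau> T L = {(Mtau \<tau> \<Phi>, Ftau \<tau> \<Phi>, eta \<tau> T \<Phi> K) | M \<Phi> K. Lstable F \<mu> \<tau> T L M \<Phi>
      \<and> (\<forall>n < stepN \<tau> T. disint (distr (Tn \<tau> (\<Phi> n)) borel fst) (Tn \<tau> (\<Phi> n)) (K n))}"

definition finitely_supported :: "'c::t1_space measure \<Rightarrow> bool" where
  "finitely_supported \<mu> \<longleftrightarrow> (\<exists>S. finite S \<and> emeasure \<mu> (UNIV - S) = 0)"

definition approx_solvable :: "('a::{real_inner,complete_space,second_countable_topology} \<times> 'a) measure set
    \<Rightarrow> 'a measure \<Rightarrow> real \<Rightarrow> bool" where
  "approx_solvable F \<mu> T \<longleftrightarrow> (\<exists>\<tau>0 L' \<mu>s. \<tau>0 > 0 \<and> L' > 0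
     \<and> (\<forall>j. finitely_supported (\<mu>s j) \<and> \<mu>s j \<in> dom_F F)
     \<and> (\<lambda>j. W2 (\<mu>s j) \<mu>) \<longlonglongrightarrow> 0
     \<and> (\<forall>\<tau> j. 0 < \<tau> \<and> \<tau> < \<tau>0 \<longrightarrow> Esol F (\<mu>s j) \<tau> T L' \<noteq> {}))"

definition atomless :: "'b measure \<Rightarrow> bool" where
  "atomless P \<longleftrightarrow> (\<forall>A \<in> sets P. emeasure P A > 0 \<longrightarrow>
      (\<exists>B \<in> sets P. B \<subseteq> A \<and> 0 < emeasure P B \<and> emeasure P B < emeasure P A))"

definition L2 :: "'b measure \<Rightarrow> ('b \<Rightarrow> 'a::{real_normed_vector,second_countable_topology}) set" where
  "L2 P = {X. X \<in> borel_measurable P \<and> integrable P (\<lambda>\<omega>. (norm (X \<omega>))\<^sup>2)}"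

definition L2dist :: "'b measure \<Rightarrow> ('b \<Rightarrow> 'a::real_normed_vector) \<Rightarrow> ('b \<Rightarrow> 'a) \<Rightarrow> real" where
  "L2dist P X Y = sqrt (\<integral>\<omega>. (norm (X \<omega> - Y \<omega>))\<^sup>2 \<partial>P)"

definition lagr_op :: "'b measure \<Rightarrow> ('a::{real_inner,complete_space,second_countable_topology} \<times> 'a) measure set
    \<Rightarrow> (('b \<Rightarrow> 'a) \<times> ('b \<Rightarrow> 'a)) set" where
  "lagr_op P G = {(X, V). X \<in> L2 P \<and> V \<in> L2 P \<and> distr P borel (\<lambda>\<omega>. (X \<omega>, V \<omega>)) \<in> G}"

definition lagr_curve :: "'b measure \<Rightarrow> ('a::{real_inner,complete_space,second_countable_topology} \<times> 'a) measure set
    \<Rightarrow> real \<Rightarrow> ('b \<Rightarrow> 'a) \<Rightarrow> (real \<Rightarrow> 'b \<Rightarrow> 'a) \<Rightarrow> bool" where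
  "lagr_curve P G T Xb Xt \<longleftrightarrow> (\<forall>t\<in>{0..T}. Xt t \<in> L2 P)
     \<and> (AE \<omega> in P. Xt 0 \<omega> = Xb \<omega>)
     \<and> (\<exists>C. \<forall>s\<in>{0..T}. \<forall>t\<in>{0..T}. L2dist P (Xt s) (Xt t) \<le> C * \<bar>s - t\<bar>)
     \<and> (AE t in lborel. t \<in> {0<..<T} \<longrightarrow>
          (\<exists>V. (Xt t, V) \<in> lagr_op P G
             \<and> ((\<lambda>s. L2dist P (\<lambda>\<omega>. (1 / (s - t)) *\<^sub>R (Xt s \<omega> - Xt t \<omega>)) V) \<longlongrightarrow> 0) (at t within {0..T})))"

definition lagr_solution :: "'b measure \<Rightarrow> ('a::{real_inner,complete_space,second_countable_topology} \<times> 'a) measure set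
    \<Rightarrow> real \<Rightarrow> ('b \<Rightarrow> 'a) \<Rightarrow> ('b \<Rightarrow> real \<Rightarrow> 'a) \<Rightarrow> bool" where
  "lagr_solution P G T Xb Xs \<longleftrightarrow> Xs \<in> measurable P (pathM T)
     \<and> (\<forall>\<omega>. continuous_on {0..T} (Xs \<omega>))
     \<and> (\<exists>Xt. lagr_curve P G T Xb Xt \<and> (\<forall>t\<in>{0..T}. AE \<omega> in P. Xs \<omega> t = Xt t \<omega>))"

definition L2C :: "'b measure \<Rightarrow> real \<Rightarrow> ('b \<Rightarrow> real \<Rightarrow> 'a::{real_normed_vector,second_countable_topology}) set" where
  "L2C P T = {Z. Z \<in> measurable P (pathM T) \<and> (\<forall>\<omega>. continuous_on {0..T} (Z \<omega>))
      \<and> (\<integral>\<^sup>+\<omega>. ennreal ((SUP t\<in>{0..T}. norm (Z \<omega> t))\<^sup>2) \<partial>P) < \<infinity>}"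

definition L2C_dist2 :: "'b measure \<Rightarrow> real \<Rightarrow> ('b \<Rightarrow> real \<Rightarrow> 'a::real_normed_vector) \<Rightarrow> ('b \<Rightarrow> real \<Rightarrow> 'a) \<Rightarrow> ennreal" where
  "L2C_dist2 P T Z Y = (\<integral>\<^sup>+\<omega>. ennreal ((SUP t\<in>{0..T}. norm (Z \<omega> t - Y \<omega> t))\<^sup>2) \<partial>P)"

end

theory Submission
  imports Defs
begin

text \<open>
  By construction of the path measure, the velocity \<open>V\<^sub>n\<close> of a path of the scheme at its \<open>n\<close>-th node
  \<open>Y\<^sub>n\<close> has conditional expectation \<open>b\<^sub>n(Y\<^sub>n)\<close> given \<open>Y\<^sub>0, \<dots>, Y\<^sub>n\<close>, where \<open>b\<^sub>n\<close> is the barycentric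
  field, and the law of \<open>(Y\<^sub>n, b\<^sub>n(Y\<^sub>n))\<close> lies in the extension of the barycentric field. Total
  dissipativity therefore compares \<open>(Y\<^sub>n, b\<^sub>n(Y\<^sub>n))\<close> with \<open>(X\<^sub>t, X\<^sub>t')\<close> under any coupling. The
  error \<open>V\<^sub>n - b\<^sub>n(Y\<^sub>n)\<close> must in addition be orthogonal to \<open>X\<^sub>t\<close>. This is achieved by comparing
  \<open>Z\<^sub>h(\<omega>)\<close> with \<open>X(\<omega>')\<close>, where \<open>\<omega>\<close> and \<open>\<omega>'\<close> are conditionally independent given the cell of \<open>Y\<^sub>0\<close> in
  a fine countable partition: Gronwall's inequality bounds both \<open>Z\<^sub>h(\<omega>) - X(\<omega>')\<close> and \<open>X(\<omega>) - X(\<omega>')\<close>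
  by the initial distance and the step size. The resulting bound on \<open>E|Z\<^sub>h(t) - X\<^sub>t|\<^sup>2\<close>, uniform in
  \<open>t\<close>, passes to the supremum over \<open>t\<close> because both processes are Lipschitz in \<open>L\<^sup>2\<close> and hence have
  paths of finite expected energy.
\<close>

section \<open>Square-integrable random variables\<close>

definition L2norm :: "'b measure \<Rightarrow> ('b \<Rightarrow> 'a::real_normed_vector) \<Rightarrow> real" where
  "L2norm M X = sqrt (\<integral>\<omega>. (norm (X \<omega>))\<^sup>2 \<partial>M)"

definition L2inner :: "'b measure \<Rightarrow> ('b \<Rightarrow> 'a::real_inner) \<Rightarrow> ('b \<Rightarrow> 'a) \<Rightarrow> real" where
  "L2inner M X Y = (\<integral>\<omega>. inner (X \<omega>) (Y \<omega>) \<partial>M)"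

lemma L2dist_eq_L2norm: "L2dist M X Y = L2norm M (\<lambda>\<omega>. X \<omega> - Y \<omega>)"
  by (simp add: L2dist_def L2norm_def)

lemma L2norm_nonneg [simp]: "0 \<le> L2norm M X"
  by (simp add: L2norm_def)

lemma L2norm_power2: "(L2norm M X)\<^sup>2 = (\<integral>\<omega>. (norm (X \<omega>))\<^sup>2 \<partial>M)"
  by (simp add: L2norm_def)

lemma L2norm_zero [simp]: "L2norm M (\<lambda>_. 0) = 0"
  by (simp add: L2norm_def)

lemma L2norm_scaleR: "L2norm M (\<lambda>\<omega>. c *\<^sub>R X \<omega>) = \<bar>c\<bar> * L2norm M X"
  by (simp add: L2norm_def power_mult_distrib real_sqrt_mult)

lemma L2norm_minus_commute: "L2norm M (\<lambda>\<omega>. X \<omega> - Y \<omega>) = L2norm M (\<lambda>\<omega>. Y \<omega> - X \<omega>)"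
  unfolding L2norm_def by (subst norm_minus_commute) (rule refl)

lemma L2_measurable: "X \<in> L2 M \<Longrightarrow> X \<in> borel_measurable M"
  and L2_integrable_power2: "X \<in> L2 M \<Longrightarrow> integrable M (\<lambda>\<omega>. (norm (X \<omega>))\<^sup>2)"
  by (auto simp: L2_def)

lemma nn_integral_norm_power2_eq_L2norm:
  "X \<in> L2 M \<Longrightarrow> (\<integral>\<^sup>+\<omega>. ennreal ((norm (X \<omega>))\<^sup>2) \<partial>M) = ennreal ((L2norm M X)\<^sup>2)"
  unfolding L2norm_power2 by (intro nn_integral_eq_integral L2_integrable_power2) auto

lemma norm_add_power2_le:
  fixes x y :: "'a::real_normed_vector"
  shows "(norm (x + y))\<^sup>2 \<le> 2 * (norm x)\<^sup>2 + 2 * (norm y)\<^sup>2"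
proof -
  have "(norm (x + y))\<^sup>2 \<le> (norm x + norm y)\<^sup>2"
    by (intro power_mono norm_triangle_ineq) auto
  also have "\<dots> \<le> 2 * (norm x)\<^sup>2 + 2 * (norm y)\<^sup>2"
    using sum_squares_bound[of "norm x" "norm y"] by (simp add: power2_sum)
  finally show ?thesis .
qed

lemma L2_zero: "(\<lambda>_. 0) \<in> L2 M"
  by (simp add: L2_def)

lemma L2_add:
  assumes "X \<in> L2 M" "Y \<in> L2 M"
  shows "(\<lambda>\<omega>. X \<omega> + Y \<omega>) \<in> L2 M"
proof -
  note [measurable] = assms[THEN L2_measurable]
  have "integrable M (\<lambda>\<omega>. 2 * (norm (X \<omega>))\<^sup>2 + 2 * (norm (Y \<omega>))\<^sup>2)"
    using assms[THEN L2_integrable_power2] by auto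
  then have "integrable M (\<lambda>\<omega>. (norm (X \<omega> + Y \<omega>))\<^sup>2)"
    by (rule Bochner_Integration.integrable_bound) (auto intro!: AE_I2 simp: norm_add_power2_le)
  then show ?thesis by (simp add: L2_def)
qed

lemma L2_scaleR: "X \<in> L2 M \<Longrightarrow> (\<lambda>\<omega>. c *\<^sub>R X \<omega>) \<in> L2 M"
  by (auto simp: L2_def power_mult_distrib)

lemma L2_diff: "X \<in> L2 M \<Longrightarrow> Y \<in> L2 M \<Longrightarrow> (\<lambda>\<omega>. X \<omega> - Y \<omega>) \<in> L2 M"
  using L2_add[OF _ L2_scaleR[of _ M "-1"]] by simp

lemma L2_sum: "(\<And>i. i \<in> I \<Longrightarrow> X i \<in> L2 M) \<Longrightarrow> (\<lambda>\<omega>. \<Sum>i\<in>I. X i \<omega>) \<in> L2 M"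
  by (induction I rule: infinite_finite_induct) (auto intro: L2_add L2_zero)

lemmas L2_intros = L2_add L2_diff L2_scaleR L2_sum

lemma bounded_measurable_in_L2:
  assumes "finite_measure M" "X \<in> borel_measurable M" "\<And>\<omega>. norm (X \<omega>) \<le> B"
  shows "X \<in> L2 M"
proof -
  interpret finite_measure M by fact
  have "integrable M (\<lambda>\<omega>. (norm (X \<omega>))\<^sup>2)"
    using assms(2,3)
    by (intro integrable_const_bound[where B = "B\<^sup>2"] AE_I2) (auto intro!: power_mono)
  then show ?thesis using assms(2) by (simp add: L2_def)
qed

lemma L2norm_le_AE_bound:
  assumes M: "prob_space M" and X: "X \<in> L2 M" and "AE \<omega> in M. norm (X \<omega>) \<le> B" "0 \<le> B"
  shows "L2norm M X \<le> B"
proof -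
  interpret prob_space M by fact
  have "(L2norm M X)\<^sup>2 \<le> (\<integral>\<omega>. B\<^sup>2 \<partial>M)"
    unfolding L2norm_power2
  proof (rule integral_mono_AE[OF L2_integrable_power2[OF X]])
    show "AE \<omega> in M. (norm (X \<omega>))\<^sup>2 \<le> B\<^sup>2"
      using assms(3) by eventually_elim (simp add: power_mono)
  qed simp
  then have "(L2norm M X)\<^sup>2 \<le> B\<^sup>2" by (simp add: prob_space)
  then show ?thesis by (rule power2_le_imp_le) fact
qed

lemma L2_integrable_norm:
  assumes "finite_measure M" "X \<in> L2 M"
  shows "integrable M (\<lambda>\<omega>. norm (X \<omega>))"
  by (rule finite_measure.square_integrable_imp_integrable) (use assms in \<open>auto simp: L2_def\<close>)

lemma L2_integrable_inner:
  fixes X Y :: "'b \<Rightarrow> 'a::{real_inner,second_countable_topology}"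
  assumes "X \<in> L2 M" "Y \<in> L2 M"
  shows "integrable M (\<lambda>\<omega>. inner (X \<omega>) (Y \<omega>))"
proof (rule Bochner_Integration.integrable_bound)
  note [measurable] = assms[THEN L2_measurable]
  show "integrable M (\<lambda>\<omega>. (norm (X \<omega>))\<^sup>2 + (norm (Y \<omega>))\<^sup>2)"
    using assms[THEN L2_integrable_power2] by auto
  have "norm (inner x y) \<le> norm ((norm x)\<^sup>2 + (norm y)\<^sup>2)" for x y :: 'a
    using Cauchy_Schwarz_ineq2[of x y] sum_squares_bound[of "norm x" "norm y"]
      mult_nonneg_nonneg[OF norm_ge_zero norm_ge_zero, of x y] by simp
  then show "AE \<omega> in M. norm (inner (X \<omega>) (Y \<omega>)) \<le> norm ((norm (X \<omega>))\<^sup>2 + (norm (Y \<omega>))\<^sup>2)"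
    by simp
  show "(\<lambda>\<omega>. inner (X \<omega>) (Y \<omega>)) \<in> borel_measurable M" by measurable
qed

lemma L2inner_add_right:
  fixes X Y Z :: "'b \<Rightarrow> 'a::{real_inner,second_countable_topology}"
  assumes "X \<in> L2 M" "Y \<in> L2 M" "Z \<in> L2 M"
  shows "L2inner M X (\<lambda>\<omega>. Y \<omega> + Z \<omega>) = L2inner M X Y + L2inner M X Z"
  using assms by (simp add: L2inner_def inner_add_right L2_integrable_inner)

lemma L2inner_diff_right:
  fixes X Y Z :: "'b \<Rightarrow> 'a::{real_inner,second_countable_topology}"
  assumes "X \<in> L2 M" "Y \<in> L2 M" "Z \<in> L2 M"
  shows "L2inner M X (\<lambda>\<omega>. Y \<omega> - Z \<omega>) = L2inner M X Y - L2inner M X Z"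
  using assms by (simp add: L2inner_def inner_diff_right L2_integrable_inner)

lemma L2inner_scaleR_right: "L2inner M X (\<lambda>\<omega>. c *\<^sub>R Y \<omega>) = c * L2inner M X Y"
  by (simp add: L2inner_def)

lemma L2inner_commute: "L2inner M X Y = L2inner M Y X"
  by (simp add: L2inner_def inner_commute)

lemma L2inner_add_left:
  fixes X Y Z :: "'b \<Rightarrow> 'a::{real_inner,second_countable_topology}"
  assumes "X \<in> L2 M" "Y \<in> L2 M" "Z \<in> L2 M"
  shows "L2inner M (\<lambda>\<omega>. X \<omega> + Y \<omega>) Z = L2inner M X Z + L2inner M Y Z"
  using L2inner_add_right[of Z M X Y] assms by (simp add: L2inner_commute)

lemma L2norm_add_power2:
  fixes X Y :: "'b \<Rightarrow> 'a::{real_inner,second_countable_topology}"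
  assumes "X \<in> L2 M" "Y \<in> L2 M"
  shows "(L2norm M (\<lambda>\<omega>. X \<omega> + Y \<omega>))\<^sup>2 = (L2norm M X)\<^sup>2 + 2 * L2inner M X Y + (L2norm M Y)\<^sup>2"
proof -
  have "(L2norm M (\<lambda>\<omega>. X \<omega> + Y \<omega>))\<^sup>2
      = (\<integral>\<omega>. (norm (X \<omega>))\<^sup>2 + 2 * inner (X \<omega>) (Y \<omega>) + (norm (Y \<omega>))\<^sup>2 \<partial>M)"
    by (simp add: L2norm_power2 power2_norm_eq_inner inner_add_left inner_add_right inner_commute
        algebra_simps)
  also have "\<dots> = (L2norm M X)\<^sup>2 + 2 * L2inner M X Y + (L2norm M Y)\<^sup>2"
    using assms[THEN L2_integrable_power2] L2_integrable_inner[OF assms]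
    by (simp add: L2norm_power2 L2inner_def)
  finally show ?thesis .
qed

lemma L2_Cauchy_Schwarz:
  fixes X Y :: "'b \<Rightarrow> 'a::{real_inner,second_countable_topology}"
  assumes "X \<in> L2 M" "Y \<in> L2 M"
  shows "\<bar>L2inner M X Y\<bar> \<le> L2norm M X * L2norm M Y"
proof -
  note [measurable] = assms[THEN L2_measurable]
  have "ennreal \<bar>L2inner M X Y\<bar> \<le> (\<integral>\<^sup>+\<omega>. norm (inner (X \<omega>) (Y \<omega>)) \<partial>M)"
    unfolding L2inner_def using integral_norm_bound_ennreal[OF L2_integrable_inner[OF assms]]
    by simp
  also have "\<dots> \<le> (\<integral>\<^sup>+\<omega>. ennreal (norm (X \<omega>)) * ennreal (norm (Y \<omega>)) \<partial>M)"
    by (intro nn_integral_mono) (simp add: ennreal_leI Cauchy_Schwarz_ineq2 flip: ennreal_mult)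
  finally have "(ennreal \<bar>L2inner M X Y\<bar>)\<^sup>2
      \<le> (\<integral>\<^sup>+\<omega>. ennreal (norm (X \<omega>)) * ennreal (norm (Y \<omega>)) \<partial>M)\<^sup>2"
    by (intro power_mono) auto
  also have "\<dots> \<le> (\<integral>\<^sup>+\<omega>. (ennreal (norm (X \<omega>)))\<^sup>2 \<partial>M) * (\<integral>\<^sup>+\<omega>. (ennreal (norm (Y \<omega>)))\<^sup>2 \<partial>M)"
    by (intro Cauchy_Schwarz_nn_integral) measurable
  also have "\<dots> = ennreal ((L2norm M X * L2norm M Y)\<^sup>2)"
    using assms by (simp add: ennreal_power nn_integral_norm_power2_eq_L2norm power_mult_distrib
        ennreal_mult)
  finally have "\<bar>L2inner M X Y\<bar>\<^sup>2 \<le> (L2norm M X * L2norm M Y)\<^sup>2"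
    by (simp add: ennreal_power)
  then show ?thesis by (rule power2_le_imp_le) simp
qed

lemma L2norm_add_le:
  fixes X Y :: "'b \<Rightarrow> 'a::{real_inner,second_countable_topology}"
  assumes "X \<in> L2 M" "Y \<in> L2 M"
  shows "L2norm M (\<lambda>\<omega>. X \<omega> + Y \<omega>) \<le> L2norm M X + L2norm M Y"
proof -
  have "(L2norm M (\<lambda>\<omega>. X \<omega> + Y \<omega>))\<^sup>2 \<le> (L2norm M X + L2norm M Y)\<^sup>2"
    using L2norm_add_power2[OF assms] L2_Cauchy_Schwarz[OF assms] by (simp add: power2_sum)
  then show ?thesis by (rule power2_le_imp_le) simp
qed

lemma L2norm_diff_le:
  fixes X Y :: "'b \<Rightarrow> 'a::{real_inner,second_countable_topology}"
  assumes "X \<in> L2 M" "Y \<in> L2 M"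
  shows "L2norm M (\<lambda>\<omega>. X \<omega> - Y \<omega>) \<le> L2norm M X + L2norm M Y"
  using L2norm_add_le[OF assms(1) L2_scaleR[OF assms(2), of "-1"]] L2norm_scaleR[of M "-1" Y]
  by simp

lemma L2norm_diff_power2_le:
  fixes X Y :: "'b \<Rightarrow> 'a::{real_inner,second_countable_topology}"
  assumes "X \<in> L2 M" "Y \<in> L2 M"
  shows "(L2norm M (\<lambda>\<omega>. X \<omega> - Y \<omega>))\<^sup>2 \<le> 2 * (L2norm M X)\<^sup>2 + 2 * (L2norm M Y)\<^sup>2"
proof -
  have "(L2norm M (\<lambda>\<omega>. X \<omega> - Y \<omega>))\<^sup>2 \<le> (L2norm M X + L2norm M Y)\<^sup>2"
    by (intro power_mono L2norm_diff_le assms) simp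
  also have "\<dots> \<le> 2 * (L2norm M X)\<^sup>2 + 2 * (L2norm M Y)\<^sup>2"
    using sum_squares_bound[of "L2norm M X" "L2norm M Y"] by (simp add: power2_sum)
  finally show ?thesis .
qed

lemma L2norm_le_diff_add:
  fixes X Y :: "'b \<Rightarrow> 'a::{real_inner,second_countable_topology}"
  assumes "X \<in> L2 M" "Y \<in> L2 M"
  shows "L2norm M X \<le> L2norm M (\<lambda>\<omega>. X \<omega> - Y \<omega>) + L2norm M Y"
  using L2norm_add_le[OF L2_diff[OF assms] assms(2)] by simp

lemma abs_L2norm_diff_le:
  fixes X Y :: "'b \<Rightarrow> 'a::{real_inner,second_countable_topology}"
  assumes "X \<in> L2 M" "Y \<in> L2 M"
  shows "\<bar>L2norm M X - L2norm M Y\<bar> \<le> L2norm M (\<lambda>\<omega>. X \<omega> - Y \<omega>)"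
  using L2norm_le_diff_add[OF assms] L2norm_le_diff_add[OF assms(2,1)]
    L2norm_minus_commute[of M X Y]
  by linarith

lemma L2norm_sum_le:
  fixes X :: "'i \<Rightarrow> 'b \<Rightarrow> 'a::{real_inner,second_countable_topology}"
  assumes "\<And>i. i \<in> I \<Longrightarrow> X i \<in> L2 M"
  shows "L2norm M (\<lambda>\<omega>. \<Sum>i\<in>I. X i \<omega>) \<le> (\<Sum>i\<in>I. L2norm M (X i))"
  using assms
proof (induction I rule: infinite_finite_induct)
  case (insert i I)
  then show ?case
    using L2norm_add_le[of "X i" M "\<lambda>\<omega>. \<Sum>i\<in>I. X i \<omega>"] L2_sum[of I X M] by auto
qed auto

lemma L2norm_cong_AE:
  assumes "X \<in> borel_measurable M" "Y \<in> borel_measurable M" "AE \<omega> in M. X \<omega> = Y \<omega>"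
  shows "L2norm M X = L2norm M Y"
  unfolding L2norm_def using assms by (intro arg_cong[where f = sqrt] integral_cong_AE) auto

lemma L2_cong_AE:
  assumes "X \<in> L2 M" "Y \<in> borel_measurable M" "AE \<omega> in M. X \<omega> = Y \<omega>"
  shows "Y \<in> L2 M"
proof -
  have "integrable M (\<lambda>\<omega>. (norm (X \<omega>))\<^sup>2) \<longleftrightarrow> integrable M (\<lambda>\<omega>. (norm (Y \<omega>))\<^sup>2)"
    using assms L2_measurable[OF assms(1)] by (intro integrable_cong_AE) auto
  then show ?thesis using assms by (auto simp: L2_def)
qed

lemma L2_distr_iff:
  assumes [measurable]: "f \<in> measurable M N" "X \<in> borel_measurable N"
  shows "X \<in> L2 (distr M N f) \<longleftrightarrow> (\<lambda>\<omega>. X (f \<omega>)) \<in> L2 M"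
  by (auto simp: L2_def integrable_distr_eq)

lemma L2norm_distr:
  assumes [measurable]: "f \<in> measurable M N" "X \<in> borel_measurable N"
  shows "L2norm (distr M N f) X = L2norm M (\<lambda>\<omega>. X (f \<omega>))"
  by (simp add: L2norm_def integral_distr)

lemma borel_measurable_fst [measurable (raw)]:
  fixes f :: "'b \<Rightarrow> 'c::topological_space \<times> 'd::topological_space"
  assumes "f \<in> borel_measurable M"
  shows "(\<lambda>x. fst (f x)) \<in> borel_measurable M"
  by (rule measurable_compose[OF assms borel_measurable_continuous_onI]) (intro continuous_intros)

lemma borel_measurable_snd [measurable (raw)]:
  fixes f :: "'b \<Rightarrow> 'c::topological_space \<times> 'd::topological_space"
  assumes "f \<in> borel_measurable M"
  shows "(\<lambda>x. snd (f x)) \<in> borel_measurable M"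
  by (rule measurable_compose[OF assms borel_measurable_continuous_onI]) (intro continuous_intros)

lemma P2_imp_L2:
  fixes \<Phi> :: "('a::{real_normed_vector,second_countable_topology} \<times> 'a) measure"
  assumes "\<Phi> \<in> P2"
  shows "fst \<in> L2 \<Phi>" "snd \<in> L2 \<Phi>"
proof -
  have [measurable_cong]: "sets \<Phi> = sets borel" using assms by (simp add: P2_def)
  have "integrable \<Phi> (\<lambda>p. (norm p)\<^sup>2)"
    using assms by (intro integrableI_bounded) (auto simp: P2_def)
  then have "integrable \<Phi> (\<lambda>p. (norm (fst p))\<^sup>2)" "integrable \<Phi> (\<lambda>p. (norm (snd p))\<^sup>2)"
    by (rule Bochner_Integration.integrable_bound;
        auto intro!: AE_I2 power_mono norm_fst_le norm_snd_le)+
  then show "fst \<in> L2 \<Phi>" "snd \<in> L2 \<Phi>" by (auto simp: L2_def)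
qed

lemma emeasure_distr_eq_nn_integral:
  assumes "f \<in> measurable M N" "S \<in> sets N"
  shows "emeasure (distr M N f) S = (\<integral>\<^sup>+x. indicator S (f x) \<partial>M)"
proof -
  have "emeasure (distr M N f) S = (\<integral>\<^sup>+y. indicator S y \<partial>distr M N f)" using assms by simp
  also have "\<dots> = (\<integral>\<^sup>+x. indicator S (f x) \<partial>M)" using assms by (intro nn_integral_distr) auto
  finally show ?thesis .
qed

lemma distr_eqI_nn_integral:
  assumes f: "f \<in> measurable M N" and sets: "sets K = sets N"
    and eq: "\<And>S. S \<in> sets N \<Longrightarrow> (\<integral>\<^sup>+x. indicator S (f x) \<partial>M) = emeasure K S"
  shows "distr M N f = K"
  by (rule measure_eqI) (simp_all add: emeasure_distr_eq_nn_integral f sets eq)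

definition measure_preserving :: "'b measure \<Rightarrow> 'c measure \<Rightarrow> ('b \<Rightarrow> 'c) \<Rightarrow> bool" where
  "measure_preserving M N f \<longleftrightarrow> f \<in> measurable M N \<and> distr M N f = N"

context
  fixes M :: "'b measure" and N :: "'c measure" and f :: "'b \<Rightarrow> 'c"
  assumes f: "measure_preserving M N f"
begin

lemma distr_measure_preserving:
  "X \<in> measurable N K \<Longrightarrow> distr M K (\<lambda>\<omega>. X (f \<omega>)) = distr N K X"
  using f distr_distr[of X N K f M] by (simp add: measure_preserving_def comp_def)

lemma L2_measure_preserving: "X \<in> L2 N \<Longrightarrow> (\<lambda>\<omega>. X (f \<omega>)) \<in> L2 M"
  using f L2_distr_iff[of f M N X] by (simp add: measure_preserving_def L2_measurable)

lemma L2norm_measure_preserving: "X \<in> borel_measurable N \<Longrightarrow> L2norm M (\<lambda>\<omega>. X (f \<omega>)) = L2norm N X"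
  using f L2norm_distr[of f M N X] by (simp add: measure_preserving_def)

lemma L2inner_measure_preserving:
  fixes X Y :: "'c \<Rightarrow> 'a::{real_inner,second_countable_topology}"
  assumes [measurable]: "X \<in> borel_measurable N" "Y \<in> borel_measurable N"
  shows "L2inner M (\<lambda>\<omega>. X (f \<omega>)) (\<lambda>\<omega>. Y (f \<omega>)) = L2inner N X Y"
  using f integral_distr[of f M N "\<lambda>\<omega>. inner (X \<omega>) (Y \<omega>)"]
  by (simp add: measure_preserving_def L2inner_def)

end

section \<open>Convergence of square-integrable random variables\<close>

lemma L2norm_add_liminf_ge:
  fixes X :: "nat \<Rightarrow> 'b \<Rightarrow> 'a::{real_inner,second_countable_topology}"
  assumes X: "\<And>h. X h \<in> L2 M" and Y: "Y \<in> L2 M"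
    and lim: "AE \<omega> in M. (\<lambda>h. X h \<omega>) \<longlonglongrightarrow> Y \<omega>"
  shows "ennreal (4 * (L2norm M Y)\<^sup>2) \<le> liminf (\<lambda>h. ennreal ((L2norm M (\<lambda>\<omega>. X h \<omega> + Y \<omega>))\<^sup>2))"
proof -
  note [measurable] = L2_measurable[OF X] L2_measurable[OF Y]
  have "ennreal (4 * (L2norm M Y)\<^sup>2) = (\<integral>\<^sup>+\<omega>. ennreal ((norm (2 *\<^sub>R Y \<omega>))\<^sup>2) \<partial>M)"
    unfolding nn_integral_norm_power2_eq_L2norm[OF L2_scaleR[OF Y]]
    by (simp add: L2norm_scaleR power_mult_distrib)
  also have "\<dots> = (\<integral>\<^sup>+\<omega>. liminf (\<lambda>h. ennreal ((norm (X h \<omega> + Y \<omega>))\<^sup>2)) \<partial>M)"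
    using lim
  proof (intro nn_integral_cong_AE, eventually_elim)
    case (elim \<omega>)
    have "(\<lambda>h. ennreal ((norm (X h \<omega> + Y \<omega>))\<^sup>2)) \<longlonglongrightarrow> ennreal ((norm (Y \<omega> + Y \<omega>))\<^sup>2)"
      by (intro tendsto_ennrealI tendsto_power tendsto_norm tendsto_add elim tendsto_const)
    from lim_imp_Liminf[OF _ this] show ?case by (simp add: scaleR_2)
  qed
  also have "\<dots> \<le> liminf (\<lambda>h. \<integral>\<^sup>+\<omega>. ennreal ((norm (X h \<omega> + Y \<omega>))\<^sup>2) \<partial>M)"
    by (rule nn_integral_liminf) measurable
  finally show ?thesis
    unfolding nn_integral_norm_power2_eq_L2norm[OF L2_add[OF X Y]] .
qed

lemma eventually_gt_if_le_liminf:
  fixes a :: "nat \<Rightarrow> real"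
  assumes "ennreal B \<le> liminf (\<lambda>h. ennreal (a h))" "\<And>h. 0 \<le> a h" "c < B"
  shows "\<forall>\<^sub>F h in sequentially. c < a h"
proof (cases "c < 0")
  case True
  then show ?thesis using less_le_trans[OF _ assms(2)] by simp
next
  case False
  then have "ennreal c < ennreal B" using \<open>c < B\<close> by (intro ennreal_lessI) auto
  also note assms(1)
  finally have "\<forall>\<^sub>F h in sequentially. ennreal c < ennreal (a h)" by (rule less_LiminfD)
  then show ?thesis using False by (auto simp: ennreal_less_iff)
qed

text \<open>By the parallelogram identity it suffices to bound \<open>\<parallel>X\<^sub>h + Y\<parallel>\<close> from below.\<close>

lemma AE_L2norm_tendsto_imp_L2_tendsto:
  fixes X :: "nat \<Rightarrow> 'b \<Rightarrow> 'a::{real_inner,second_countable_topology}"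
  assumes X: "\<And>h. X h \<in> L2 M" and Y: "Y \<in> L2 M"
    and lim: "AE \<omega> in M. (\<lambda>h. X h \<omega>) \<longlonglongrightarrow> Y \<omega>"
    and norms: "(\<lambda>h. L2norm M (X h)) \<longlonglongrightarrow> L2norm M Y"
  shows "(\<lambda>h. L2norm M (\<lambda>\<omega>. X h \<omega> - Y \<omega>)) \<longlonglongrightarrow> 0"
proof -
  define B where "B = 4 * (L2norm M Y)\<^sup>2"
  define a where "a h = (L2norm M (\<lambda>\<omega>. X h \<omega> + Y \<omega>))\<^sup>2" for h
  define c where "c h = 2 * (L2norm M (X h))\<^sup>2 + 2 * (L2norm M Y)\<^sup>2" for h
  have parallelogram: "(L2norm M (\<lambda>\<omega>. X h \<omega> - Y \<omega>))\<^sup>2 = c h - a h" for h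
    using L2norm_add_power2[OF X[of h] Y] L2norm_add_power2[OF X[of h] L2_scaleR[OF Y, of "-1"]]
    by (simp add: a_def c_def L2norm_scaleR[of M "-1" Y, simplified]
        L2inner_scaleR_right[of M _ "-1" Y, simplified])
  have "(\<lambda>h. (L2norm M (\<lambda>\<omega>. X h \<omega> - Y \<omega>))\<^sup>2) \<longlonglongrightarrow> 0"
  proof (rule order_tendstoI)
    fix e :: real assume "0 < e"
    have "c \<longlonglongrightarrow> B"
      unfolding c_def B_def using norms by (auto intro!: tendsto_eq_intros)
    then have "\<forall>\<^sub>F h in sequentially. c h < B + e / 2"
      by (rule order_tendstoD) (use \<open>0 < e\<close> in simp)
    moreover have "\<forall>\<^sub>F h in sequentially. B - e / 2 < a h"
      unfolding a_def using \<open>0 < e\<close> L2norm_add_liminf_ge[OF X Y lim]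
      by (intro eventually_gt_if_le_liminf[of B]) (simp_all add: B_def)
    ultimately show "\<forall>\<^sub>F h in sequentially. (L2norm M (\<lambda>\<omega>. X h \<omega> - Y \<omega>))\<^sup>2 < e"
      by eventually_elim (simp add: parallelogram)
  qed (auto intro!: always_eventually elim: less_le_trans)
  from tendsto_real_sqrt[OF this] show ?thesis by simp
qed

lemma joint_law_in_Gamma:
  fixes X :: "'b \<Rightarrow> 'c::second_countable_topology" and Y :: "'b \<Rightarrow> 'd::second_countable_topology"
  assumes "prob_space P" and [measurable]: "X \<in> borel_measurable P" "Y \<in> borel_measurable P"
  shows "distr P borel (\<lambda>\<omega>. (X \<omega>, Y \<omega>)) \<in> Gamma (distr P borel X) (distr P borel Y)"
  using assms(1) by (auto simp: Gamma_def distr_distr comp_def intro: prob_space.prob_space_distr)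

lemma L2_law_marginal:
  fixes X :: "'b \<Rightarrow> 'a::{real_normed_vector,second_countable_topology}"
  assumes X: "X \<in> L2 P" and f: "f \<in> borel_measurable \<gamma>" "distr \<gamma> borel f = distr P borel X"
  shows "f \<in> L2 \<gamma>" "L2norm \<gamma> f = L2norm P X"
proof -
  have id: "(\<lambda>x::'a. x) \<in> borel_measurable borel" by simp
  note X' = L2_measurable[OF X]
  show "f \<in> L2 \<gamma>"
    using L2_distr_iff[OF f(1) id] L2_distr_iff[OF X' id] X f(2) by simp
  show "L2norm \<gamma> f = L2norm P X"
    using L2norm_distr[OF f(1) id] L2norm_distr[OF X' id] f(2) by simp
qed

lemma abs_L2norm_diff_le_W2:
  fixes X Y :: "'b \<Rightarrow> 'a::{real_inner,second_countable_topology}"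
  assumes P: "prob_space P" and X: "X \<in> L2 P" and Y: "Y \<in> L2 P"
  shows "\<bar>L2norm P X - L2norm P Y\<bar> \<le> W2 (distr P borel X) (distr P borel Y)"
proof -
  define costs where
    "costs = {(\<integral>p. (norm (fst p - snd p))\<^sup>2 \<partial>\<gamma>) | \<gamma>. \<gamma> \<in> Gamma (distr P borel X) (distr P borel Y)}"
  have "\<bar>L2norm P X - L2norm P Y\<bar>\<^sup>2 \<le> Inf costs"
  proof (rule cInf_greatest)
    show "costs \<noteq> {}"
      using joint_law_in_Gamma[OF P L2_measurable[OF X] L2_measurable[OF Y]]
      by (auto simp: costs_def)
    fix c assume "c \<in> costs"
    then obtain \<gamma> where \<gamma>: "sets \<gamma> = sets borel"
        "distr \<gamma> borel fst = distr P borel X" "distr \<gamma> borel snd = distr P borel Y"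
      and c: "c = (L2norm \<gamma> (\<lambda>p. fst p - snd p))\<^sup>2"
      by (auto simp: costs_def Gamma_def L2norm_power2)
    have [measurable_cong]: "sets \<gamma> = sets borel" by fact
    have "fst \<in> borel_measurable \<gamma>" "snd \<in> borel_measurable \<gamma>" by measurable
    note fst = L2_law_marginal[OF X this(1) \<gamma>(2)] and snd = L2_law_marginal[OF Y this(2) \<gamma>(3)]
    show "\<bar>L2norm P X - L2norm P Y\<bar>\<^sup>2 \<le> c"
      unfolding c using abs_L2norm_diff_le[OF fst(1) snd(1)] fst(2) snd(2)
      by (intro power_mono) auto
  qed
  from real_sqrt_le_mono[OF this] show ?thesis
    unfolding W2_def costs_def by simp
qed

lemma AE_W2_tendsto_imp_L2_tendsto:
  fixes X :: "nat \<Rightarrow> 'b \<Rightarrow> 'a::{real_inner,second_countable_topology}"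
  assumes P: "prob_space P" and X: "\<And>h. X h \<in> L2 P" and Y: "Y \<in> L2 P"
    and lim: "AE \<omega> in P. (\<lambda>h. X h \<omega>) \<longlonglongrightarrow> Y \<omega>"
    and W: "(\<lambda>h. W2 (distr P borel (X h)) (distr P borel Y)) \<longlonglongrightarrow> 0"
  shows "(\<lambda>h. L2norm P (\<lambda>\<omega>. X h \<omega> - Y \<omega>)) \<longlonglongrightarrow> 0"
proof (rule AE_L2norm_tendsto_imp_L2_tendsto[OF X Y lim])
  have "(\<lambda>h. L2norm P (X h) - L2norm P Y) \<longlonglongrightarrow> 0"
    by (rule Lim_null_comparison[OF _ W]) (simp add: abs_L2norm_diff_le_W2[OF P X Y])
  then show "(\<lambda>h. L2norm P (X h)) \<longlonglongrightarrow> L2norm P Y" by (rule LIM_zero_cancel)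
qed

section \<open>Gronwall's inequality for Lipschitz functions\<close>

lemma negligible_lipschitz_image:
  fixes h :: "real \<Rightarrow> real"
  assumes lip: "C-lipschitz_on S h" and "N \<subseteq> S" "negligible N"
  shows "negligible (h ` N)"
proof (rule negligible_locally_Lipschitz_image)
  fix t assume "t \<in> N"
  then have "norm (h s - h t) \<le> C * norm (s - t)" if "s \<in> N" for s
    using that lipschitz_on_normD[OF lip] \<open>N \<subseteq> S\<close> by blast
  then show "\<exists>U B. open U \<and> t \<in> U \<and> (\<forall>s\<in>N \<inter> U. norm (h s - h t) \<le> B * norm (s - t))"
    by (intro exI[of _ UNIV] exI[of _ C]) simp
qed (use assms in simp_all)

lemma continuous_last_time_at_level:
  fixes h :: "real \<Rightarrow> real"
  assumes cont: "continuous_on {a..b} h" and "a \<le> b" "h a < y" "y < h b"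
  obtains t where "t \<in> {a<..<b}" "h t = y" "\<And>s. s \<in> {t<..b} \<Longrightarrow> y < h s"
proof -
  have "compact ({a..b} \<inter> h -` {..y})"
    unfolding compact_eq_bounded_closed using cont
    by (auto intro: continuous_closed_preimage bounded_subset[OF bounded_closed_interval])
  then obtain t where t: "t \<in> {a..b}" "h t \<le> y" "\<And>s. s \<in> {a..b} \<Longrightarrow> h s \<le> y \<Longrightarrow> s \<le> t"
    using compact_attains_sup[of "{a..b} \<inter> h -` {..y}"] assms(2,3) by force
  have "continuous_on {t..b} h" by (rule continuous_on_subset[OF cont]) (use t in auto)
  then obtain s where "t \<le> s" "s \<le> b" "h s = y"
    using IVT'[of h t y b] t assms by auto
  moreover from this have "s \<le> t" using t by simp
  ultimately have "h t = y" by simp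
  moreover from this have "t \<in> {a<..<b}" using t(1) assms by (auto simp: less_le)
  moreover have "y < h s" if "s \<in> {t<..b}" for s using t(1) t(3)[of s] that by force
  ultimately show thesis by (intro that)
qed

text \<open>Zygmund's argument: a Lipschitz function maps the exceptional null set to a null set, so if
  \<open>h a < h b\<close>, some level \<open>y\<close> in between is attained only outside of it. At the last time \<open>h\<close> is at
  most \<open>y\<close>, its right derivative cannot be negative.\<close>

lemma lipschitz_AE_right_deriv_neg_imp_le:
  fixes h :: "real \<Rightarrow> real"
  assumes "a \<le> b" and lip: "C-lipschitz_on {a..b} h"
    and der: "AE t in lborel. t \<in> {a<..<b} \<longrightarrow> (\<exists>d<0. (h has_real_derivative d) (at_right t))"
  shows "h b \<le> h a"
proof (rule ccontr)
  assume "\<not> h b \<le> h a"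
  obtain N where N: "N \<in> null_sets lborel"
    and "{t. \<not> (t \<in> {a<..<b} \<longrightarrow> (\<exists>d<0. (h has_real_derivative d) (at_right t)))} \<subseteq> N"
    using der by (auto simp: eventually_ae_filter)
  then have deriv: "\<exists>d<0. (h has_real_derivative d) (at_right t)" if "t \<in> {a<..<b}" "t \<notin> N" for t
    using that by blast
  have "negligible (h ` (N \<inter> {a..b}))"
    using N by (intro negligible_lipschitz_image[OF lip] negligible_Int)
      (auto simp: negligible_iff_null_sets null_sets_completionI)
  moreover have "\<not> negligible {h a<..<h b}"
    using negligible_interval(2)[of "h a" "h b"] \<open>\<not> h b \<le> h a\<close> by (simp add: box_real)
  ultimately obtain y where y: "h a < y" "y < h b" "y \<notin> h ` (N \<inter> {a..b})"
    using negligible_subset by (metis greaterThanLessThan_iff subsetI)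
  obtain t where t: "t \<in> {a<..<b}" "h t = y" "\<And>s. s \<in> {t<..b} \<Longrightarrow> y < h s"
    using continuous_last_time_at_level[OF lipschitz_on_continuous_on[OF lip] \<open>a \<le> b\<close> y(1,2)]
    by blast
  then obtain d where d: "d < 0" "(h has_real_derivative d) (at_right t)"
    using deriv y(3) by force
  have "\<forall>\<^sub>F s in at_right t. (h s - h t) / (s - t) < 0"
    using d by (intro order_tendstoD(2)[of _ d]) (auto simp: has_field_derivative_iff)
  moreover have "\<forall>\<^sub>F s in at_right t. s \<in> {t<..<b}"
    using t(1) by (intro eventually_at_right_real) auto
  ultimately have "\<forall>\<^sub>F s in at_right t. False"
  proof eventually_elim
    case (elim s)
    then show ?case using t(2) t(3)[of s] by (simp add: divide_less_0_iff)
  qed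
  then show False by simp
qed

lemma lipschitz_AE_right_deriv_nonpos_imp_le:
  fixes g :: "real \<Rightarrow> real"
  assumes "a \<le> b" and lip: "C-lipschitz_on {a..b} g"
    and der: "AE t in lborel. t \<in> {a<..<b} \<longrightarrow> (\<exists>d\<le>0. (g has_real_derivative d) (at_right t))"
  shows "g b \<le> g a"
proof (rule field_le_epsilon)
  fix e :: real assume "0 < e"
  define \<epsilon> where "\<epsilon> = e / (b - a + 1)"
  have "0 < \<epsilon>" "\<epsilon> * (b - a) \<le> e" using \<open>0 < e\<close> \<open>a \<le> b\<close> by (auto simp: \<epsilon>_def field_simps)
  have "g b - \<epsilon> * b \<le> g a - \<epsilon> * a"
  proof (rule lipschitz_AE_right_deriv_neg_imp_le[OF \<open>a \<le> b\<close>])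
    show "(C + \<bar>\<epsilon>\<bar> * 1)-lipschitz_on {a..b} (\<lambda>t. g t - \<epsilon> * t)"
      by (intro lipschitz_intros lip)
    show "AE t in lborel. t \<in> {a<..<b} \<longrightarrow>
        (\<exists>d<0. ((\<lambda>t. g t - \<epsilon> * t) has_real_derivative d) (at_right t))"
      using der
    proof eventually_elim
      case (elim t)
      have "((\<lambda>t. g t - \<epsilon> * t) has_real_derivative d - \<epsilon>) (at_right t)"
        if "(g has_real_derivative d) (at_right t)" for d
        using that by (auto intro!: derivative_eq_intros)
      then show ?case using elim \<open>0 < \<epsilon>\<close> by (metis diff_less_0_iff_less order_le_less_trans)
    qed
  qed
  then show "g b \<le> g a + e" using \<open>\<epsilon> * (b - a) \<le> e\<close> by (simp add: algebra_simps)
qed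

lemma lipschitz_on_mult_bounded:
  fixes f g :: "'c::metric_space \<Rightarrow> real"
  assumes f: "A-lipschitz_on S f" "\<And>x. x \<in> S \<Longrightarrow> \<bar>f x\<bar> \<le> F"
    and g: "B-lipschitz_on S g" "\<And>x. x \<in> S \<Longrightarrow> \<bar>g x\<bar> \<le> G" and "0 \<le> F" "0 \<le> G"
  shows "(F * B + G * A)-lipschitz_on S (\<lambda>x. f x * g x)"
proof (rule lipschitz_onI)
  fix x y assume xy: "x \<in> S" "y \<in> S"
  have "dist (f x * g x) (f y * g y) = \<bar>f x * (g x - g y) + g y * (f x - f y)\<bar>"
    by (simp add: dist_real_def algebra_simps)
  also have "\<dots> \<le> \<bar>f x\<bar> * \<bar>g x - g y\<bar> + \<bar>g y\<bar> * \<bar>f x - f y\<bar>"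
    by (metis abs_mult abs_triangle_ineq)
  also have "\<dots> \<le> F * (B * dist x y) + G * (A * dist x y)"
    using f(2)[OF xy(1)] g(2)[OF xy(2)] lipschitz_onD[OF f(1) xy] lipschitz_onD[OF g(1) xy]
      \<open>0 \<le> F\<close> \<open>0 \<le> G\<close>
    by (intro add_mono mult_mono) (auto simp: dist_real_def)
  finally show "dist (f x * g x) (f y * g y) \<le> (F * B + G * A) * dist x y"
    by (simp add: algebra_simps)
qed (use lipschitz_on_nonneg[OF f(1)] lipschitz_on_nonneg[OF g(1)] assms in simp)

lemma lipschitz_on_exp_decay:
  fixes a :: real
  assumes "0 \<le> a"
  shows "a-lipschitz_on {0..} (\<lambda>t. exp (- a * t))"
proof (rule bounded_derivative_imp_lipschitz)
  fix t :: real assume "t \<in> {0..}"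
  show "((\<lambda>t. exp (- a * t)) has_derivative (\<lambda>h. h * (- a * exp (- a * t)))) (at t within {0..})"
    by (auto intro!: derivative_eq_intros)
  have "exp (- a * t) \<le> 1" using \<open>t \<in> {0..}\<close> \<open>0 \<le> a\<close> by simp
  then have "\<bar>- a * exp (- a * t)\<bar> \<le> a" using \<open>0 \<le> a\<close> by (simp add: abs_mult mult_left_le)
  then have "norm (h * (- a * exp (- a * t))) \<le> a * norm h" for h
    using mult_right_mono[of "\<bar>- a * exp (- a * t)\<bar>" a "\<bar>h\<bar>"] by (simp add: abs_mult ac_simps)
  then show "onorm (\<lambda>h. h * (- a * exp (- a * t))) \<le> a"
    by (rule onorm_bound[OF \<open>0 \<le> a\<close>])
qed (use assms in auto)

lemma lipschitz_on_abs_le: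
  fixes u :: "real \<Rightarrow> real"
  assumes lip: "C-lipschitz_on {a..b} u" and s: "s \<in> {a..b}"
  shows "\<bar>u s\<bar> \<le> \<bar>u a\<bar> + C * (b - a)"
proof -
  have "\<bar>u s - u a\<bar> \<le> C * (s - a)" using lipschitz_onD[OF lip, of s a] s
    by (simp add: dist_real_def)
  also have "\<dots> \<le> C * (b - a)" using s lipschitz_on_nonneg[OF lip] by (intro mult_left_mono) auto
  finally show ?thesis by linarith
qed

lemma lipschitz_Gronwall:
  fixes u :: "real \<Rightarrow> real"
  assumes lip: "C-lipschitz_on {0..t} u"
    and der: "AE s in lborel. s \<in> {0<..<t} \<longrightarrow>
      (\<exists>d\<le>a * u s + b. (u has_real_derivative d) (at_right s))"
    and "0 \<le> a" "0 \<le> b" "0 \<le> t"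
  shows "u t \<le> exp (a * t) * (u 0 + b * t)"
proof -
  define g where "g = (\<lambda>s. exp (- a * s) * u s - b * s)"
  have deriv: "\<exists>d\<le>0. (g has_real_derivative d) (at_right s)"
    if s: "0 < s" and d: "d \<le> a * u s + b" "(u has_real_derivative d) (at_right s)" for s d
  proof (intro exI conjI)
    have "((\<lambda>s. exp (- a * s)) has_real_derivative exp (- a * s) * - a) (at_right s)"
      "((\<lambda>s. b * s) has_real_derivative b) (at_right s)"
      by (auto intro!: derivative_eq_intros)
    from DERIV_diff[OF DERIV_mult[OF this(1) d(2)] this(2)]
    show "(g has_real_derivative exp (- a * s) * (d - a * u s) - b) (at_right s)"
      unfolding g_def by (rule DERIV_cong) (simp add: algebra_simps)
    have "exp (- a * s) * (d - a * u s) \<le> exp (- a * s) * b"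
      using d(1) by (intro mult_left_mono) auto
    also have "\<dots> \<le> b"
      using s \<open>0 \<le> a\<close> \<open>0 \<le> b\<close> by (intro mult_left_le_one_le) auto
    finally show "exp (- a * s) * (d - a * u s) - b \<le> 0" by simp
  qed
  have "g t \<le> g 0"
  proof (rule lipschitz_AE_right_deriv_nonpos_imp_le[OF \<open>0 \<le> t\<close>])
    have exp_u: "(1 * C + (\<bar>u 0\<bar> + C * t) * a)-lipschitz_on {0..t} (\<lambda>s. exp (- a * s) * u s)"
      using lip lipschitz_on_abs_le[OF lip] \<open>0 \<le> a\<close> \<open>0 \<le> t\<close> lipschitz_on_nonneg[OF lip]
      by (intro lipschitz_on_mult_bounded lipschitz_on_subset[OF lipschitz_on_exp_decay]) auto
    show "(1 * C + (\<bar>u 0\<bar> + C * t) * a + \<bar>b\<bar> * 1)-lipschitz_on {0..t} g"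
      unfolding g_def by (intro lipschitz_intros exp_u)
    show "AE s in lborel. s \<in> {0<..<t} \<longrightarrow> (\<exists>d\<le>0. (g has_real_derivative d) (at_right s))"
      using der by eventually_elim (use deriv in auto)
  qed
  then show ?thesis by (simp add: g_def exp_minus field_simps)
qed

section \<open>Lipschitz curves of random variables\<close>

definition L2_lipschitz_on ::
    "'b measure \<Rightarrow> real \<Rightarrow> real set \<Rightarrow> (real \<Rightarrow> 'b \<Rightarrow> 'a::{real_normed_vector,second_countable_topology})
        \<Rightarrow> bool" where
  "L2_lipschitz_on M C S X \<longleftrightarrow> 0 \<le> C \<and> (\<forall>t\<in>S. X t \<in> L2 M) \<and>
    (\<forall>s\<in>S. \<forall>t\<in>S. L2norm M (\<lambda>\<omega>. X s \<omega> - X t \<omega>) \<le> C * \<bar>s - t\<bar>)"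

definition has_L2_right_deriv ::
    "'b measure \<Rightarrow> (real \<Rightarrow> 'b \<Rightarrow> 'a::{real_normed_vector,second_countable_topology})
      \<Rightarrow> ('b \<Rightarrow> 'a) \<Rightarrow> real \<Rightarrow> bool" where
  "has_L2_right_deriv M X V t \<longleftrightarrow> V \<in> L2 M \<and> X t \<in> L2 M \<and> (\<forall>\<^sub>F s in at_right t. X s \<in> L2 M) \<and>
    ((\<lambda>s. L2norm M (\<lambda>\<omega>. (1 / (s - t)) *\<^sub>R (X s \<omega> - X t \<omega>) - V \<omega>)) \<longlongrightarrow> 0) (at_right t)"

lemma L2_lipschitz_onD:
  assumes "L2_lipschitz_on M C S X"
  shows "0 \<le> C"
    and "t \<in> S \<Longrightarrow> X t \<in> L2 M"
    and "s \<in> S \<Longrightarrow> t \<in> S \<Longrightarrow> L2norm M (\<lambda>\<omega>. X s \<omega> - X t \<omega>) \<le> C * \<bar>s - t\<bar>"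
  using assms by (auto simp: L2_lipschitz_on_def)

lemma L2_lipschitz_on_diff:
  fixes X Y :: "real \<Rightarrow> 'b \<Rightarrow> 'a::{real_inner,second_countable_topology}"
  assumes X: "L2_lipschitz_on M A S X" and Y: "L2_lipschitz_on M B S Y"
  shows "L2_lipschitz_on M (A + B) S (\<lambda>t \<omega>. X t \<omega> - Y t \<omega>)"
  unfolding L2_lipschitz_on_def
proof (intro conjI ballI)
  note XD = L2_lipschitz_onD[OF X] and YD = L2_lipschitz_onD[OF Y]
  show "0 \<le> A + B" using XD(1) YD(1) by simp
  show "(\<lambda>\<omega>. X t \<omega> - Y t \<omega>) \<in> L2 M" if "t \<in> S" for t
    using that by (intro L2_diff XD YD)
  fix s t assume st: "s \<in> S" "t \<in> S"
  have "L2norm M (\<lambda>\<omega>. X s \<omega> - Y s \<omega> - (X t \<omega> - Y t \<omega>))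
      = L2norm M (\<lambda>\<omega>. (X s \<omega> - X t \<omega>) - (Y s \<omega> - Y t \<omega>))"
    by (simp add: algebra_simps)
  also have "\<dots> \<le> L2norm M (\<lambda>\<omega>. X s \<omega> - X t \<omega>) + L2norm M (\<lambda>\<omega>. Y s \<omega> - Y t \<omega>)"
    using st by (intro L2norm_diff_le L2_diff XD YD)
  also have "\<dots> \<le> (A + B) * \<bar>s - t\<bar>"
    using XD(3)[OF st] YD(3)[OF st] by (simp add: distrib_right)
  finally show "L2norm M (\<lambda>\<omega>. X s \<omega> - Y s \<omega> - (X t \<omega> - Y t \<omega>)) \<le> (A + B) * \<bar>s - t\<bar>" .
qed

lemma L2_lipschitz_on_measure_preserving:
  assumes f: "measure_preserving M N f" and X: "L2_lipschitz_on N C S X"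
  shows "L2_lipschitz_on M C S (\<lambda>t \<omega>. X t (f \<omega>))"
  unfolding L2_lipschitz_on_def
proof (intro conjI ballI)
  note XD = L2_lipschitz_onD[OF X]
  show "0 \<le> C" by (rule XD)
  show "(\<lambda>\<omega>. X t (f \<omega>)) \<in> L2 M" if "t \<in> S" for t
    using that by (intro L2_measure_preserving[OF f] XD)
  fix s t assume st: "s \<in> S" "t \<in> S"
  then have "L2norm M (\<lambda>\<omega>. X s (f \<omega>) - X t (f \<omega>)) = L2norm N (\<lambda>\<omega>. X s \<omega> - X t \<omega>)"
    by (intro L2norm_measure_preserving[OF f] L2_measurable L2_diff XD)
  then show "L2norm M (\<lambda>\<omega>. X s (f \<omega>) - X t (f \<omega>)) \<le> C * \<bar>s - t\<bar>"
    using XD(3)[OF st] by simp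
qed

lemma L2_lipschitz_on_cong_AE:
  assumes X: "L2_lipschitz_on M C S X" and Y: "\<And>t. t \<in> S \<Longrightarrow> Y t \<in> borel_measurable M"
    and eq: "\<And>t. t \<in> S \<Longrightarrow> AE \<omega> in M. X t \<omega> = Y t \<omega>"
  shows "L2_lipschitz_on M C S Y"
  unfolding L2_lipschitz_on_def
proof (intro conjI ballI)
  note XD = L2_lipschitz_onD[OF X]
  show "0 \<le> C" by (rule XD)
  show "Y t \<in> L2 M" if "t \<in> S" for t
    using L2_cong_AE[OF XD(2) Y eq] that by simp
  fix s t assume st: "s \<in> S" "t \<in> S"
  have "L2norm M (\<lambda>\<omega>. Y s \<omega> - Y t \<omega>) = L2norm M (\<lambda>\<omega>. X s \<omega> - X t \<omega>)"
  proof (rule L2norm_cong_AE)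
    show "AE \<omega> in M. Y s \<omega> - Y t \<omega> = X s \<omega> - X t \<omega>"
      using eq[OF st(1)] eq[OF st(2)] by eventually_elim simp
  qed (use st in \<open>auto intro!: borel_measurable_diff Y L2_measurable[OF XD(2)]\<close>)
  then show "L2norm M (\<lambda>\<omega>. Y s \<omega> - Y t \<omega>) \<le> C * \<bar>s - t\<bar>"
    using XD(3)[OF st] by simp
qed

lemma lipschitz_on_L2norm:
  fixes X :: "real \<Rightarrow> 'b \<Rightarrow> 'a::{real_inner,second_countable_topology}"
  assumes X: "L2_lipschitz_on M C S X"
  shows "C-lipschitz_on S (\<lambda>t. L2norm M (X t))"
proof (rule lipschitz_onI)
  fix s t assume "s \<in> S" "t \<in> S"
  with L2_lipschitz_onD[OF X] show "dist (L2norm M (X s)) (L2norm M (X t)) \<le> C * dist s t"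
    unfolding dist_real_def by (blast intro: order_trans abs_L2norm_diff_le)
qed (rule L2_lipschitz_onD(1)[OF X])

lemma has_L2_right_derivD:
  assumes "has_L2_right_deriv M X V t"
  shows "V \<in> L2 M" "X t \<in> L2 M" "\<forall>\<^sub>F s in at_right t. X s \<in> L2 M"
    "((\<lambda>s. L2norm M (\<lambda>\<omega>. (1 / (s - t)) *\<^sub>R (X s \<omega> - X t \<omega>) - V \<omega>)) \<longlongrightarrow> 0) (at_right t)"
  using assms by (simp_all add: has_L2_right_deriv_def)

lemma has_L2_right_deriv_diff:
  fixes X Y :: "real \<Rightarrow> 'b \<Rightarrow> 'a::{real_inner,second_countable_topology}"
  assumes X: "has_L2_right_deriv M X V t" and Y: "has_L2_right_deriv M Y W t"
  shows "has_L2_right_deriv M (\<lambda>s \<omega>. X s \<omega> - Y s \<omega>) (\<lambda>\<omega>. V \<omega> - W \<omega>) t"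
proof -
  note XD = has_L2_right_derivD[OF X] and YD = has_L2_right_derivD[OF Y]
  define err where "err X V s = (\<lambda>\<omega>. (1 / (s - t)) *\<^sub>R (X s \<omega> - X t \<omega>) - V \<omega>)"
    for X :: "real \<Rightarrow> 'b \<Rightarrow> 'a" and V s
  have err_diff: "err (\<lambda>s \<omega>. X s \<omega> - Y s \<omega>) (\<lambda>\<omega>. V \<omega> - W \<omega>) s = (\<lambda>\<omega>. err X V s \<omega> - err Y W s \<omega>)"
    for s
    by (simp add: err_def fun_eq_iff scaleR_right_diff_distrib)
  have "((\<lambda>s. L2norm M (err (\<lambda>s \<omega>. X s \<omega> - Y s \<omega>) (\<lambda>\<omega>. V \<omega> - W \<omega>) s)) \<longlongrightarrow> 0) (at_right t)"
  proof (rule Lim_null_comparison)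
    show "((\<lambda>s. L2norm M (err X V s) + L2norm M (err Y W s)) \<longlongrightarrow> 0) (at_right t)"
      using tendsto_add[OF XD(4) YD(4)] by (simp add: err_def)
    show "\<forall>\<^sub>F s in at_right t. norm (L2norm M (err (\<lambda>s \<omega>. X s \<omega> - Y s \<omega>) (\<lambda>\<omega>. V \<omega> - W \<omega>) s))
        \<le> L2norm M (err X V s) + L2norm M (err Y W s)"
      using XD(3) YD(3)
    proof eventually_elim
      case (elim s)
      then have "err X V s \<in> L2 M" "err Y W s \<in> L2 M"
        unfolding err_def using XD(1,2) YD(1,2) by (intro L2_intros; simp)+
      then show ?case unfolding err_diff by (simp add: L2norm_diff_le)
    qed
  qed
  moreover have "\<forall>\<^sub>F s in at_right t. (\<lambda>\<omega>. X s \<omega> - Y s \<omega>) \<in> L2 M"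
    using XD(3) YD(3) by eventually_elim (rule L2_diff)
  ultimately show ?thesis
    unfolding has_L2_right_deriv_def err_def by (intro conjI L2_diff XD(1,2) YD(1,2))
qed

lemma has_L2_right_deriv_measure_preserving:
  fixes X :: "real \<Rightarrow> 'c \<Rightarrow> 'a::{real_inner,second_countable_topology}"
  assumes f: "measure_preserving M N f" and X: "has_L2_right_deriv N X V t"
  shows "has_L2_right_deriv M (\<lambda>s \<omega>. X s (f \<omega>)) (\<lambda>\<omega>. V (f \<omega>)) t"
proof -
  note XD = has_L2_right_derivD[OF X]
  have "\<forall>\<^sub>F s in at_right t. L2norm N (\<lambda>\<omega>. (1 / (s - t)) *\<^sub>R (X s \<omega> - X t \<omega>) - V \<omega>)
      = L2norm M (\<lambda>\<omega>. (1 / (s - t)) *\<^sub>R (X s (f \<omega>) - X t (f \<omega>)) - V (f \<omega>))"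
    using XD(3)
  proof eventually_elim
    case (elim s)
    then have "(\<lambda>\<omega>. (1 / (s - t)) *\<^sub>R (X s \<omega> - X t \<omega>) - V \<omega>) \<in> L2 N"
      using XD(1,2) by (intro L2_intros)
    from L2norm_measure_preserving[OF f L2_measurable[OF this]] show ?case by simp
  qed
  from Lim_transform_eventually[OF XD(4) this] show ?thesis
    unfolding has_L2_right_deriv_def
    by (intro conjI L2_measure_preserving[OF f] XD(1,2) eventually_mono[OF XD(3)])
qed

lemma has_L2_right_deriv_affine:
  fixes X :: "real \<Rightarrow> 'b \<Rightarrow> 'a::{real_inner,second_countable_topology}"
  assumes X: "X t \<in> L2 M" and V: "V \<in> L2 M"
    and affine: "\<forall>\<^sub>F s in at_right t. X s = (\<lambda>\<omega>. X t \<omega> + (s - t) *\<^sub>R V \<omega>)"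
  shows "has_L2_right_deriv M X V t"
  unfolding has_L2_right_deriv_def
proof (intro conjI X V)
  show "\<forall>\<^sub>F s in at_right t. X s \<in> L2 M"
    using affine by eventually_elim (simp only:, intro L2_intros X V)
  have "\<forall>\<^sub>F s in at_right t. 0 = L2norm M (\<lambda>\<omega>. (1 / (s - t)) *\<^sub>R (X s \<omega> - X t \<omega>) - V \<omega>)"
    using affine eventually_at_right_less[of t] by eventually_elim simp
  then show "((\<lambda>s. L2norm M (\<lambda>\<omega>. (1 / (s - t)) *\<^sub>R (X s \<omega> - X t \<omega>) - V \<omega>)) \<longlongrightarrow> 0) (at_right t)"
    by (rule Lim_transform_eventually[OF tendsto_const])
qed

lemma L2_lipschitz_on_quotient_le:
  assumes X: "L2_lipschitz_on M C S X" and "s \<in> S" "t \<in> S"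
  shows "L2norm M (\<lambda>\<omega>. (1 / (s - t)) *\<^sub>R (X s \<omega> - X t \<omega>)) \<le> C"
proof (cases "s = t")
  case False
  then show ?thesis
    using L2_lipschitz_onD(3)[OF assms] unfolding L2norm_scaleR by (simp add: field_simps)
qed (simp add: L2_lipschitz_onD(1)[OF X])

lemma L2norm_right_deriv_le:
  fixes X :: "real \<Rightarrow> 'b \<Rightarrow> 'a::{real_inner,second_countable_topology}"
  assumes X: "L2_lipschitz_on M C {a..b} X" and t: "t \<in> {a..<b}"
    and V: "has_L2_right_deriv M X V t"
  shows "L2norm M V \<le> C"
proof (rule tendsto_lowerbound[OF _ _ trivial_limit_at_right_real])
  note VD = has_L2_right_derivD[OF V]
  let ?q = "\<lambda>s \<omega>. (1 / (s - t)) *\<^sub>R (X s \<omega> - X t \<omega>)"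
  show "((\<lambda>s. L2norm M (\<lambda>\<omega>. ?q s \<omega> - V \<omega>) + C) \<longlongrightarrow> C) (at_right t)"
    using tendsto_add[OF VD(4) tendsto_const] by simp
  have "\<forall>\<^sub>F s in at_right t. s \<in> {t<..<b}"
    using t by (intro eventually_at_right_real) auto
  then show "\<forall>\<^sub>F s in at_right t. L2norm M V \<le> L2norm M (\<lambda>\<omega>. ?q s \<omega> - V \<omega>) + C"
    using VD(3)
  proof eventually_elim
    case (elim s)
    have "?q s \<in> L2 M" using elim(2) VD(2) by (intro L2_intros)
    then have "L2norm M V \<le> L2norm M (\<lambda>\<omega>. ?q s \<omega> - V \<omega>) + L2norm M (?q s)"
      using L2norm_le_diff_add[OF VD(1)] L2norm_minus_commute[of M V] by simp
    moreover have "L2norm M (?q s) \<le> C"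
      using elim(1) t by (intro L2_lipschitz_on_quotient_le[OF X]) auto
    ultimately show ?case by linarith
  qed
qed

lemma has_L2_right_deriv_tendsto:
  fixes X :: "real \<Rightarrow> 'b \<Rightarrow> 'a::{real_inner,second_countable_topology}"
  assumes V: "has_L2_right_deriv M X V t" and Y: "Y \<in> L2 M"
  shows "((\<lambda>s. L2inner M Y (\<lambda>\<omega>. (1 / (s - t)) *\<^sub>R (X s \<omega> - X t \<omega>))) \<longlongrightarrow> L2inner M Y V) (at_right t)"
proof -
  note VD = has_L2_right_derivD[OF V]
  let ?q = "\<lambda>s \<omega>. (1 / (s - t)) *\<^sub>R (X s \<omega> - X t \<omega>)"
  have "((\<lambda>s. L2inner M Y (?q s) - L2inner M Y V) \<longlongrightarrow> 0) (at_right t)"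
  proof (rule Lim_null_comparison)
    show "((\<lambda>s. L2norm M Y * L2norm M (\<lambda>\<omega>. ?q s \<omega> - V \<omega>)) \<longlongrightarrow> 0) (at_right t)"
      using tendsto_mult_left[OF VD(4), of "L2norm M Y"] by simp
    show "\<forall>\<^sub>F s in at_right t. norm (L2inner M Y (?q s) - L2inner M Y V)
        \<le> L2norm M Y * L2norm M (\<lambda>\<omega>. ?q s \<omega> - V \<omega>)"
      using VD(3)
    proof eventually_elim
      case (elim s)
      then have q: "?q s \<in> L2 M" using VD(2) by (intro L2_intros)
      then show ?case
        using L2_Cauchy_Schwarz[OF Y L2_diff[OF q VD(1)]] L2inner_diff_right[OF Y q VD(1)] by simp
    qed
  qed
  then show ?thesis by (rule LIM_zero_cancel)
qed

lemma L2norm_power2_quotient: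
  fixes X :: "real \<Rightarrow> 'b \<Rightarrow> 'a::{real_inner,second_countable_topology}"
  assumes X: "X s \<in> L2 M" "X t \<in> L2 M" and "s \<noteq> t"
  defines "q \<equiv> \<lambda>\<omega>. (1 / (s - t)) *\<^sub>R (X s \<omega> - X t \<omega>)"
  shows "((L2norm M (X s))\<^sup>2 - (L2norm M (X t))\<^sup>2) / (s - t)
      = 2 * L2inner M (X t) q + (s - t) * (L2norm M q)\<^sup>2"
proof -
  have q: "q \<in> L2 M" unfolding q_def using X by (intro L2_intros)
  have "X s = (\<lambda>\<omega>. X t \<omega> + (s - t) *\<^sub>R q \<omega>)" using \<open>s \<noteq> t\<close> by (auto simp: q_def)
  then have "(L2norm M (X s))\<^sup>2 = (L2norm M (X t))\<^sup>2
      + 2 * (s - t) * L2inner M (X t) q + (s - t)\<^sup>2 * (L2norm M q)\<^sup>2"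
    using L2norm_add_power2[OF X(2) L2_scaleR[OF q, of "s - t"]]
    by (simp add: L2norm_scaleR L2inner_scaleR_right power_mult_distrib)
  then show ?thesis using \<open>s \<noteq> t\<close> by (simp add: field_simps power2_eq_square)
qed

lemma L2norm_power2_has_right_derivative:
  fixes X :: "real \<Rightarrow> 'b \<Rightarrow> 'a::{real_inner,second_countable_topology}"
  assumes X: "L2_lipschitz_on M C {a..b} X" and t: "t \<in> {a..<b}"
    and V: "has_L2_right_deriv M X V t"
  shows "((\<lambda>s. (L2norm M (X s))\<^sup>2) has_real_derivative 2 * L2inner M V (X t)) (at_right t)"
proof -
  note VD = has_L2_right_derivD[OF V]
  define q where "q s = (\<lambda>\<omega>. (1 / (s - t)) *\<^sub>R (X s \<omega> - X t \<omega>))" for s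
  have near: "\<forall>\<^sub>F s in at_right t. s \<in> {t<..<b}"
    using t by (intro eventually_at_right_real) auto
  have quotient: "\<forall>\<^sub>F s in at_right t. 2 * L2inner M (X t) (q s) + (s - t) * (L2norm M (q s))\<^sup>2
      = ((L2norm M (X s))\<^sup>2 - (L2norm M (X t))\<^sup>2) / (s - t)"
    using near VD(3)
  proof eventually_elim
    case (elim s)
    then show ?case unfolding q_def by (intro L2norm_power2_quotient[symmetric] VD(2)) auto
  qed
  have "((\<lambda>s. (s - t) * (L2norm M (q s))\<^sup>2) \<longlongrightarrow> 0) (at_right t)"
  proof (rule Lim_null_comparison)
    have "((\<lambda>s. (s - t) * C\<^sup>2) \<longlongrightarrow> (t - t) * C\<^sup>2) (at_right t)"
      by (intro tendsto_intros)
    then show "((\<lambda>s. (s - t) * C\<^sup>2) \<longlongrightarrow> 0) (at_right t)" by simp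
    show "\<forall>\<^sub>F s in at_right t. norm ((s - t) * (L2norm M (q s))\<^sup>2) \<le> (s - t) * C\<^sup>2"
      using near
    proof eventually_elim
      case (elim s)
      have "L2norm M (q s) \<le> C"
        unfolding q_def using elim t by (intro L2_lipschitz_on_quotient_le[OF X]) auto
      then show ?case using elim by (auto simp: abs_mult intro!: mult_left_mono power_mono)
    qed
  qed
  from tendsto_add[OF tendsto_mult_left[OF has_L2_right_deriv_tendsto[OF V VD(2)], of 2] this]
  have "((\<lambda>s. 2 * L2inner M (X t) (q s) + (s - t) * (L2norm M (q s))\<^sup>2)
      \<longlongrightarrow> 2 * L2inner M V (X t)) (at_right t)"
    by (simp add: q_def L2inner_commute)
  then show ?thesis
    unfolding has_field_derivative_iff by (rule Lim_transform_eventually[OF _ quotient])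
qed

lemma L2_Gronwall:
  fixes D :: "real \<Rightarrow> 'b \<Rightarrow> 'a::{real_inner,second_countable_topology}"
  assumes D: "L2_lipschitz_on M C {0..T} D"
    and der: "AE t in lborel. t \<in> {0<..<T} \<longrightarrow> (\<exists>V. has_L2_right_deriv M D V t \<and>
      L2inner M V (D t) \<le> a * (L2norm M (D t))\<^sup>2 + b)"
    and "0 \<le> a" "0 \<le> b" and t: "t \<in> {0..T}"
  shows "(L2norm M (D t))\<^sup>2 \<le> exp (2 * a * t) * ((L2norm M (D 0))\<^sup>2 + 2 * b * t)"
proof (rule lipschitz_Gronwall)
  define B where "B = \<bar>L2norm M (D 0)\<bar> + C * (t - 0)"
  have "{0..t} \<subseteq> {0..T}" using t by auto
  then have lip: "C-lipschitz_on {0..t} (\<lambda>s. L2norm M (D s))"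
    by (rule lipschitz_on_subset[OF lipschitz_on_L2norm[OF D]])
  have "0 \<le> B" using t L2_lipschitz_onD(1)[OF D] by (simp add: B_def)
  then show "(B * C + B * C)-lipschitz_on {0..t} (\<lambda>s. (L2norm M (D s))\<^sup>2)"
    unfolding power2_eq_square B_def by (intro lipschitz_on_mult_bounded lip lipschitz_on_abs_le)
  show "AE s in lborel. s \<in> {0<..<t} \<longrightarrow> (\<exists>d\<le>2 * a * (L2norm M (D s))\<^sup>2 + 2 * b.
      ((\<lambda>s. (L2norm M (D s))\<^sup>2) has_real_derivative d) (at_right s))"
    using der
  proof eventually_elim
    case (elim s)
    show ?case
    proof
      assume "s \<in> {0<..<t}"
      then have s: "s \<in> {0<..<T}" "s \<in> {0..<T}" using t by auto
      then obtain V where V: "has_L2_right_deriv M D V s"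
        "L2inner M V (D s) \<le> a * (L2norm M (D s))\<^sup>2 + b"
        using elim by blast
      then show "\<exists>d\<le>2 * a * (L2norm M (D s))\<^sup>2 + 2 * b.
          ((\<lambda>s. (L2norm M (D s))\<^sup>2) has_real_derivative d) (at_right s)"
        using L2norm_power2_has_right_derivative[OF D s(2) V(1)]
        by (intro exI[of _ "2 * L2inner M V (D s)"]) simp
    qed
  qed
qed (use assms in auto)

section \<open>Suprema of paths of finite energy\<close>

definition dyadic :: "real \<Rightarrow> nat \<Rightarrow> nat \<Rightarrow> real" where
  "dyadic T m k = real k * T / 2 ^ m"

definition dyadic_index :: "real \<Rightarrow> nat \<Rightarrow> real \<Rightarrow> nat" where
  "dyadic_index T m t = nat \<lfloor>t * 2 ^ m / T\<rfloor>"

abbreviation dyadic_floor :: "real \<Rightarrow> nat \<Rightarrow> real \<Rightarrow> real" where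
  "dyadic_floor T m t \<equiv> dyadic T m (dyadic_index T m t)"

definition dyadic_energy :: "real \<Rightarrow> nat \<Rightarrow> (real \<Rightarrow> 'a::real_normed_vector) \<Rightarrow> real" where
  "dyadic_energy T m x
      = (\<Sum>k<2 ^ m. 2 ^ m / T * (norm (x (dyadic T m (Suc k)) - x (dyadic T m k)))\<^sup>2)"

definition path_energy :: "real \<Rightarrow> (real \<Rightarrow> 'a::real_normed_vector) \<Rightarrow> ennreal" where
  "path_energy T x = (SUP m. ennreal (dyadic_energy T m x))"

lemma dyadic_refine: "dyadic T (m + r) (k * 2 ^ r) = dyadic T m k"
  by (simp add: dyadic_def power_add)

context
  fixes T :: real
  assumes T: "0 < T"
begin

lemma dyadic_mem: "k \<le> 2 ^ m \<Longrightarrow> dyadic T m k \<in> {0..T}"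
proof -
  assume "k \<le> 2 ^ m"
  then have "real k \<le> 2 ^ m" by (metis of_nat_le_iff of_nat_numeral of_nat_power)
  then show ?thesis using T by (simp add: dyadic_def field_simps mult_mono)
qed

lemma
  assumes "t \<in> {0..T}"
  shows dyadic_index_le: "dyadic_index T m t \<le> 2 ^ m"
    and dyadic_floor_le: "dyadic_floor T m t \<le> t"
    and le_dyadic_floor_add: "t \<le> dyadic_floor T m t + T / 2 ^ m"
proof -
  have "t * 2 ^ m / T \<le> 2 ^ m" using T assms by (simp add: field_simps)
  then have "\<lfloor>t * 2 ^ m / T\<rfloor> \<le> 2 ^ m"
    by (metis floor_le_iff floor_mono floor_numeral_power of_int_numeral of_int_power order_refl)
  then show "dyadic_index T m t \<le> 2 ^ m" unfolding dyadic_index_def by (simp add: nat_le_iff)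
  have index: "real (dyadic_index T m t) = of_int \<lfloor>t * 2 ^ m / T\<rfloor>"
    unfolding dyadic_index_def using T assms by simp
  have "real (dyadic_index T m t) \<le> t * 2 ^ m / T" unfolding index by (rule of_int_floor_le)
  then show "dyadic_floor T m t \<le> t" using T by (simp add: dyadic_def field_simps)
  have "t * 2 ^ m / T \<le> real (dyadic_index T m t) + 1" unfolding index by linarith
  then show "t \<le> dyadic_floor T m t + T / 2 ^ m" using T by (simp add: dyadic_def field_simps)
qed

lemma dyadic_floor_mem: "t \<in> {0..T} \<Longrightarrow> dyadic_floor T m t \<in> {0..T}"
  by (intro dyadic_mem dyadic_index_le)

lemma dyadic_index_refine:
  assumes "t \<in> {0..T}"
  shows "dyadic_index T m t * 2 ^ r \<le> dyadic_index T (m + r) t"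
proof -
  have "real (dyadic_index T m t * 2 ^ r) \<le> t * 2 ^ (m + r) / T"
    using dyadic_floor_le[OF assms, of m] T by (simp add: dyadic_def field_simps power_add)
  then show ?thesis unfolding dyadic_index_def[of T "m + r"] by (rule le_nat_floor)
qed

lemma dyadic_floor_tendsto:
  assumes t: "t \<in> {0..T}"
  shows "(\<lambda>r. dyadic_floor T (m + r) t) \<longlonglongrightarrow> t"
proof (rule tendsto_sandwich)
  have "(\<lambda>r. T / 2 ^ m * (1 / 2) ^ r) \<longlonglongrightarrow> T / 2 ^ m * 0"
    by (intro tendsto_intros LIMSEQ_power_zero) auto
  from tendsto_diff[OF tendsto_const this]
  show "(\<lambda>r. t - T / 2 ^ m * (1 / 2) ^ r) \<longlonglongrightarrow> t" by simp
  show "\<forall>\<^sub>F r in sequentially. t - T / 2 ^ m * (1 / 2) ^ r \<le> dyadic_floor T (m + r) t"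
    using le_dyadic_floor_add[OF t, of "m + r" for r]
    by (intro always_eventually allI) (simp add: power_add power_divide algebra_simps)
  show "\<forall>\<^sub>F r in sequentially. dyadic_floor T (m + r) t \<le> t"
    by (intro always_eventually allI dyadic_floor_le[OF t])
qed simp

lemma dyadic_energy_nonneg: "0 \<le> dyadic_energy T m x"
  unfolding dyadic_energy_def using T by (intro sum_nonneg) auto

lemma dyadic_energy_mono_Suc: "dyadic_energy T m x \<le> dyadic_energy T (Suc m) x"
proof -
  define y where "y j = x (dyadic T (Suc m) j)" for j
  have x_eq_y: "x (dyadic T m k) = y (2 * k)" for k
    using dyadic_refine[of T m 1 k] by (simp add: y_def mult.commute)
  have "dyadic_energy T m x = (\<Sum>k<2 ^ m. 2 ^ m / T * (norm (y (2 * k + 2) - y (2 * k)))\<^sup>2)"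
    unfolding dyadic_energy_def x_eq_y by simp
  also have "\<dots> \<le> (\<Sum>k<2 ^ m. \<Sum>j=k * 2..<k * 2 + 2. 2 ^ Suc m / T * (norm (y (Suc j) - y j))\<^sup>2)"
  proof (rule sum_mono)
    fix k
    have "(norm (y (2 * k + 2) - y (2 * k)))\<^sup>2
      \<le> 2 * (norm (y (2 * k + 2) - y (2 * k + 1)))\<^sup>2 + 2 * (norm (y (2 * k + 1) - y (2 * k)))\<^sup>2"
      using norm_add_power2_le[of "y (2 * k + 2) - y (2 * k + 1)" "y (2 * k + 1) - y (2 * k)"]
      by simp
    from mult_left_mono[OF this, of "2 ^ m / T"] T
    show "2 ^ m / T * (norm (y (2 * k + 2) - y (2 * k)))\<^sup>2
      \<le> (\<Sum>j=k * 2..<k * 2 + 2. 2 ^ Suc m / T * (norm (y (Suc j) - y j))\<^sup>2)"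
      by (simp add: numeral_2_eq_2 algebra_simps)
  qed
  also have "\<dots> = dyadic_energy T (Suc m) x"
    unfolding sum.nat_group by (simp add: dyadic_energy_def y_def mult.commute)
  finally show ?thesis .
qed

lemma dyadic_energy_mono: "m \<le> n \<Longrightarrow> dyadic_energy T m x \<le> dyadic_energy T n x"
  by (rule lift_Suc_mono_le[of "\<lambda>m. dyadic_energy T m x"]) (auto intro: dyadic_energy_mono_Suc)

lemma dyadic_increment_le_energy:
  assumes "i \<le> j" "j \<le> 2 ^ m"
  shows "(norm (x (dyadic T m j) - x (dyadic T m i)))\<^sup>2
    \<le> (dyadic T m j - dyadic T m i) * dyadic_energy T m x"
proof -
  define d where "d k = norm (x (dyadic T m (Suc k)) - x (dyadic T m k))" for k
  have "x (dyadic T m j) - x (dyadic T m i) = (\<Sum>k=i..<j. x (dyadic T m (Suc k)) - x (dyadic T m k))"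
    using sum_Suc_diff'[OF \<open>i \<le> j\<close>, of "\<lambda>k. x (dyadic T m k)"] by simp
  then have "norm (x (dyadic T m j) - x (dyadic T m i)) \<le> (\<Sum>k=i..<j. d k)"
    by (simp add: d_def norm_sum)
  then have "(norm (x (dyadic T m j) - x (dyadic T m i)))\<^sup>2 \<le> (\<Sum>k=i..<j. d k)\<^sup>2"
    by (intro power_mono) auto
  also have "\<dots> \<le> (\<Sum>k=i..<j. (d k)\<^sup>2) * card {i..<j}"
    by (rule sum_squared_le_sum_of_squares)
  also have "\<dots> \<le> (\<Sum>k<2 ^ m. (d k)\<^sup>2) * card {i..<j}"
    using assms by (intro mult_right_mono sum_mono2) auto
  also have "\<dots> = (dyadic T m j - dyadic T m i) * (2 ^ m / T * (\<Sum>k<2 ^ m. (d k)\<^sup>2))"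
    using T assms by (simp add: dyadic_def field_simps of_nat_diff)
  also have "2 ^ m / T * (\<Sum>k<2 ^ m. (d k)\<^sup>2) = dyadic_energy T m x"
    by (simp add: dyadic_energy_def d_def sum_distrib_left)
  finally show ?thesis .
qed

lemma continuous_path_dyadic_floor_le_energy:
  fixes x :: "real \<Rightarrow> 'a::real_normed_vector"
  assumes t: "t \<in> {0..T}" and cont: "continuous_on {0..T} x" and "\<And>n. dyadic_energy T n x \<le> e"
  shows "(norm (x t - x (dyadic_floor T m t)))\<^sup>2 \<le> T / 2 ^ m * e"
proof (rule LIMSEQ_le_const2)
  have "(\<lambda>r. x (dyadic_floor T (m + r) t)) \<longlonglongrightarrow> x t"
    using dyadic_floor_tendsto[OF t] dyadic_floor_mem[OF t] t
    by (intro continuous_on_tendsto_compose[OF cont]) auto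
  then show "(\<lambda>r. (norm (x (dyadic_floor T (m + r) t) - x (dyadic_floor T m t)))\<^sup>2)
      \<longlonglongrightarrow> (norm (x t - x (dyadic_floor T m t)))\<^sup>2"
    by (intro tendsto_intros)
  have "(norm (x (dyadic_floor T (m + r) t) - x (dyadic_floor T m t)))\<^sup>2 \<le> T / 2 ^ m * e" for r
  proof -
    have "(norm (x (dyadic_floor T (m + r) t) - x (dyadic_floor T m t)))\<^sup>2
        \<le> (dyadic_floor T (m + r) t - dyadic_floor T m t) * dyadic_energy T (m + r) x"
      using dyadic_increment_le_energy[OF dyadic_index_refine[OF t] dyadic_index_le[OF t], of x]
      by (simp only: dyadic_refine)
    also have "\<dots> \<le> T / 2 ^ m * e"
      using dyadic_floor_le[OF t, of "m + r"] le_dyadic_floor_add[OF t, of m] T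
        dyadic_energy_nonneg assms(3) by (intro mult_mono) auto
    finally show ?thesis .
  qed
  then show "\<exists>N. \<forall>r\<ge>N. (norm (x (dyadic_floor T (m + r) t) - x (dyadic_floor T m t)))\<^sup>2
      \<le> T / 2 ^ m * e"
    by blast
qed

lemma SUP_norm_power2_le_energy:
  fixes x :: "real \<Rightarrow> 'a::real_normed_vector"
  assumes cont: "continuous_on {0..T} x" and energy: "\<And>n. dyadic_energy T n x \<le> e"
  shows "(SUP t\<in>{0..T}. norm (x t))\<^sup>2
      \<le> 2 * (\<Sum>k\<le>2 ^ m. (norm (x (dyadic T m k)))\<^sup>2) + 2 * T / 2 ^ m * e"
    (is "_ \<le> ?B")
proof -
  have "(norm (x t))\<^sup>2 \<le> ?B" if t: "t \<in> {0..T}" for t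
  proof -
    have "(norm (x t))\<^sup>2 \<le> 2 * (norm (x (dyadic_floor T m t)))\<^sup>2
        + 2 * (norm (x t - x (dyadic_floor T m t)))\<^sup>2"
      using norm_add_power2_le[of "x (dyadic_floor T m t)" "x t - x (dyadic_floor T m t)"] by simp
    moreover have "(norm (x (dyadic_floor T m t)))\<^sup>2 \<le> (\<Sum>k\<le>2 ^ m. (norm (x (dyadic T m k)))\<^sup>2)"
      using dyadic_index_le[OF t]
      by (intro member_le_sum[of _ _ "\<lambda>k. (norm (x (dyadic T m k)))\<^sup>2"]) auto
    ultimately show ?thesis
      using continuous_path_dyadic_floor_le_energy[OF t cont energy, of m] by simp
  qed
  then have norm_le: "norm (x t) \<le> sqrt ?B" if "t \<in> {0..T}" for t
    using that by (intro real_le_rsqrt)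
  have "0 \<le> (SUP t\<in>{0..T}. norm (x t))"
    using T norm_le by (intro cSUP_upper2[where x = 0] bdd_aboveI2[where M = "sqrt ?B"]) auto
  moreover have "(SUP t\<in>{0..T}. norm (x t)) \<le> sqrt ?B"
    using T norm_le by (intro cSUP_least) auto
  moreover have "0 \<le> ?B" using norm_le[of 0] T order_trans[OF norm_ge_zero] by fastforce
  ultimately show ?thesis by (metis power_mono real_sqrt_pow2)
qed

lemma SUP_norm_power2_le_path_energy:
  fixes x :: "real \<Rightarrow> 'a::real_normed_vector"
  assumes cont: "continuous_on {0..T} x"
  shows "ennreal ((SUP t\<in>{0..T}. norm (x t))\<^sup>2)
    \<le> ennreal (2 * (\<Sum>k\<le>2 ^ m. (norm (x (dyadic T m k)))\<^sup>2))
      + ennreal (2 * T / 2 ^ m) * path_energy T x"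
proof (cases "path_energy T x")
  case (real e)
  have "dyadic_energy T n x \<le> e" for n
  proof -
    have "ennreal (dyadic_energy T n x) \<le> ennreal e"
      unfolding real(2)[symmetric] path_energy_def by (rule SUP_upper) simp
    then show ?thesis using real(1) by simp
  qed
  then have "ennreal ((SUP t\<in>{0..T}. norm (x t))\<^sup>2)
      \<le> ennreal (2 * (\<Sum>k\<le>2 ^ m. (norm (x (dyadic T m k)))\<^sup>2) + 2 * T / 2 ^ m * e)"
    by (intro ennreal_leI SUP_norm_power2_le_energy[OF cont])
  also have "\<dots> = ennreal (2 * (\<Sum>k\<le>2 ^ m. (norm (x (dyadic T m k)))\<^sup>2))
      + ennreal (2 * T / 2 ^ m * e)"
    using T real(1) by (intro ennreal_plus) (auto intro!: sum_nonneg)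
  also have "ennreal (2 * T / 2 ^ m * e) = ennreal (2 * T / 2 ^ m) * path_energy T x"
    unfolding real(2) using T real(1) by (intro ennreal_mult) auto
  finally show ?thesis .
next
  case top
  then show ?thesis using T by (simp add: ennreal_mult_top)
qed

context
  fixes M :: "'b measure" and C :: real
    and D :: "'b \<Rightarrow> real \<Rightarrow> 'a::{real_inner,second_countable_topology}"
  assumes D: "L2_lipschitz_on M C {0..T} (\<lambda>t \<omega>. D \<omega> t)"
begin

lemma L2_dyadic: "k \<le> 2 ^ m \<Longrightarrow> (\<lambda>\<omega>. D \<omega> (dyadic T m k)) \<in> L2 M"
  by (intro L2_lipschitz_onD(2)[OF D] dyadic_mem)

lemma integrable_dyadic_energy: "integrable M (\<lambda>\<omega>. dyadic_energy T m (D \<omega>))"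
  unfolding dyadic_energy_def
  by (intro Bochner_Integration.integrable_sum integrable_mult_right L2_integrable_power2 L2_diff
      L2_dyadic) auto

lemma path_energy_measurable: "(\<lambda>\<omega>. path_energy T (D \<omega>)) \<in> borel_measurable M"
  unfolding path_energy_def
  by (intro borel_measurable_SUP measurable_compose[OF _ measurable_ennreal]
      borel_measurable_integrable integrable_dyadic_energy) auto

lemma integral_dyadic_energy_le: "(\<integral>\<omega>. dyadic_energy T m (D \<omega>) \<partial>M) \<le> C\<^sup>2 * T"
proof -
  define increment where "increment k = (\<lambda>\<omega>. D \<omega> (dyadic T m (Suc k)) - D \<omega> (dyadic T m k))" for k
  have L2_increment: "increment k \<in> L2 M" if "k < 2 ^ m" for k
    unfolding increment_def using that by (intro L2_diff L2_dyadic) auto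
  have L2norm_increment: "L2norm M (increment k) \<le> C * (T / 2 ^ m)" if "k < 2 ^ m" for k
  proof -
    have "L2norm M (increment k) \<le> C * \<bar>dyadic T m (Suc k) - dyadic T m k\<bar>"
      unfolding increment_def using that by (intro L2_lipschitz_onD(3)[OF D] dyadic_mem) auto
    also have "\<bar>dyadic T m (Suc k) - dyadic T m k\<bar> = T / 2 ^ m"
      using T by (simp add: dyadic_def field_simps)
    finally show ?thesis .
  qed
  have "(\<integral>\<omega>. dyadic_energy T m (D \<omega>) \<partial>M) = (\<Sum>k<2 ^ m. 2 ^ m / T * (L2norm M (increment k))\<^sup>2)"
    using L2_integrable_power2[OF L2_increment]
    by (simp add: dyadic_energy_def L2norm_power2 increment_def)
  also have "\<dots> \<le> (\<Sum>k<(2::nat) ^ m. 2 ^ m / T * (C * (T / 2 ^ m))\<^sup>2)"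
    using T L2norm_increment by (intro sum_mono mult_left_mono power_mono) auto
  also have "\<dots> = C\<^sup>2 * T" using T by (simp add: power2_eq_square field_simps)
  finally show ?thesis .
qed

lemma nn_integral_path_energy_le: "(\<integral>\<^sup>+\<omega>. path_energy T (D \<omega>) \<partial>M) \<le> ennreal (C\<^sup>2 * T)"
proof -
  have "(\<integral>\<^sup>+\<omega>. path_energy T (D \<omega>) \<partial>M) = (SUP m. \<integral>\<^sup>+\<omega>. ennreal (dyadic_energy T m (D \<omega>)) \<partial>M)"
    unfolding path_energy_def using borel_measurable_integrable[OF integrable_dyadic_energy]
    by (intro nn_integral_monotone_convergence_SUP)
      (auto simp: incseq_def le_fun_def intro!: ennreal_leI dyadic_energy_mono)
  also have "\<dots> = (SUP m. ennreal (\<integral>\<omega>. dyadic_energy T m (D \<omega>) \<partial>M))"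
    by (subst nn_integral_eq_integral[OF integrable_dyadic_energy])
      (auto simp: dyadic_energy_nonneg)
  also have "\<dots> \<le> ennreal (C\<^sup>2 * T)"
    by (intro SUP_least ennreal_leI integral_dyadic_energy_le)
  finally show ?thesis .
qed

lemma nn_integral_SUP_norm_power2_le:
  assumes cont: "\<And>\<omega>. continuous_on {0..T} (D \<omega>)"
    and bound: "\<And>t. t \<in> {0..T} \<Longrightarrow> (L2norm M (\<lambda>\<omega>. D \<omega> t))\<^sup>2 \<le> \<kappa>"
  shows "(\<integral>\<^sup>+\<omega>. ennreal ((SUP t\<in>{0..T}. norm (D \<omega> t))\<^sup>2) \<partial>M)
    \<le> ennreal (2 * (2 ^ m + 1) * \<kappa> + 2 * T\<^sup>2 * C\<^sup>2 / 2 ^ m)"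
proof -
  define S where "S \<omega> = (\<Sum>k\<le>2 ^ m. (norm (D \<omega> (dyadic T m k)))\<^sup>2)" for \<omega>
  note [measurable] = path_energy_measurable
  have S: "integrable M S"
    unfolding S_def
    by (intro Bochner_Integration.integrable_sum L2_integrable_power2 L2_dyadic) auto
  have S_nonneg: "0 \<le> S \<omega>" for \<omega> unfolding S_def by (intro sum_nonneg) auto
  have "(\<integral>\<omega>. S \<omega> \<partial>M) = (\<Sum>k\<le>2 ^ m. (L2norm M (\<lambda>\<omega>. D \<omega> (dyadic T m k)))\<^sup>2)"
    unfolding S_def L2norm_power2
    by (intro Bochner_Integration.integral_sum L2_integrable_power2 L2_dyadic) auto
  also have "\<dots> \<le> (\<Sum>k\<le>(2::nat) ^ m. \<kappa>)" by (intro sum_mono bound dyadic_mem) auto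
  finally have S_le: "(\<integral>\<omega>. S \<omega> \<partial>M) \<le> (2 ^ m + 1) * \<kappa>" by (simp add: add.commute)
  have "0 \<le> \<kappa>" using bound[of 0] T order_trans[OF zero_le_power2] by fastforce
  have "(\<integral>\<^sup>+\<omega>. ennreal ((SUP t\<in>{0..T}. norm (D \<omega> t))\<^sup>2) \<partial>M)
      \<le> (\<integral>\<^sup>+\<omega>. ennreal (2 * S \<omega>) + ennreal (2 * T / 2 ^ m) * path_energy T (D \<omega>) \<partial>M)"
    unfolding S_def by (intro nn_integral_mono SUP_norm_power2_le_path_energy cont)
  also have "\<dots> = (\<integral>\<^sup>+\<omega>. ennreal (2 * S \<omega>) \<partial>M)
      + ennreal (2 * T / 2 ^ m) * (\<integral>\<^sup>+\<omega>. path_energy T (D \<omega>) \<partial>M)"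
    using S by (subst nn_integral_add) (auto simp: nn_integral_cmult)
  also have "(\<integral>\<^sup>+\<omega>. ennreal (2 * S \<omega>) \<partial>M) = ennreal (2 * (\<integral>\<omega>. S \<omega> \<partial>M))"
    using S S_nonneg by (subst nn_integral_eq_integral) auto
  also have "ennreal (2 * (\<integral>\<omega>. S \<omega> \<partial>M)) + ennreal (2 * T / 2 ^ m) * (\<integral>\<^sup>+\<omega>. path_energy T (D \<omega>) \<partial>M)
      \<le> ennreal (2 * ((2 ^ m + 1) * \<kappa>)) + ennreal (2 * T / 2 ^ m) * ennreal (C\<^sup>2 * T)"
    using S_le by (intro add_mono mult_left_mono nn_integral_path_energy_le ennreal_leI) auto
  also have "ennreal (2 * T / 2 ^ m) * ennreal (C\<^sup>2 * T) = ennreal (2 * T\<^sup>2 * C\<^sup>2 / 2 ^ m)"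
    using T by (subst ennreal_mult[symmetric]) (simp_all, simp add: power2_eq_square mult_ac)
  also have "ennreal (2 * ((2 ^ m + 1) * \<kappa>)) + \<dots>
      = ennreal (2 * (2 ^ m + 1) * \<kappa> + 2 * T\<^sup>2 * C\<^sup>2 / 2 ^ m)"
    using \<open>0 \<le> \<kappa>\<close> by (subst ennreal_plus) (auto simp: mult.assoc)
  finally show ?thesis .
qed

end

end

lemma tendsto_0_if_le_interpolation:
  fixes f :: "nat \<Rightarrow> ennreal" and \<kappa> :: "nat \<Rightarrow> real"
  assumes "\<kappa> \<longlonglongrightarrow> 0" and bound: "\<And>h m. f h \<le> ennreal (2 * (2 ^ m + 1) * \<kappa> h + A / 2 ^ m)"
  shows "f \<longlonglongrightarrow> 0"
proof (rule order_tendstoI)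
  fix x :: ennreal assume "0 < x"
  then obtain e where e: "0 < e" "ennreal e < x"
    using dense[of 0 x]
    by (metis ennreal_cases ennreal_less_zero_iff less_top not_less_iff_gr_or_eq)
  have "(\<lambda>m. A * (1 / 2) ^ m) \<longlonglongrightarrow> A * 0"
    by (intro tendsto_mult_left LIMSEQ_power_zero) simp
  then have "\<forall>\<^sub>F m in sequentially. A * (1 / 2) ^ m < e / 2"
    by (rule order_tendstoD) (use e in simp)
  then obtain m where m: "A / 2 ^ m < e / 2"
    by (auto simp: eventually_sequentially power_divide)
  have "(\<lambda>h. 2 * (2 ^ m + 1) * \<kappa> h) \<longlonglongrightarrow> 2 * (2 ^ m + 1) * 0"
    by (intro tendsto_mult_left assms(1))
  then have "\<forall>\<^sub>F h in sequentially. 2 * (2 ^ m + 1) * \<kappa> h < e / 2"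
    by (rule order_tendstoD) (use e in simp)
  then show "\<forall>\<^sub>F h in sequentially. f h < x"
  proof eventually_elim
    case (elim h)
    have "f h \<le> ennreal (2 * (2 ^ m + 1) * \<kappa> h + A / 2 ^ m)" by (rule bound)
    also have "\<dots> \<le> ennreal e" using add_strict_mono[OF elim m] by (intro ennreal_leI) simp
    finally show ?case using e(2) by simp
  qed
qed simp

lemma L2C_dist2_tendsto_0:
  fixes Z :: "nat \<Rightarrow> 'b \<Rightarrow> real \<Rightarrow> 'a::{real_inner,second_countable_topology}"
  assumes T: "0 < T" and cont: "\<And>h \<omega>. continuous_on {0..T} (Z h \<omega>)" "\<And>\<omega>. continuous_on {0..T} (X \<omega>)"
    and lip: "\<And>h. L2_lipschitz_on M C {0..T} (\<lambda>t \<omega>. Z h \<omega> t - X \<omega> t)"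
    and bound: "\<And>h t. t \<in> {0..T} \<Longrightarrow> (L2norm M (\<lambda>\<omega>. Z h \<omega> t - X \<omega> t))\<^sup>2 \<le> \<kappa> h"
    and \<kappa>: "\<kappa> \<longlonglongrightarrow> 0"
  shows "(\<lambda>h. L2C_dist2 M T (Z h) X) \<longlonglongrightarrow> 0"
proof (rule tendsto_0_if_le_interpolation[OF \<kappa>])
  show "L2C_dist2 M T (Z h) X \<le> ennreal (2 * (2 ^ m + 1) * \<kappa> h + 2 * T\<^sup>2 * C\<^sup>2 / 2 ^ m)" for h m
    unfolding L2C_dist2_def
    by (intro nn_integral_SUP_norm_power2_le[OF T lip] continuous_on_diff cont bound)
qed

section \<open>A conditionally independent coupling\<close>

definition cell_density :: "'b measure \<Rightarrow> ('b \<Rightarrow> nat) \<Rightarrow> 'b \<Rightarrow> 'b \<Rightarrow> real" where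
  "cell_density P c \<omega> \<omega>' = (if c \<omega> = c \<omega>' then 1 / measure P {\<omega>'' \<in> space P. c \<omega>'' = c \<omega>} else 0)"

text \<open>The law of two points that are conditionally independent given that they lie in the same cell
  of the partition into the level sets of \<open>c\<close>.\<close>

definition cell_coupling :: "'b measure \<Rightarrow> ('b \<Rightarrow> nat) \<Rightarrow> ('b \<times> 'b) measure" where
  "cell_coupling P c = density (P \<Otimes>\<^sub>M P) (\<lambda>p. ennreal (cell_density P c (fst p) (snd p)))"

lemma cell_density_nonneg: "0 \<le> cell_density P c \<omega> \<omega>'"
  by (simp add: cell_density_def)

lemma cell_density_commute: "cell_density P c \<omega> \<omega>' = cell_density P c \<omega>' \<omega>"
  by (auto simp: cell_density_def)

context
  fixes P :: "'b measure" and c :: "'b \<Rightarrow> nat"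
  assumes P: "prob_space P" and c [measurable]: "c \<in> measurable P (count_space UNIV)"
begin

lemma cell_density_measurable [measurable]:
  "(\<lambda>p. cell_density P c (fst p) (snd p)) \<in> borel_measurable (P \<Otimes>\<^sub>M P)"
proof -
  have "Measurable.pred (P \<Otimes>\<^sub>M P) (\<lambda>p. \<exists>i. c (snd p) = i \<and> c (fst p) = i)" by measurable
  then have [measurable]: "Measurable.pred (P \<Otimes>\<^sub>M P) (\<lambda>p. c (fst p) = c (snd p))" by simp
  have "(\<lambda>p. c (fst p)) \<in> measurable (P \<Otimes>\<^sub>M P) (count_space UNIV)" by measurable
  from measurable_compose[OF this, of "\<lambda>i. measure P {\<omega> \<in> space P. c \<omega> = i}" borel]
  have [measurable]: "(\<lambda>p. measure P {\<omega> \<in> space P. c \<omega> = c (fst p)}) \<in> borel_measurable (P \<Otimes>\<^sub>M P)"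
    by simp
  show ?thesis unfolding cell_density_def by measurable
qed

lemma AE_cell_pos: "AE \<omega> in P. 0 < measure P {\<omega>' \<in> space P. c \<omega>' = c \<omega>}"
proof -
  interpret prob_space P by (rule P)
  have "AE \<omega> in P. c \<omega> = i \<longrightarrow> 0 < measure P {\<omega>' \<in> space P. c \<omega>' = i}" for i
  proof (cases "measure P {\<omega>' \<in> space P. c \<omega>' = i} = 0")
    case True
    then have "{\<omega>' \<in> space P. c \<omega>' = i} \<in> null_sets P"
      by (intro null_setsI) (auto simp: emeasure_eq_measure)
    from AE_not_in[OF this] show ?thesis using AE_space by eventually_elim auto
  qed (simp add: less_le)
  then have "AE \<omega> in P. \<forall>i. c \<omega> = i \<longrightarrow> 0 < measure P {\<omega>' \<in> space P. c \<omega>' = i}"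
    unfolding AE_all_countable by (rule allI)
  then show ?thesis by eventually_elim simp
qed

lemma nn_integral_cell_density: "AE \<omega> in P. (\<integral>\<^sup>+\<omega>'. ennreal (cell_density P c \<omega> \<omega>') \<partial>P) = 1"
  using AE_cell_pos
proof eventually_elim
  case (elim \<omega>)
  interpret prob_space P by (rule P)
  define w where "w = measure P {\<omega>' \<in> space P. c \<omega>' = c \<omega>}"
  have "(\<integral>\<^sup>+\<omega>'. ennreal (cell_density P c \<omega> \<omega>') \<partial>P)
      = (\<integral>\<^sup>+\<omega>'. ennreal (1 / w) * indicator {\<omega>' \<in> space P. c \<omega>' = c \<omega>} \<omega>' \<partial>P)"
    by (intro nn_integral_cong) (auto simp: cell_density_def w_def)
  also have "\<dots> = ennreal (1 / w) * ennreal w"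
    by (subst nn_integral_cmult_indicator) (auto simp: w_def emeasure_eq_measure)
  also have "\<dots> = 1" using elim by (simp add: w_def flip: ennreal_mult)
  finally show ?case .
qed

lemma nn_integral_cell_coupling:
  assumes [measurable]: "f \<in> borel_measurable (P \<Otimes>\<^sub>M P)"
  shows "(\<integral>\<^sup>+p. f p \<partial>cell_coupling P c)
      = (\<integral>\<^sup>+\<omega>. \<integral>\<^sup>+\<omega>'. ennreal (cell_density P c \<omega> \<omega>') * f (\<omega>, \<omega>') \<partial>P \<partial>P)"
proof -
  interpret prob_space P by (rule P)
  show ?thesis
    unfolding cell_coupling_def
    by (subst nn_integral_density) (auto simp: nn_integral_fst[symmetric])
qed

lemma measure_preserving_cell_coupling:
  shows "measure_preserving (cell_coupling P c) P fst"
    and "measure_preserving (cell_coupling P c) P snd"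
proof -
  interpret prob_space P by (rule P)
  interpret PP: pair_prob_space P P ..
  have sets [measurable_cong]: "sets (cell_coupling P c) = sets (P \<Otimes>\<^sub>M P)"
    by (simp add: cell_coupling_def)
  have marginal: "(\<integral>\<^sup>+\<omega>. \<integral>\<^sup>+\<omega>'. ennreal (cell_density P c \<omega> \<omega>') * indicator S \<omega> \<partial>P \<partial>P)
      = emeasure P S"
    if [measurable]: "S \<in> sets P" for S
  proof -
    have "(\<lambda>\<omega>'. cell_density P c \<omega> \<omega>') \<in> borel_measurable P" if "\<omega> \<in> space P" for \<omega>
      using measurable_compose[OF measurable_Pair1'[OF that] cell_density_measurable] by simp
    then have "(\<integral>\<^sup>+\<omega>. \<integral>\<^sup>+\<omega>'. ennreal (cell_density P c \<omega> \<omega>') * indicator S \<omega> \<partial>P \<partial>P)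
        = (\<integral>\<^sup>+\<omega>. (\<integral>\<^sup>+\<omega>'. ennreal (cell_density P c \<omega> \<omega>') \<partial>P) * indicator S \<omega> \<partial>P)"
      by (intro nn_integral_cong nn_integral_multc) auto
    also have "\<dots> = (\<integral>\<^sup>+\<omega>. indicator S \<omega> \<partial>P)"
      using nn_integral_cell_density by (intro nn_integral_cong_AE) auto
    finally show ?thesis by simp
  qed
  have "distr (cell_coupling P c) P fst = P"
    by (rule distr_eqI_nn_integral) (use marginal in \<open>simp_all add: nn_integral_cell_coupling\<close>)
  then show "measure_preserving (cell_coupling P c) P fst" by (simp add: measure_preserving_def)
  have "distr (cell_coupling P c) P snd = P"
  proof (rule distr_eqI_nn_integral)
    fix S assume [measurable]: "S \<in> sets P"
    have "(\<integral>\<^sup>+p. indicator S (snd p) \<partial>cell_coupling P c)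
        = (\<integral>\<^sup>+\<omega>. \<integral>\<^sup>+\<omega>'. ennreal (cell_density P c \<omega> \<omega>') * indicator S \<omega>' \<partial>P \<partial>P)"
      by (simp add: nn_integral_cell_coupling)
    also have "\<dots> = (\<integral>\<^sup>+\<omega>'. \<integral>\<^sup>+\<omega>. ennreal (cell_density P c \<omega> \<omega>') * indicator S \<omega>' \<partial>P \<partial>P)"
      by (subst PP.Fubini'[symmetric]) (auto simp: case_prod_beta')
    finally show "(\<integral>\<^sup>+p. indicator S (snd p) \<partial>cell_coupling P c) = emeasure P S"
      using marginal[of S] by (simp add: cell_density_commute)
  qed simp_all
  then show "measure_preserving (cell_coupling P c) P snd" by (simp add: measure_preserving_def)
qed

lemma prob_space_cell_coupling: "prob_space (cell_coupling P c)"
  using measure_preserving_cell_coupling(1) P prob_space_distrD[of fst "cell_coupling P c" P]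
  by (simp add: measure_preserving_def)

lemma AE_cell_coupling: "AE p in cell_coupling P c. c (fst p) = c (snd p)"
  unfolding cell_coupling_def
    AE_density[OF measurable_compose[OF cell_density_measurable measurable_ennreal]]
  by (simp add: cell_density_def)

lemma cell_coupling_L2inner_eq_0:
  fixes A B :: "'b \<Rightarrow> 'a::{real_inner,second_countable_topology}"
  assumes A: "A \<in> L2 P" and B: "B \<in> L2 P"
    and cells: "\<And>i e. L2inner P A (\<lambda>\<omega>. if c \<omega> = i then e else 0) = 0"
  shows "L2inner (cell_coupling P c) (\<lambda>p. A (fst p)) (\<lambda>p. B (snd p)) = 0"
proof -
  interpret prob_space P by (rule P)
  interpret PP: pair_prob_space P P ..
  note [measurable] = L2_measurable[OF A] L2_measurable[OF B]
  have "integrable (cell_coupling P c) (\<lambda>p. inner (A (fst p)) (B (snd p)))"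
    by (intro L2_integrable_inner L2_measure_preserving[OF measure_preserving_cell_coupling(1) A]
        L2_measure_preserving[OF measure_preserving_cell_coupling(2) B])
  then have int: "integrable (P \<Otimes>\<^sub>M P)
      (\<lambda>p. cell_density P c (fst p) (snd p) * inner (A (fst p)) (B (snd p)))"
    unfolding cell_coupling_def by (subst (asm) integrable_density) (auto simp: cell_density_nonneg)
  have "L2inner (cell_coupling P c) (\<lambda>p. A (fst p)) (\<lambda>p. B (snd p))
      = (\<integral>p. cell_density P c (fst p) (snd p) * inner (A (fst p)) (B (snd p)) \<partial>(P \<Otimes>\<^sub>M P))"
    unfolding L2inner_def cell_coupling_def
    by (subst integral_density) (auto simp: cell_density_nonneg)
  also have "\<dots> = (\<integral>\<omega>'. (\<integral>\<omega>. cell_density P c \<omega> \<omega>' * inner (A \<omega>) (B \<omega>') \<partial>P) \<partial>P)"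
    using int by (subst PP.integral_snd) (auto simp: case_prod_beta')
  also have "\<dots> = (\<integral>\<omega>'. 0 \<partial>P)"
  proof (intro Bochner_Integration.integral_cong refl)
    fix \<omega>'
    let ?w = "measure P {\<omega> \<in> space P. c \<omega> = c \<omega>'}"
    have "(\<integral>\<omega>. cell_density P c \<omega> \<omega>' * inner (A \<omega>) (B \<omega>') \<partial>P)
        = L2inner P A (\<lambda>\<omega>. if c \<omega> = c \<omega>' then (1 / ?w) *\<^sub>R B \<omega>' else 0)"
      unfolding L2inner_def
      by (intro Bochner_Integration.integral_cong refl) (auto simp: cell_density_def)
    then show "(\<integral>\<omega>. cell_density P c \<omega> \<omega>' * inner (A \<omega>) (B \<omega>') \<partial>P) = 0" using cells by simp
  qed
  finally show ?thesis by simp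
qed

end

lemma small_cells:
  fixes \<epsilon> :: real
  assumes "0 < \<epsilon>"
  obtains cell :: "'a::{metric_space,second_countable_topology} \<Rightarrow> nat"
  where "cell \<in> measurable borel (count_space UNIV)" "\<And>x y. cell x = cell y \<Longrightarrow> dist x y < \<epsilon>"
proof -
  obtain D :: "'a set" where D: "countable D" "\<And>X. open X \<Longrightarrow> X \<noteq> {} \<Longrightarrow> \<exists>d\<in>D. d \<in> X"
    using countable_dense_setE by blast
  define cell where "cell x = (LEAST i. dist x (from_nat_into D i) < \<epsilon> / 2)" for x
  have "\<exists>i. dist x (from_nat_into D i) < \<epsilon> / 2" for x
  proof -
    obtain d where "d \<in> D" "d \<in> ball x (\<epsilon> / 2)" using D(2)[of "ball x (\<epsilon> / 2)"] assms by auto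
    then show ?thesis using from_nat_into_surj[OF D(1)] by (metis mem_ball)
  qed
  then have near: "dist x (from_nat_into D (cell x)) < \<epsilon> / 2" for x
    unfolding cell_def by (rule LeastI_ex)
  show thesis
  proof (rule that[of cell])
    show "cell \<in> measurable borel (count_space UNIV)" unfolding cell_def by measurable
    show "dist x y < \<epsilon>" if "cell x = cell y" for x y
      using near[of x] near[of y] that dist_triangle_half_l by metis
  qed
qed

section \<open>Totally dissipative fields and their Lagrangian solutions\<close>

lemma lagr_op_dissipative:
  fixes X V :: "'b \<Rightarrow> 'a::{real_inner,complete_space,second_countable_topology}"
  assumes G: "tdiss lam G" and R: "prob_space R"
    and f: "measure_preserving R P f" and g: "measure_preserving R Q g"
    and X: "(X, V) \<in> lagr_op P G" and Y: "(Y, W) \<in> lagr_op Q G"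
  shows "L2inner R (\<lambda>p. V (f p) - W (g p)) (\<lambda>p. X (f p) - Y (g p))
    \<le> lam * (L2norm R (\<lambda>p. X (f p) - Y (g p)))\<^sup>2"
proof -
  have L2: "X \<in> L2 P" "V \<in> L2 P" "Y \<in> L2 Q" "W \<in> L2 Q"
    and laws: "distr P borel (\<lambda>\<omega>. (X \<omega>, V \<omega>)) \<in> G" "distr Q borel (\<lambda>\<omega>. (Y \<omega>, W \<omega>)) \<in> G"
    using X Y by (simp_all add: lagr_op_def)
  note [measurable] = L2_measurable[OF L2_measure_preserving[OF f L2(1)]]
    L2_measurable[OF L2_measure_preserving[OF f L2(2)]]
    L2_measurable[OF L2_measure_preserving[OF g L2(3)]]
    L2_measurable[OF L2_measure_preserving[OF g L2(4)]]
  have "distr R borel (\<lambda>p. ((Y (g p), W (g p)), (X (f p), V (f p))))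
      \<in> Gamma (distr R borel (\<lambda>p. (Y (g p), W (g p)))) (distr R borel (\<lambda>p. (X (f p), V (f p))))"
    by (rule joint_law_in_Gamma[OF R]) measurable
  also have "distr R borel (\<lambda>p. (Y (g p), W (g p))) = distr Q borel (\<lambda>\<omega>. (Y \<omega>, W \<omega>))"
    using L2 by (intro distr_measure_preserving[OF g] borel_measurable_Pair L2_measurable)
  also have "distr R borel (\<lambda>p. (X (f p), V (f p))) = distr P borel (\<lambda>\<omega>. (X \<omega>, V \<omega>))"
    using L2 by (intro distr_measure_preserving[OF f] borel_measurable_Pair L2_measurable)
  finally show ?thesis
    using G laws unfolding tdiss_def L2inner_def L2norm_power2 by (fastforce simp: integral_distr)
qed

definition lipschitz_lagr_curve
  :: "'b measure \<Rightarrow> ('a::{real_inner,complete_space,second_countable_topology} \<times> 'a) measure set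
    \<Rightarrow> real \<Rightarrow> real \<Rightarrow> (real \<Rightarrow> 'b \<Rightarrow> 'a) \<Rightarrow> bool" where
  "lipschitz_lagr_curve P G C T X \<longleftrightarrow> L2_lipschitz_on P C {0..T} X \<and>
    (AE t in lborel. t \<in> {0<..<T} \<longrightarrow> (\<exists>W. (X t, W) \<in> lagr_op P G \<and> has_L2_right_deriv P X W t))"

lemma lagr_curve_imp_lipschitz:
  assumes "lagr_curve P G T X\<^sub>0 X"
  obtains C where "lipschitz_lagr_curve P G C T X"
proof -
  have XL2: "X t \<in> L2 P" if "t \<in> {0..T}" for t
    using assms that by (simp add: lagr_curve_def)
  obtain C where C: "\<And>s t. s \<in> {0..T} \<Longrightarrow> t \<in> {0..T} \<Longrightarrow> L2dist P (X s) (X t) \<le> C * \<bar>s - t\<bar>"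
    using assms unfolding lagr_curve_def by blast
  have "L2dist P (X s) (X t) \<le> \<bar>C\<bar> * \<bar>s - t\<bar>" if "s \<in> {0..T}" "t \<in> {0..T}" for s t
    using C[OF that] by (rule order_trans) (intro mult_right_mono, auto)
  then have lip: "L2_lipschitz_on P \<bar>C\<bar> {0..T} X"
    using XL2 by (simp add: L2_lipschitz_on_def L2dist_eq_L2norm)
  have "AE t in lborel. t \<in> {0<..<T} \<longrightarrow> (\<exists>W. (X t, W) \<in> lagr_op P G \<and>
      ((\<lambda>s. L2dist P (\<lambda>\<omega>. (1 / (s - t)) *\<^sub>R (X s \<omega> - X t \<omega>)) W) \<longlongrightarrow> 0) (at t within {0..T}))"
    using assms by (simp add: lagr_curve_def)
  then have "AE t in lborel. t \<in> {0<..<T}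
      \<longrightarrow> (\<exists>W. (X t, W) \<in> lagr_op P G \<and> has_L2_right_deriv P X W t)"
  proof eventually_elim
    case (elim t)
    have "has_L2_right_deriv P X W t"
      if t: "t \<in> {0<..<T}" and W: "(X t, W) \<in> lagr_op P G"
        and lim: "((\<lambda>s. L2dist P (\<lambda>\<omega>. (1 / (s - t)) *\<^sub>R (X s \<omega> - X t \<omega>)) W)
            \<longlongrightarrow> 0) (at t within {0..T})" for W
      unfolding has_L2_right_deriv_def
    proof (intro conjI)
      show "W \<in> L2 P" "X t \<in> L2 P" using W by (simp_all add: lagr_op_def)
      have "\<forall>\<^sub>F s in at_right t. s \<in> {t<..<T}" using t by (intro eventually_at_right_real) auto
      then show "\<forall>\<^sub>F s in at_right t. X s \<in> L2 P" by eventually_elim (use t XL2 in auto)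
      have "((\<lambda>s. L2dist P (\<lambda>\<omega>. (1 / (s - t)) *\<^sub>R (X s \<omega> - X t \<omega>)) W) \<longlongrightarrow> 0) (at t within {t..T})"
        using t by (intro tendsto_within_subset[OF lim]) auto
      then show "((\<lambda>s. L2norm P (\<lambda>\<omega>. (1 / (s - t)) *\<^sub>R (X s \<omega> - X t \<omega>) - W \<omega>)) \<longlongrightarrow> 0) (at_right t)"
        using at_within_Icc_at_right[of t T] t by (simp add: L2dist_eq_L2norm)
    qed
    then show ?case using elim by blast
  qed
  with lip that show thesis unfolding lipschitz_lagr_curve_def by blast
qed

lemma has_L2_right_deriv_cong_AE:
  fixes X Y :: "real \<Rightarrow> 'b \<Rightarrow> 'a::{real_inner,second_countable_topology}"
  assumes X: "has_L2_right_deriv M X V t" and t: "a \<le> t" "t < b"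
    and Y: "\<And>s. s \<in> {a..b} \<Longrightarrow> Y s \<in> borel_measurable M"
    and eq: "\<And>s. s \<in> {a..b} \<Longrightarrow> AE \<omega> in M. X s \<omega> = Y s \<omega>"
  shows "has_L2_right_deriv M Y V t"
  unfolding has_L2_right_deriv_def
proof (intro conjI)
  note XD = has_L2_right_derivD[OF X]
  have t_mem: "t \<in> {a..b}" using t by simp
  have near: "\<forall>\<^sub>F s in at_right t. s \<in> {t<..<b}"
    using t by (intro eventually_at_right_real) auto
  show "V \<in> L2 M" by (rule XD)
  show "Y t \<in> L2 M" by (rule L2_cong_AE[OF XD(2) Y eq]) (use t in auto)
  show "\<forall>\<^sub>F s in at_right t. Y s \<in> L2 M"
    using near XD(3)
  proof eventually_elim
    case (elim s)
    then show ?case using t by (intro L2_cong_AE[OF _ Y eq]) auto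
  qed
  have "\<forall>\<^sub>F s in at_right t. L2norm M (\<lambda>\<omega>. (1 / (s - t)) *\<^sub>R (X s \<omega> - X t \<omega>) - V \<omega>)
      = L2norm M (\<lambda>\<omega>. (1 / (s - t)) *\<^sub>R (Y s \<omega> - Y t \<omega>) - V \<omega>)"
    using near XD(3)
  proof eventually_elim
    case (elim s)
    then have s: "s \<in> {a..b}" using t by auto
    note [measurable] = L2_measurable[OF elim(2)] L2_measurable[OF XD(1)] L2_measurable[OF XD(2)]
      Y[OF s] Y[OF t_mem]
    show ?case
    proof (rule L2norm_cong_AE)
      show "AE \<omega> in M. (1 / (s - t)) *\<^sub>R (X s \<omega> - X t \<omega>) - V \<omega>
          = (1 / (s - t)) *\<^sub>R (Y s \<omega> - Y t \<omega>) - V \<omega>"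
        using eq[OF s] eq[OF t_mem] by eventually_elim simp
    qed measurable
  qed
  from Lim_transform_eventually[OF XD(4) this]
  show "((\<lambda>s. L2norm M (\<lambda>\<omega>. (1 / (s - t)) *\<^sub>R (Y s \<omega> - Y t \<omega>) - V \<omega>)) \<longlongrightarrow> 0) (at_right t)" .
qed

lemma lipschitz_lagr_curve_cong_AE:
  assumes X: "lipschitz_lagr_curve P G C T X"
    and Y: "\<And>t. t \<in> {0..T} \<Longrightarrow> Y t \<in> borel_measurable P"
    and eq: "\<And>t. t \<in> {0..T} \<Longrightarrow> AE \<omega> in P. X t \<omega> = Y t \<omega>"
  shows "lipschitz_lagr_curve P G C T Y"
  unfolding lipschitz_lagr_curve_def
proof
  have X_lip: "L2_lipschitz_on P C {0..T} X" using X by (simp add: lipschitz_lagr_curve_def)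
  then show lip: "L2_lipschitz_on P C {0..T} Y" by (rule L2_lipschitz_on_cong_AE[OF _ Y eq])
  show "AE t in lborel. t \<in> {0<..<T} \<longrightarrow> (\<exists>W. (Y t, W) \<in> lagr_op P G \<and> has_L2_right_deriv P Y W t)"
    using X[unfolded lipschitz_lagr_curve_def, THEN conjunct2]
  proof eventually_elim
    case (elim t)
    show ?case
    proof
      assume "t \<in> {0<..<T}"
      then have t: "t \<in> {0..T}" "0 \<le> t" "t < T" by auto
      obtain W where W: "(X t, W) \<in> lagr_op P G" "has_L2_right_deriv P X W t"
        using elim \<open>t \<in> {0<..<T}\<close> by blast
      note [measurable] = L2_measurable[OF L2_lipschitz_onD(2)[OF X_lip t(1)]] Y[OF t(1)]
        L2_measurable[OF has_L2_right_derivD(1)[OF W(2)]]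
      have "distr P borel (\<lambda>\<omega>. (Y t \<omega>, W \<omega>)) = distr P borel (\<lambda>\<omega>. (X t \<omega>, W \<omega>))"
        using eq[OF t(1)] by (intro distr_cong_AE) auto
      then have "(Y t, W) \<in> lagr_op P G"
        using W(1) L2_lipschitz_onD(2)[OF lip t(1)] by (simp add: lagr_op_def)
      moreover have "has_L2_right_deriv P Y W t"
        by (rule has_L2_right_deriv_cong_AE[OF W(2) t(2,3) Y eq])
      ultimately show "\<exists>W. (Y t, W) \<in> lagr_op P G \<and> has_L2_right_deriv P Y W t" by blast
    qed
  qed
qed

lemma lagr_solution_imp_lipschitz:
  assumes Xs: "lagr_solution P G T X\<^sub>0 X" and T: "0 \<le> T"
  obtains C where "lipschitz_lagr_curve P G C T (\<lambda>t \<omega>. X \<omega> t)" "AE \<omega> in P. X \<omega> 0 = X\<^sub>0 \<omega>"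
proof -
  obtain Y where Y: "lagr_curve P G T X\<^sub>0 Y" and eq: "\<And>t. t \<in> {0..T} \<Longrightarrow> AE \<omega> in P. X \<omega> t = Y t \<omega>"
    using Xs unfolding lagr_solution_def by blast
  obtain C where C: "lipschitz_lagr_curve P G C T Y" using lagr_curve_imp_lipschitz[OF Y] .
  have "lipschitz_lagr_curve P G C T (\<lambda>t \<omega>. X \<omega> t)"
  proof (rule lipschitz_lagr_curve_cong_AE[OF C])
    fix t assume t: "t \<in> {0..T}"
    show "(\<lambda>\<omega>. X \<omega> t) \<in> borel_measurable P"
      using Xs measurable_compose[OF _ measurable_component_singleton[OF t]]
      by (auto simp: lagr_solution_def)
    show "AE \<omega> in P. Y t \<omega> = X \<omega> t" using eq[OF t] by eventually_elim simp
  qed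
  moreover have "AE \<omega> in P. Y 0 \<omega> = X\<^sub>0 \<omega>" using Y by (simp add: lagr_curve_def)
  then have "AE \<omega> in P. X \<omega> 0 = X\<^sub>0 \<omega>" using eq[of 0] T by (auto elim: eventually_elim2)
  ultimately show thesis by (rule that)
qed

lemma lipschitz_lagr_curve_contraction:
  fixes X :: "real \<Rightarrow> 'b \<Rightarrow> 'a::{real_inner,complete_space,second_countable_topology}"
    and Y :: "real \<Rightarrow> 'c \<Rightarrow> 'a"
  assumes G: "tdiss lam G" and R: "prob_space R"
    and f: "measure_preserving R P f" and g: "measure_preserving R Q g"
    and X: "lipschitz_lagr_curve P G A T X" and Y: "lipschitz_lagr_curve Q G B T Y"
    and t: "t \<in> {0..T}"
  shows "(L2norm R (\<lambda>p. X t (f p) - Y t (g p)))\<^sup>2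
    \<le> exp (2 * \<bar>lam\<bar> * t) * (L2norm R (\<lambda>p. X 0 (f p) - Y 0 (g p)))\<^sup>2"
proof -
  let ?D = "\<lambda>t p. X t (f p) - Y t (g p)"
  have lip: "L2_lipschitz_on R (A + B) {0..T} ?D"
    using X Y unfolding lipschitz_lagr_curve_def
    by (intro L2_lipschitz_on_diff L2_lipschitz_on_measure_preserving[OF f]
        L2_lipschitz_on_measure_preserving[OF g]) auto
  have "AE t in lborel. t \<in> {0<..<T} \<longrightarrow>
      (\<exists>V. has_L2_right_deriv R ?D V t \<and> L2inner R V (?D t)
        \<le> \<bar>lam\<bar> * (L2norm R (?D t))\<^sup>2 + 0)"
    using X[unfolded lipschitz_lagr_curve_def, THEN conjunct2]
      Y[unfolded lipschitz_lagr_curve_def, THEN conjunct2]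
  proof eventually_elim
    case (elim t)
    show ?case
    proof
      assume "t \<in> {0<..<T}"
      then obtain V W where V: "(X t, V) \<in> lagr_op P G" "has_L2_right_deriv P X V t"
        and W: "(Y t, W) \<in> lagr_op Q G" "has_L2_right_deriv Q Y W t"
        using elim by blast
      have "L2inner R (\<lambda>p. V (f p) - W (g p)) (?D t) \<le> lam * (L2norm R (?D t))\<^sup>2"
        by (rule lagr_op_dissipative[OF G R f g V(1) W(1)])
      also have "\<dots> \<le> \<bar>lam\<bar> * (L2norm R (?D t))\<^sup>2 + 0"
        by (simp add: mult_right_mono)
      finally show "\<exists>V. has_L2_right_deriv R ?D V t \<and> L2inner R V (?D t)
          \<le> \<bar>lam\<bar> * (L2norm R (?D t))\<^sup>2 + 0"
        using has_L2_right_deriv_diff[OF has_L2_right_deriv_measure_preserving[OF f V(2)]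
            has_L2_right_deriv_measure_preserving[OF g W(2)]]
        by blast
    qed
  qed
  from L2_Gronwall[OF lip this abs_ge_zero order_refl t] show ?thesis by simp
qed

section \<open>Barycenters and disintegrations\<close>

lemma simple_approximation_of_identity:
  obtains s :: "nat \<Rightarrow> 'a::{real_normed_vector,second_countable_topology} \<Rightarrow> 'a"
  where "\<And>i. simple_function borel (s i)" "\<And>v. (\<lambda>i. s i v) \<longlonglongrightarrow> v"
    "\<And>i v. norm (s i v) \<le> 2 * norm v"
proof -
  have "(\<lambda>v::'a. v) \<in> borel_measurable borel" by simp
  from borel_measurable_implies_sequence_metric[OF this, of 0]
  show thesis using that by simp metis
qed

lemma simple_bochner_integral_Cauchy:
  fixes f :: "'b \<Rightarrow> 'a::{real_normed_vector,second_countable_topology}"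
  assumes f: "f \<in> borel_measurable M"
    and s: "\<And>i. Bochner_Integration.simple_bochner_integrable M (s i)"
    and lim: "(\<lambda>i. \<integral>\<^sup>+x. norm (f x - s i x) \<partial>M) \<longlonglongrightarrow> 0"
  shows "Cauchy (\<lambda>i. Bochner_Integration.simple_bochner_integral M (s i))" (is "Cauchy ?I")
proof (rule metric_CauchyI)
  fix e :: real assume "0 < e"
  then have "0 < ennreal (e / 2)" by simp
  from order_tendstoD(2)[OF lim this]
  obtain n\<^sub>0 where n\<^sub>0: "\<And>n. n\<^sub>0 \<le> n \<Longrightarrow> (\<integral>\<^sup>+x. norm (f x - s n x) \<partial>M) < ennreal (e / 2)"
    by (auto simp: eventually_sequentially)
  have "dist (?I m) (?I n) < e" if "n\<^sub>0 \<le> m" "n\<^sub>0 \<le> n" for m n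
  proof -
    have "ennreal (norm (?I m - ?I n))
        \<le> (\<integral>\<^sup>+x. norm (f x - s m x) \<partial>M) + (\<integral>\<^sup>+x. norm (f x - s n x) \<partial>M)"
      by (intro simple_bochner_integral_bounded s f)
    also have "\<dots> < ennreal (e / 2) + ennreal (e / 2)"
      by (intro add_strict_mono n\<^sub>0 that)
    also have "\<dots> = ennreal e" using \<open>0 < e\<close> by (simp flip: ennreal_plus)
    finally show ?thesis using \<open>0 < e\<close> by (simp add: dist_norm ennreal_less_iff)
  qed
  then show "\<exists>n\<^sub>0. \<forall>m\<ge>n\<^sub>0. \<forall>n\<ge>n\<^sub>0. dist (?I m) (?I n) < e" by blast
qed

text \<open>The sort of the ambient space does not include \<open>banach\<close>, so the library's
  integrability criterion does not apply to vector-valued functions.\<close>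

lemma barycenter_limit:
  fixes s :: "nat \<Rightarrow> 'a \<Rightarrow> 'a::{real_normed_vector,complete_space,second_countable_topology}"
    and M :: "'a measure"
  assumes s: "\<And>i. simple_function borel (s i)" "\<And>v. (\<lambda>i. s i v) \<longlonglongrightarrow> v"
    "\<And>i v. norm (s i v) \<le> 2 * norm v"
    and M: "sets M = sets borel" and fin: "(\<integral>\<^sup>+v. norm v \<partial>M) < \<infinity>"
  shows "has_bochner_integral M (\<lambda>v. v) (\<integral>v. v \<partial>M)"
    and "(\<lambda>i. Bochner_Integration.simple_bochner_integral M (s i)) \<longlonglongrightarrow> (\<integral>v. v \<partial>M)"
proof -
  let ?I = "Bochner_Integration.simple_bochner_integral M"
  have [measurable_cong]: "sets M = sets borel" by fact
  have simple: "simple_function M (s i)" for i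
    using s(1)[of i] simple_function_cong_algebra[OF M] M sets_eq_imp_space_eq[OF M] by blast
  then have [measurable]: "s i \<in> borel_measurable M" for i
    by (rule borel_measurable_simple_function)
  have fin_dominating: "(\<integral>\<^sup>+v. ennreal (2 * norm v) \<partial>M) < \<infinity>"
    using fin by (simp add: nn_integral_cmult ennreal_mult ennreal_mult_less_top)
  have integrable: "Bochner_Integration.simple_bochner_integrable M (s i)" for i
  proof (rule simple_bochner_integrableI_bounded[OF simple])
    have "(\<integral>\<^sup>+v. norm (s i v) \<partial>M) \<le> (\<integral>\<^sup>+v. ennreal (2 * norm v) \<partial>M)"
      using s(3) by (intro nn_integral_mono ennreal_leI)
    then show "(\<integral>\<^sup>+v. norm (s i v) \<partial>M) < \<infinity>" using fin_dominating by (rule le_less_trans)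
  qed
  have lim: "(\<lambda>i. \<integral>\<^sup>+v. norm (v - s i v) \<partial>M) \<longlonglongrightarrow> 0"
    by (rule nn_integral_dominated_convergence_norm[where w = "\<lambda>v. 2 * norm v"])
      (use s fin_dominating in auto)
  have "Cauchy (\<lambda>i. ?I (s i))"
    by (rule simple_bochner_integral_Cauchy[OF _ integrable lim]) simp
  then obtain b where b: "(\<lambda>i. ?I (s i)) \<longlonglongrightarrow> b"
    using Cauchy_convergent_iff convergent_def by blast
  have "has_bochner_integral M (\<lambda>v. v) b"
    by (rule has_bochner_integral.intros[OF _ integrable lim b]) simp
  moreover from this have "(\<integral>v. v \<partial>M) = b" by (rule has_bochner_integral_integral_eq)
  ultimately show "has_bochner_integral M (\<lambda>v. v) (\<integral>v. v \<partial>M)" "(\<lambda>i. ?I (s i)) \<longlonglongrightarrow> (\<integral>v. v \<partial>M)"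
    using b by simp_all
qed

lemma has_bochner_integral_barycenter:
  fixes M :: "'a::{real_normed_vector,complete_space,second_countable_topology} measure"
  assumes "sets M = sets borel" "(\<integral>\<^sup>+v. norm v \<partial>M) < \<infinity>"
  shows "has_bochner_integral M (\<lambda>v. v) (\<integral>v. v \<partial>M)"
proof -
  obtain s :: "nat \<Rightarrow> 'a \<Rightarrow> 'a" where "\<And>i. simple_function borel (s i)" "\<And>v. (\<lambda>i. s i v) \<longlonglongrightarrow> v"
    "\<And>i v. norm (s i v) \<le> 2 * norm v"
    using simple_approximation_of_identity by blast
  from barycenter_limit(1)[OF this assms] show ?thesis .
qed

lemma has_bochner_integral_inner_centered:
  fixes M :: "'a::{real_inner,complete_space,second_countable_topology} measure"
  assumes M: "prob_space M" "sets M = sets borel" and fin: "(\<integral>\<^sup>+v. norm v \<partial>M) < \<infinity>"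
  shows "has_bochner_integral M (\<lambda>v. inner (v - (\<integral>v. v \<partial>M)) w) 0"
proof -
  interpret prob_space M by fact
  let ?b = "\<integral>v. v \<partial>M"
  have "has_bochner_integral M (\<lambda>_. inner ?b w) (inner ?b w)"
    using has_bochner_integral_integrable[of M "\<lambda>_. inner ?b w"] by (simp add: prob_space)
  from has_bochner_integral_diff[OF has_bochner_integral_inner_left this]
  have "has_bochner_integral M (\<lambda>v. inner v w - inner ?b w) (inner ?b w - inner ?b w)"
    using has_bochner_integral_barycenter[OF M(2) fin] by blast
  then show ?thesis by (simp add: inner_diff_left)
qed

lemma simple_bochner_integral_kernel_measurable:
  fixes s :: "'d::topological_space \<Rightarrow> 'a::{real_normed_vector,second_countable_topology}"
  assumes K: "K \<in> measurable N (subprob_algebra borel)" and s: "simple_function borel s"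
  shows "(\<lambda>x. Bochner_Integration.simple_bochner_integral (K x) s) \<in> borel_measurable N"
proof -
  have "{v. s v = y} \<in> sets borel" for y
    using simple_functionD(2)[OF s, of "{y}"] by (simp add: vimage_def)
  then have [measurable]: "(\<lambda>x. measure (K x) {v. s v = y}) \<in> borel_measurable N" for y
    by (intro measurable_compose[OF K measurable_measure_subprob_algebra])
  have "Bochner_Integration.simple_bochner_integral (K x) s
      = (\<Sum>y\<in>range s. measure (K x) {v. s v = y} *\<^sub>R y)" if "x \<in> space N" for x
  proof -
    have "space (K x) = UNIV"
      using measurable_space[OF K that] sets_eq_imp_space_eq[of "K x" borel]
      by (simp add: space_subprob_algebra)
    then show ?thesis by (simp add: simple_bochner_integral_def)
  qed
  then show ?thesis by (subst measurable_cong) measurable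
qed

lemma barycenter_measurable:
  fixes K :: "'c \<Rightarrow> 'a::{real_normed_vector,complete_space,second_countable_topology} measure"
  assumes K [measurable]: "K \<in> measurable N (subprob_algebra borel)"
  shows "(\<lambda>x. \<integral>v. v \<partial>K x) \<in> borel_measurable N"
proof -
  obtain s :: "nat \<Rightarrow> 'a \<Rightarrow> 'a" where s: "\<And>i. simple_function borel (s i)" "\<And>v. (\<lambda>i. s i v) \<longlonglongrightarrow> v"
    "\<And>i v. norm (s i v) \<le> 2 * norm v"
    using simple_approximation_of_identity by blast
  note [measurable] = simple_bochner_integral_kernel_measurable[OF K s(1)]
  define F where "F = {x \<in> space N. (\<integral>\<^sup>+v. norm v \<partial>K x) < \<infinity>}"
  have [measurable]: "(\<lambda>x. \<integral>\<^sup>+v. norm v \<partial>K x) \<in> borel_measurable N"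
    by (rule measurable_compose[OF K nn_integral_measurable_subprob_algebra]) simp
  have [measurable]: "F \<in> sets N" unfolding F_def by measurable
  let ?I = "\<lambda>i x. Bochner_Integration.simple_bochner_integral (K x) (s i)"
  show ?thesis
  proof (rule borel_measurable_LIMSEQ_metric)
    show "(\<lambda>x. if x \<in> F then ?I i x else 0) \<in> borel_measurable N" for i by measurable
    fix x assume x: "x \<in> space N"
    show "(\<lambda>i. if x \<in> F then ?I i x else 0) \<longlonglongrightarrow> (\<integral>v. v \<partial>K x)"
    proof (cases "x \<in> F")
      case True
      have "sets (K x) = sets borel" using measurable_space[OF K x]
        by (simp add: space_subprob_algebra)
      from barycenter_limit(2)[OF s this] show ?thesis using True by (simp add: F_def)
    next
      case False
      then have "\<not> integrable (K x) (\<lambda>v. v)"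
        using has_bochner_integral_implies_finite_norm[OF has_bochner_integral_integrable] x
        by (auto simp: F_def)
      then show ?thesis using False by (simp add: not_integrable_integral_eq)
    qed
  qed
qed

lemma disint_prob_space: "disint \<mu> \<Phi> K \<Longrightarrow> prob_space (K x)"
  and disint_sets: "disint \<mu> \<Phi> K \<Longrightarrow> sets (K x) = sets borel"
  by (auto simp: disint_def)

lemma disint_kernel:
  assumes "disint \<mu> \<Phi> K" "sets \<mu> = sets borel"
  shows "K \<in> measurable borel (subprob_algebra borel)"
  unfolding measurable_cong_sets[OF assms(2)[symmetric] refl] using assms(1)
  by (intro measurable_subprob_algebra) (auto simp: disint_def intro: prob_space_imp_subprob_space)

lemma disint_nn_integral:
  fixes \<Phi> :: "('c::second_countable_topology \<times> 'd::second_countable_topology) measure"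
  assumes K: "disint \<mu> \<Phi> K" and sets: "sets \<mu> = sets borel" "sets \<Phi> = sets borel"
    and f: "f \<in> borel_measurable borel"
  shows "(\<integral>\<^sup>+p. f p \<partial>\<Phi>) = (\<integral>\<^sup>+x. \<integral>\<^sup>+y. f (x, y) \<partial>K x \<partial>\<mu>)"
proof -
  note [measurable_cong] = sets(1) disint_sets[OF K]
  have space: "space \<mu> = UNIV" "space (K x) = UNIV" for x
    using sets_eq_imp_space_eq[OF sets(1)] sets_eq_imp_space_eq[OF disint_sets[OF K]] by simp_all
  have kernel: "(\<lambda>x. distr (K x) borel (Pair x)) \<in> measurable \<mu> (subprob_algebra borel)"
  proof (rule measurable_distr2[where M = borel])
    show "case_prod Pair \<in> measurable (\<mu> \<Otimes>\<^sub>M borel) (borel :: ('c \<times> 'd) measure)"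
      unfolding measurable_cong_sets[OF sets_pair_measure_cong[OF sets(1) refl] refl] borel_prod
      by simp
    show "K \<in> measurable \<mu> (subprob_algebra borel)"
      using disint_kernel[OF K sets(1)] by (simp add: measurable_cong_sets[OF sets(1) refl])
  qed
  have "\<Phi> = \<mu> \<bind> (\<lambda>x. distr (K x) borel (Pair x))"
  proof (rule measure_eqI)
    show "sets \<Phi> = sets (\<mu> \<bind> (\<lambda>x. distr (K x) borel (Pair x)))"
      using sets space by (simp add: sets_bind[OF sets_kernel[OF kernel]])
  next
    fix S assume "S \<in> sets \<Phi>"
    then have S: "S \<in> sets borel" using sets by simp
    have "emeasure (distr (K x) borel (Pair x)) S = emeasure (K x) (Pair x -` S)" for x
      using S space by (subst emeasure_distr) (auto intro: borel_measurable_Pair)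
    then show "emeasure \<Phi> S = emeasure (\<mu> \<bind> (\<lambda>x. distr (K x) borel (Pair x))) S"
      using K S by (subst emeasure_bind[OF _ kernel S]) (auto simp: space disint_def)
  qed
  then have "(\<integral>\<^sup>+p. f p \<partial>\<Phi>) = (\<integral>\<^sup>+x. \<integral>\<^sup>+p. f p \<partial>distr (K x) borel (Pair x) \<partial>\<mu>)"
    by (simp add: nn_integral_bind[OF f kernel])
  also have "\<dots> = (\<integral>\<^sup>+x. \<integral>\<^sup>+y. f (x, y) \<partial>K x \<partial>\<mu>)"
    using f by (intro nn_integral_cong nn_integral_distr) (auto intro: borel_measurable_Pair)
  finally show ?thesis .
qed

lemma disint_distr:
  fixes \<Phi> :: "('c::second_countable_topology \<times> 'd::second_countable_topology) measure"
    and g :: "'c \<Rightarrow> 'd \<Rightarrow> 'e::second_countable_topology"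
  assumes K: "disint \<mu> \<Phi> K" and sets: "sets \<mu> = sets borel" "sets \<Phi> = sets borel"
    and g: "case_prod g \<in> borel_measurable (borel \<Otimes>\<^sub>M borel)"
  shows "disint \<mu> (distr \<Phi> borel (\<lambda>p. (fst p, g (fst p) (snd p)))) (\<lambda>x. distr (K x) borel (g x))"
    (is "disint _ (distr _ _ ?f) ?L")
proof -
  have gx: "g x \<in> measurable (K x) borel" for x
    unfolding measurable_cong_sets[OF disint_sets[OF K] refl]
    using measurable_compose[OF measurable_Pair1' g, of x] by simp
  have L: "?L \<in> measurable borel (subprob_algebra borel)"
    by (rule measurable_distr2[OF g disint_kernel[OF K sets(1)]])
  have f: "?f \<in> measurable borel borel"
    using g by (simp add: borel_prod[symmetric] case_prod_beta')
  have "emeasure (distr \<Phi> borel ?f) C = (\<integral>\<^sup>+x. emeasure (?L x) (Pair x -` C) \<partial>\<mu>)"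
    if C: "C \<in> sets borel" for C
  proof -
    have "emeasure (distr \<Phi> borel ?f) C = (\<integral>\<^sup>+p. indicator C (?f p) \<partial>\<Phi>)"
      by (rule emeasure_distr_eq_nn_integral)
        (use C f in \<open>simp_all add: measurable_cong_sets[OF sets(2) refl]\<close>)
    also have "\<dots> = (\<integral>\<^sup>+x. \<integral>\<^sup>+y. indicator C (?f (x, y)) \<partial>K x \<partial>\<mu>)"
      by (rule disint_nn_integral[OF K sets measurable_compose[OF f]]) (use C in simp)
    also have "\<dots> = (\<integral>\<^sup>+x. emeasure (?L x) (Pair x -` C) \<partial>\<mu>)"
    proof (rule nn_integral_cong)
      fix x
      have "Pair x -` C \<in> sets borel"
        using measurable_sets[OF borel_measurable_Pair C, of "\<lambda>_. x" borel "\<lambda>y. y"] by simp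
      from emeasure_distr_eq_nn_integral[OF gx this, of x]
      show "(\<integral>\<^sup>+y. indicator C (?f (x, y)) \<partial>K x) = emeasure (?L x) (Pair x -` C)"
        by (simp add: indicator_def)
    qed
    finally show ?thesis .
  qed
  moreover have "prob_space (?L x)" for x
    by (rule prob_space.prob_space_distr[OF disint_prob_space[OF K] gx])
  moreover have "(\<lambda>x. emeasure (?L x) B) \<in> borel_measurable \<mu>" if "B \<in> sets borel" for B
    unfolding measurable_cong_sets[OF sets(1) refl]
    by (rule measurable_compose[OF L measurable_emeasure_subprob_algebra[OF that]])
  ultimately show ?thesis unfolding disint_def by simp
qed

lemma integral_eq_0_if_kernel_centered:
  fixes g :: "'c \<times> 'd \<Rightarrow> real"
  assumes kernel: "\<And>f. f \<in> borel_measurable S \<Longrightarrow>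
      (\<integral>\<^sup>+\<omega>. f (U \<omega>, V \<omega>) \<partial>P) = (\<integral>\<^sup>+\<omega>. \<integral>\<^sup>+v. f (U \<omega>, v) \<partial>\<kappa> \<omega> \<partial>P)"
    and g [measurable]: "g \<in> borel_measurable S" and int: "integrable P (\<lambda>\<omega>. g (U \<omega>, V \<omega>))"
    and centered: "AE \<omega> in P. has_bochner_integral (\<kappa> \<omega>) (\<lambda>v. g (U \<omega>, v)) 0"
  shows "(\<integral>\<omega>. g (U \<omega>, V \<omega>) \<partial>P) = 0"
proof -
  have "(\<integral>\<^sup>+\<omega>. \<integral>\<^sup>+v. ennreal (g (U \<omega>, v)) \<partial>\<kappa> \<omega> \<partial>P)
      = (\<integral>\<^sup>+\<omega>. \<integral>\<^sup>+v. ennreal (- g (U \<omega>, v)) \<partial>\<kappa> \<omega> \<partial>P)"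
    using centered
  proof (intro nn_integral_cong_AE, eventually_elim)
    case (elim \<omega>)
    then have integrable: "integrable (\<kappa> \<omega>) (\<lambda>v. g (U \<omega>, v))" and "(\<integral>v. g (U \<omega>, v) \<partial>\<kappa> \<omega>) = 0"
      by (auto simp: has_bochner_integral_iff)
    moreover have "(\<integral>\<^sup>+v. ennreal (g (U \<omega>, v)) \<partial>\<kappa> \<omega>) \<noteq> \<infinity>" "(\<integral>\<^sup>+v. ennreal (- g (U \<omega>, v)) \<partial>\<kappa> \<omega>) \<noteq> \<infinity>"
      using integrable by (auto simp: real_integrable_def)
    ultimately show ?case
      unfolding real_lebesgue_integral_def[OF integrable]
      by (metis ennreal_enn2real_if infinity_ennreal_def right_minus_eq)
  qed
  then have "(\<integral>\<^sup>+\<omega>. ennreal (g (U \<omega>, V \<omega>)) \<partial>P) = (\<integral>\<^sup>+\<omega>. ennreal (- g (U \<omega>, V \<omega>)) \<partial>P)"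
    using kernel[of "\<lambda>p. ennreal (g p)"] kernel[of "\<lambda>p. ennreal (- g p)"] by simp
  then show ?thesis by (simp add: real_lebesgue_integral_def[OF int])
qed

section \<open>Gluing a chain of transport plans\<close>

lemma seqM_eq_Ico:
  "(seqM n :: (nat \<Rightarrow> 'a::topological_space) measure) = Pi\<^sub>M {0..<Suc n} (\<lambda>_. borel)"
  by (simp only: atLeastLessThanSuc_atLeastAtMost)

lemma seqM_component_measurable:
  "i \<le> n \<Longrightarrow> (\<lambda>x. x i) \<in> measurable (seqM n) (borel :: 'a::topological_space measure)"
  by (rule measurable_component_singleton) simp

lemma seqM_restrict_measurable:
  assumes "m \<le> n"
  shows "(\<lambda>x. restrict x {0..m})
      \<in> measurable (seqM n) (seqM m :: (nat \<Rightarrow> 'a::topological_space) measure)"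
  using assms by (intro measurable_restrict_subset) auto

lemma seqM_fun_upd_measurable:
  fixes x :: "nat \<Rightarrow> 'a::topological_space"
  assumes "x \<in> space (Pi\<^sub>M J (\<lambda>_. borel :: 'a measure))" "{0..n} = J \<union> {i}"
  shows "(\<lambda>y. x(i := y)) \<in> measurable borel (seqM n)"
  by (rule measurable_fun_upd[OF assms(2) measurable_const[OF assms(1)]]) simp

locale plan_chain =
  fixes Ts :: "nat \<Rightarrow> ('a::second_countable_topology \<times> 'a) measure" and K :: "nat \<Rightarrow> 'a \<Rightarrow> 'a measure"
    and N :: nat
  assumes N_pos: "0 < N"
    and sets_plan: "n < N \<Longrightarrow> sets (Ts n) = sets borel"
    and prob_plan: "n < N \<Longrightarrow> prob_space (Ts n)"
    and disint_plan: "n < N \<Longrightarrow> disint (distr (Ts n) borel fst) (Ts n) (K n)"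
    and plans_match: "Suc n < N \<Longrightarrow> distr (Ts n) borel snd = distr (Ts (Suc n)) borel fst"
begin

text \<open>The value \<open>return borel undefined\<close> beyond the last plan is irrelevant.\<close>

definition transition :: "nat \<Rightarrow> (nat \<Rightarrow> 'a) \<Rightarrow> 'a measure" where
  "transition i x = (case i of 0 \<Rightarrow> distr (Ts 0) borel fst
    | Suc n \<Rightarrow> if n < N then K n (x n) else return borel undefined)"

lemma transition_simps [simp]:
  "transition 0 x = distr (Ts 0) borel fst" "n < N \<Longrightarrow> transition (Suc n) x = K n (x n)"
  by (simp_all add: transition_def)

lemma plan_kernel: "n < N \<Longrightarrow> K n \<in> measurable borel (subprob_algebra borel)"
  by (rule disint_kernel[OF disint_plan]) auto

lemma fst_plan_measurable: "n < N \<Longrightarrow> fst \<in> measurable (Ts n) borel"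
  and snd_plan_measurable: "n < N \<Longrightarrow> snd \<in> measurable (Ts n) borel"
  by (simp_all add: measurable_cong_sets[OF sets_plan refl] borel_measurable_fst
      borel_measurable_snd)

lemma nn_integral_plan:
  assumes n: "n < N" and f: "f \<in> borel_measurable borel"
  shows "(\<integral>\<^sup>+p. f p \<partial>Ts n) = (\<integral>\<^sup>+p. \<integral>\<^sup>+y. f (fst p, y) \<partial>K n (fst p) \<partial>Ts n)"
proof -
  have "(\<lambda>z. \<integral>\<^sup>+y. f (z, y) \<partial>K n z) \<in> borel_measurable borel"
    using f by (intro nn_integral_measurable_subprob_algebra2[OF _ plan_kernel[OF n]])
      (simp add: borel_prod)
  then show ?thesis
    using f by (subst disint_nn_integral[OF disint_plan[OF n] _ sets_plan[OF n]])
      (simp_all add: nn_integral_distr fst_plan_measurable n)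
qed

lemma prob_space_transition: "prob_space (transition i x)"
  using N_pos disint_prob_space[OF disint_plan]
  by (auto simp: transition_def split: nat.split
      intro: prob_space.prob_space_distr prob_plan fst_plan_measurable prob_space_return)

lemma transition_measurable:
  "transition i \<in> measurable (Pi\<^sub>M {0..<i} (\<lambda>_. borel)) (subprob_algebra borel)"
proof (cases i)
  case 0
  have "distr (Ts 0) borel fst \<in> space (subprob_algebra borel)"
    using prob_space_transition[of 0]
    by (simp add: space_subprob_algebra prob_space_imp_subprob_space)
  then show ?thesis by (simp add: 0 transition_def[abs_def])
next
  case (Suc n)
  have "(\<lambda>x. x n) \<in> measurable (Pi\<^sub>M {0..<i} (\<lambda>_. borel)) (borel :: 'a measure)"
    using Suc by (intro measurable_component_singleton) auto
  from measurable_compose[OF this plan_kernel[of n]] show ?thesis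
    by (cases "n < N") (auto simp: Suc transition_def[abs_def] space_subprob_algebra
        intro!: prob_space_imp_subprob_space prob_space_return)
qed

sublocale Ionescu_Tulcea transition "\<lambda>_. borel"
  by (rule Ionescu_Tulcea.intro) (rule transition_measurable prob_space_transition)+

declare C.simps [simp del]

abbreviation nodes_law :: "nat \<Rightarrow> (nat \<Rightarrow> 'a) measure" where
  "nodes_law n \<equiv> C 0 (Suc n) (\<lambda>_. undefined)"

lemma sets_nodes_law [measurable_cong]: "sets (nodes_law n) = sets (seqM n)"
  unfolding seqM_eq_Ico by (subst sets_C) simp_all

lemma space_nodes_law: "space (nodes_law n) = space (seqM n)"
  by (rule sets_eq_imp_space_eq[OF sets_nodes_law])

lemma nn_integral_nodes_law_0:
  assumes "f \<in> borel_measurable (seqM 0)"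
  shows "(\<integral>\<^sup>+x. f x \<partial>nodes_law 0) = (\<integral>\<^sup>+p. f ((\<lambda>_. undefined)(0 := fst p)) \<partial>Ts 0)"
proof -
  have "nodes_law 0 = eP 0 (\<lambda>_. undefined)"
    using bind_return[OF measurable_eP[of 0]] by (simp add: C.simps)
  then have "(\<integral>\<^sup>+x. f x \<partial>nodes_law 0)
      = (\<integral>\<^sup>+z. f ((\<lambda>_. undefined)(0 := z)) \<partial>transition 0 (\<lambda>_. undefined))"
    using assms by (simp only:) (rule nn_integral_eP, auto simp: seqM_eq_Ico)
  also have "\<dots> = (\<integral>\<^sup>+p. f ((\<lambda>_. undefined)(0 := fst p)) \<partial>Ts 0)"
  proof -
    have "(\<lambda>z. f ((\<lambda>_. undefined)(0 := z))) \<in> borel_measurable borel"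
      using measurable_compose[OF seqM_fun_upd_measurable[of "\<lambda>_. undefined" "{}" 0 0] assms]
      by simp
    then show ?thesis
      using N_pos by (simp add: nn_integral_distr fst_plan_measurable)
  qed
  finally show ?thesis .
qed

lemma nn_integral_nodes_law_Suc:
  assumes "n < N" and f: "f \<in> borel_measurable (seqM (Suc n))"
  shows "(\<integral>\<^sup>+x. f x \<partial>nodes_law (Suc n)) = (\<integral>\<^sup>+x. \<integral>\<^sup>+y. f (x(Suc n := y)) \<partial>K n (x n) \<partial>nodes_law n)"
proof -
  have "(\<integral>\<^sup>+x. f x \<partial>nodes_law (Suc n)) = (\<integral>\<^sup>+x. \<integral>\<^sup>+z. f z \<partial>eP (Suc n) x \<partial>nodes_law n)"
    unfolding C.simps(2)[of 0 "Suc n"] using f measurable_eP[of "Suc n"]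
    by (subst nn_integral_bind[where B = "seqM (Suc n)"])
      (simp_all add: seqM_eq_Ico measurable_cong_sets[OF sets_nodes_law refl])
  also have "\<dots> = (\<integral>\<^sup>+x. \<integral>\<^sup>+y. f (x(Suc n := y)) \<partial>K n (x n) \<partial>nodes_law n)"
    using f assms(1)
    by (intro nn_integral_cong) (simp add: nn_integral_eP seqM_eq_Ico space_nodes_law)
  finally show ?thesis .
qed

lemma nn_integral_nodes_law_prefix:
  assumes "m \<le> n" "f \<in> borel_measurable (seqM m)"
  shows "(\<integral>\<^sup>+x. f x \<partial>nodes_law m) = (\<integral>\<^sup>+x. f (restrict x {0..m}) \<partial>nodes_law n)"
  using assms unfolding seqM_eq_Ico
  by (subst nn_integral_C[of "Suc m" "Suc n" f 0 "\<lambda>_. undefined"])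
    (simp_all add: atLeastLessThanSuc_atLeastAtMost)

lemma transition_integral_measurable:
  assumes n: "n < N" and f: "f \<in> borel_measurable (seqM (Suc n))"
  shows "(\<lambda>x. \<integral>\<^sup>+y. f (x(Suc n := y)) \<partial>K n (x n)) \<in> borel_measurable (seqM n)"
proof (rule nn_integral_measurable_subprob_algebra2)
  have "(\<lambda>(x, y). x(Suc n := y)) \<in> measurable (seqM n \<Otimes>\<^sub>M borel) (seqM (Suc n))"
    using measurable_add_dim[of "Suc n" "{0..n}" "\<lambda>_. borel"] by (simp add: atLeast0_atMost_Suc)
  from measurable_compose[OF this f]
  show "(\<lambda>(x, y). f (x(Suc n := y))) \<in> borel_measurable (seqM n \<Otimes>\<^sub>M borel)"
    by (simp add: case_prod_beta')
  show "(\<lambda>x. K n (x n)) \<in> measurable (seqM n) (subprob_algebra borel)"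
    by (rule measurable_compose[OF seqM_component_measurable plan_kernel[OF n]]) simp
qed

lemma nn_integral_nodes_law_Markov:
  assumes n: "n < N" and f: "f \<in> borel_measurable (seqM (Suc n))"
  shows "(\<integral>\<^sup>+x. f (restrict x {0..Suc n}) \<partial>nodes_law N)
    = (\<integral>\<^sup>+x. \<integral>\<^sup>+y. f ((restrict x {0..n})(Suc n := y)) \<partial>K n (x n) \<partial>nodes_law N)"
proof -
  have "(\<integral>\<^sup>+x. f (restrict x {0..Suc n}) \<partial>nodes_law N) = (\<integral>\<^sup>+x. f x \<partial>nodes_law (Suc n))"
    using n by (intro nn_integral_nodes_law_prefix[symmetric] f) simp
  also have "\<dots> = (\<integral>\<^sup>+x. \<integral>\<^sup>+y. f (x(Suc n := y)) \<partial>K n (x n) \<partial>nodes_law n)"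
    by (rule nn_integral_nodes_law_Suc[OF n f])
  also have "\<dots> = (\<integral>\<^sup>+x. \<integral>\<^sup>+y. f ((restrict x {0..n})(Suc n := y)) \<partial>K n (x n) \<partial>nodes_law N)"
    using n nn_integral_nodes_law_prefix[OF _ transition_integral_measurable[OF n f], of N] by simp
  finally show ?thesis .
qed

lemma nn_integral_nodes_law_planI:
  assumes n: "n < N" and f: "f \<in> borel_measurable borel"
    and marginal: "\<And>g. g \<in> borel_measurable borel \<Longrightarrow>
      (\<integral>\<^sup>+x. g (x n) \<partial>nodes_law N) = (\<integral>\<^sup>+p. g (fst p) \<partial>Ts n)"
  shows "(\<integral>\<^sup>+x. f (x n, x (Suc n)) \<partial>nodes_law N) = (\<integral>\<^sup>+p. f p \<partial>Ts n)"
proof -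
  have kernel: "(\<lambda>z. \<integral>\<^sup>+y. f (z, y) \<partial>K n z) \<in> borel_measurable borel"
    using f by (intro nn_integral_measurable_subprob_algebra2[OF _ plan_kernel[OF n]])
      (simp add: borel_prod)
  have "(\<lambda>x. f (x n, x (Suc n))) \<in> borel_measurable (seqM (Suc n))"
    by (intro measurable_compose[OF borel_measurable_Pair f] seqM_component_measurable) auto
  from nn_integral_nodes_law_Markov[OF n this]
  have "(\<integral>\<^sup>+x. f (x n, x (Suc n)) \<partial>nodes_law N) = (\<integral>\<^sup>+x. \<integral>\<^sup>+y. f (x n, y) \<partial>K n (x n) \<partial>nodes_law N)"
    by simp
  also have "\<dots> = (\<integral>\<^sup>+p. \<integral>\<^sup>+y. f (fst p, y) \<partial>K n (fst p) \<partial>Ts n)"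
    by (rule marginal[OF kernel])
  also have "\<dots> = (\<integral>\<^sup>+p. f p \<partial>Ts n)"
    by (rule nn_integral_plan[OF n f, symmetric])
  finally show ?thesis .
qed

lemma nn_integral_nodes_law_marginal:
  assumes "n < N" "g \<in> borel_measurable borel"
  shows "(\<integral>\<^sup>+x. g (x n) \<partial>nodes_law N) = (\<integral>\<^sup>+p. g (fst p) \<partial>Ts n)"
  using assms
proof (induction n arbitrary: g)
  case 0
  have g: "(\<lambda>x. g (x 0)) \<in> borel_measurable (seqM 0)"
    by (rule measurable_compose[OF seqM_component_measurable 0(2)]) simp
  show ?case
    using nn_integral_nodes_law_prefix[OF _ g, of N] nn_integral_nodes_law_0[OF g] by simp
next
  case (Suc n)
  then have n: "n < N" by simp
  have "(\<lambda>p::'a \<times> 'a. g (snd p)) \<in> borel_measurable borel"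
    by (rule measurable_compose[OF borel_measurable_snd Suc.prems(2)]) simp
  from nn_integral_nodes_law_planI[OF n this Suc.IH[OF n]]
  have "(\<integral>\<^sup>+x. g (x (Suc n)) \<partial>nodes_law N) = (\<integral>\<^sup>+p. g (snd p) \<partial>Ts n)" by simp
  also have "\<dots> = (\<integral>\<^sup>+z. g z \<partial>distr (Ts n) borel snd)"
    using Suc.prems(2) by (intro nn_integral_distr[symmetric] snd_plan_measurable n) simp
  also have "\<dots> = (\<integral>\<^sup>+p. g (fst p) \<partial>Ts (Suc n))"
    unfolding plans_match[OF Suc.prems(1)]
    using Suc.prems by (intro nn_integral_distr fst_plan_measurable) simp_all
  finally show ?case .
qed

lemma nodes_law_plan:
  assumes n: "n < N"
  shows "distr (nodes_law N) borel (\<lambda>x. (x n, x (Suc n))) = Ts n"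
proof (rule distr_eqI_nn_integral)
  show "(\<lambda>x. (x n, x (Suc n))) \<in> borel_measurable (nodes_law N)"
    unfolding measurable_cong_sets[OF sets_nodes_law refl]
    using n by (intro borel_measurable_Pair seqM_component_measurable) auto
  show "sets (Ts n) = sets borel" by (rule sets_plan[OF n])
  fix S :: "('a \<times> 'a) set" assume S: "S \<in> sets borel"
  have "(\<integral>\<^sup>+x. indicator S (x n, x (Suc n)) \<partial>nodes_law N) = (\<integral>\<^sup>+p. indicator S p \<partial>Ts n)"
    using S by (intro nn_integral_nodes_law_planI[OF n] nn_integral_nodes_law_marginal[OF n]) simp
  then show "(\<integral>\<^sup>+x. indicator S (x n, x (Suc n)) \<partial>nodes_law N) = emeasure (Ts n) S"
    using S by (simp add: sets_plan[OF n])
qed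

lemma emeasure_nodes_law_Suc:
  assumes n: "n < N" and S: "S \<in> sets (seqM (Suc n))"
  shows "emeasure (nodes_law (Suc n)) S
      = (\<integral>\<^sup>+x. emeasure (K n (x n)) {y. x(Suc n := y) \<in> S} \<partial>nodes_law n)"
proof -
  have "emeasure (nodes_law (Suc n)) S = (\<integral>\<^sup>+x. indicator S x \<partial>nodes_law (Suc n))"
    using S by (simp add: sets_nodes_law)
  also have "\<dots> = (\<integral>\<^sup>+x. \<integral>\<^sup>+y. indicator S (x(Suc n := y)) \<partial>K n (x n) \<partial>nodes_law n)"
    using S by (intro nn_integral_nodes_law_Suc n) simp
  also have "\<dots> = (\<integral>\<^sup>+x. emeasure (K n (x n)) {y. x(Suc n := y) \<in> S} \<partial>nodes_law n)"
  proof (rule nn_integral_cong)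
    fix x assume "x \<in> space (nodes_law n)"
    then have "(\<lambda>y. x(Suc n := y)) \<in> measurable borel (seqM (Suc n))"
      by (intro seqM_fun_upd_measurable[of _ "{0..n}"]) (auto simp: space_nodes_law)
    from measurable_sets[OF this S] have "{y. x(Suc n := y) \<in> S} \<in> sets (K n (x n))"
      using disint_sets[OF disint_plan[OF n]] by (simp add: vimage_def)
    from nn_integral_indicator[OF this]
    show "(\<integral>\<^sup>+y. indicator S (x(Suc n := y)) \<partial>K n (x n))
        = emeasure (K n (x n)) {y. x(Suc n := y) \<in> S}"
      by (simp add: indicator_def)
  qed
  finally show ?thesis .
qed

lemma distr_first_plan:
  "distr (Ts 0) (seqM (Suc 0)) (\<lambda>p. (\<lambda>_. undefined)(0 := fst p, Suc 0 := snd p))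
      = nodes_law (Suc 0)"
  (is "distr _ _ ?nodes = _")
proof (rule distr_eqI_nn_integral)
  have nodes: "?nodes \<in> measurable borel (seqM (Suc 0))"
    by (intro measurable_fun_upd[where J = "{0..0}"] measurable_fun_upd[where J = "{}"]) auto
  then show "?nodes \<in> measurable (Ts 0) (seqM (Suc 0))"
    by (simp add: measurable_cong_sets[OF sets_plan[OF N_pos] refl])
  fix S assume S: "S \<in> sets (seqM (Suc 0) :: (nat \<Rightarrow> 'a) measure)"
  have "emeasure (nodes_law (Suc 0)) S = (\<integral>\<^sup>+x. indicator S x \<partial>nodes_law (Suc 0))"
    using S by (simp add: sets_nodes_law)
  also have "\<dots> = (\<integral>\<^sup>+x. \<integral>\<^sup>+y. indicator S (x(Suc 0 := y)) \<partial>K 0 (x 0) \<partial>nodes_law 0)"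
    using S by (intro nn_integral_nodes_law_Suc N_pos) simp
  also have "\<dots> = (\<integral>\<^sup>+p. \<integral>\<^sup>+y. indicator S (?nodes (fst p, y)) \<partial>K 0 (fst p) \<partial>Ts 0)"
    using S transition_integral_measurable[OF N_pos, of "indicator S"]
    by (subst nn_integral_nodes_law_0) auto
  also have "\<dots> = (\<integral>\<^sup>+p. indicator S (?nodes p) \<partial>Ts 0)"
    using S nodes by (intro nn_integral_plan[symmetric] N_pos) simp
  finally show "(\<integral>\<^sup>+p. indicator S (?nodes p) \<partial>Ts 0) = emeasure (nodes_law (Suc 0)) S" by simp
qed (simp add: sets_nodes_law)

lemma alpha_eq_nodes_law: "m < N \<Longrightarrow> alpha Ts K m = nodes_law (Suc m)"
proof (induction m)
  case 0
  have "(\<lambda>p::'a \<times> 'a. \<lambda>i\<in>{0..1}. if i = 0 then fst p else snd p)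
      = (\<lambda>p. (\<lambda>_. undefined)(0 := fst p, Suc 0 := snd p))"
    by (auto simp: fun_eq_iff)
  then show ?case using distr_first_plan by simp
next
  case (Suc m)
  let ?\<alpha> = "nodes_law (Suc (Suc m))"
  have "alpha Ts K (Suc m) = measure_of (space ?\<alpha>) (sets ?\<alpha>) (emeasure ?\<alpha>)"
    unfolding alpha.simps space_nodes_law sets_nodes_law
  proof (rule measure_of_eq)
    fix S assume "S \<in> sigma_sets (space (seqM (Suc (Suc m))))
        (sets (seqM (Suc (Suc m)) :: (nat \<Rightarrow> 'a) measure))"
    then have "S \<in> sets (seqM (Suc (Suc m)))" by (simp add: sets.sigma_sets_eq)
    then show "(\<integral>\<^sup>+x. emeasure (K (Suc m) (x (Suc m))) {y. x(Suc (Suc m) := y) \<in> S} \<partial>alpha Ts K m)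
        = emeasure ?\<alpha> S"
      using Suc emeasure_nodes_law_Suc[of "Suc m" S] by simp
  qed (rule sets.space_closed)
  then show ?case by (simp only: measure_of_of_measure)
qed

end

section \<open>Piecewise affine interpolation\<close>

definition ramp :: "real \<Rightarrow> real \<Rightarrow> real" where
  "ramp \<tau> u = max 0 (min \<tau> u)"

text \<open>The left inverse of the interpolation map: the node beyond \<open>T\<close> is recovered by
  extrapolating the last affine piece.\<close>

definition node :: "real \<Rightarrow> real \<Rightarrow> nat \<Rightarrow> (real \<Rightarrow> 'a::real_vector) \<Rightarrow> 'a" where
  "node \<tau> T n \<gamma> = (if n < stepN \<tau> T then \<gamma> (real n * \<tau>)
    else let s = real (stepN \<tau> T - 1) * \<tau> in \<gamma> s + (\<tau> / (T - s)) *\<^sub>R (\<gamma> T - \<gamma> s))"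

lemma ramp_mono: "s \<le> t \<Longrightarrow> ramp \<tau> s \<le> ramp \<tau> t"
  by (auto simp: ramp_def)

context
  fixes \<tau> T :: real
  assumes \<tau>: "0 < \<tau>" and T: "0 < T"
begin

lemma stepN_pos: "0 < stepN \<tau> T"
  using \<tau> T by (simp add: stepN_def)

lemma le_stepN_mult: "T \<le> real (stepN \<tau> T) * \<tau>"
proof -
  have "T / \<tau> \<le> real (stepN \<tau> T)" by (simp add: stepN_def of_nat_ceiling)
  then show ?thesis using \<tau> by (simp add: field_simps)
qed

lemma less_stepN_iff: "n < stepN \<tau> T \<longleftrightarrow> real n * \<tau> < T"
proof -
  have "n < stepN \<tau> T \<longleftrightarrow> int n < \<lceil>T / \<tau>\<rceil>" by (simp add: stepN_def zless_nat_eq_int_zless)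
  also have "\<dots> \<longleftrightarrow> real n < T / \<tau>" by (simp add: less_ceiling_iff)
  also have "\<dots> \<longleftrightarrow> real n * \<tau> < T" using \<tau> by (simp add: field_simps)
  finally show ?thesis .
qed

lemma last_node_less: "real (stepN \<tau> T - 1) * \<tau> < T"
  using stepN_pos by (intro less_stepN_iff[THEN iffD1]) simp

lemma obtain_step:
  assumes "0 \<le> t" "t < T"
  obtains n where "n < stepN \<tau> T" "real n * \<tau> \<le> t" "t < (real n + 1) * \<tau>"
proof -
  define n where "n = nat \<lfloor>t / \<tau>\<rfloor>"
  have n: "real n = of_int \<lfloor>t / \<tau>\<rfloor>" using assms(1) \<tau> by (simp add: n_def)
  have "real n \<le> t / \<tau>" "t / \<tau> < real n + 1" unfolding n by linarith+
  then have "real n * \<tau> \<le> t" "t < (real n + 1) * \<tau>"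
    using \<tau> by (simp_all add: pos_le_divide_eq pos_divide_less_eq)
  moreover from this(1) have "n < stepN \<tau> T" using assms(2) by (simp add: less_stepN_iff)
  ultimately show thesis using that by blast
qed

lemma obtain_step_closed:
  assumes "t \<in> {0..T}"
  obtains n where "n < stepN \<tau> T" "real n * \<tau> \<le> t" "t \<le> (real n + 1) * \<tau>"
proof (cases "t < T")
  case True
  with assms obtain n where "n < stepN \<tau> T" "real n * \<tau> \<le> t" "t < (real n + 1) * \<tau>"
    by (auto elim: obtain_step)
  then show thesis by (intro that) auto
next
  case False
  have "real (stepN \<tau> T - 1) + 1 = real (stepN \<tau> T)" using stepN_pos by (simp add: of_nat_diff)
  then show thesis
    using that[of "stepN \<tau> T - 1"] False assms stepN_pos last_node_less le_stepN_mult by simp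
qed

lemma Gmap_eq_affine:
  assumes n: "n < stepN \<tau> T" and t: "real n * \<tau> \<le> t" "t \<le> (real n + 1) * \<tau>" "t \<le> T"
  shows "Gmap \<tau> T x t = x n + ((t - real n * \<tau>) / \<tau>) *\<^sub>R (x (Suc n) - x n)"
proof -
  have "0 \<le> t" using t(1) \<tau> by (meson mult_nonneg_nonneg of_nat_0_le_iff less_imp_le order_trans)
  then have "t \<in> {0..T}" using t(3) by simp
  consider "t < (real n + 1) * \<tau>" | "t = (real n + 1) * \<tau>" using t(2) by linarith
  then show ?thesis
  proof cases
    case 1
    have "\<lfloor>t / \<tau>\<rfloor> = int n"
      using 1 t(1) \<tau> by (intro floor_unique) (simp_all add: pos_le_divide_eq pos_divide_less_eq)
    then have "min (nat \<lfloor>t / \<tau>\<rfloor>) (stepN \<tau> T - 1) = n" using n by simp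
    then show ?thesis using \<open>t \<in> {0..T}\<close> by (simp add: Gmap_def Let_def)
  next
    case 2
    then have "t / \<tau> = of_nat (Suc n)" using \<tau> by simp
    then have "min (nat \<lfloor>t / \<tau>\<rfloor>) (stepN \<tau> T - 1) = (if Suc n < stepN \<tau> T then Suc n else n)"
      using n by (simp only: floor_of_nat nat_int) auto
    then show ?thesis using \<open>t \<in> {0..T}\<close> 2 \<tau> by (simp add: Gmap_def Let_def distrib_right)
  qed
qed

lemma Gmap_node:
  assumes "n < stepN \<tau> T"
  shows "Gmap \<tau> T x (real n * \<tau>) = x n"
  using assms \<tau> less_stepN_iff[of n] by (subst Gmap_eq_affine[OF assms]) auto

lemma node_Gmap:
  assumes "n \<le> stepN \<tau> T"
  shows "node \<tau> T n (Gmap \<tau> T x) = x n"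
proof (cases "n < stepN \<tau> T")
  case True
  then show ?thesis by (simp add: node_def Gmap_node)
next
  case False
  define k where "k = stepN \<tau> T - 1"
  have k: "k < stepN \<tau> T" "Suc k = n" using stepN_pos False assms by (simp_all add: k_def)
  have "real k * \<tau> < T" using last_node_less by (simp add: k_def)
  have N: "stepN \<tau> T = Suc k" using k(2) False assms by simp
  then have "T \<le> (real k + 1) * \<tau>" using le_stepN_mult by (simp add: add.commute)
  then have "Gmap \<tau> T x T = x k + ((T - real k * \<tau>) / \<tau>) *\<^sub>R (x n - x k)"
    using Gmap_eq_affine[OF k(1), of T x] k \<open>real k * \<tau> < T\<close> by simp
  then show ?thesis
    using False \<tau> \<open>real k * \<tau> < T\<close> by (simp add: node_def Let_def N Gmap_node[OF k(1)])
qed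

lemma Gmap_eq_ramp_sum:
  assumes t: "t \<in> {0..T}"
  shows "Gmap \<tau> T x t
      = x 0 + (\<Sum>n<stepN \<tau> T. ramp \<tau> (t - real n * \<tau>) *\<^sub>R ((1 / \<tau>) *\<^sub>R (x (Suc n) - x n)))"
proof -
  define v where "v n = (1 / \<tau>) *\<^sub>R (x (Suc n) - x n)" for n
  obtain k where k: "k < stepN \<tau> T" "real k * \<tau> \<le> t" "t \<le> (real k + 1) * \<tau>"
    using obtain_step_closed[OF t] .
  have past: "ramp \<tau> (t - real n * \<tau>) = \<tau>" if "n < k" for n
  proof -
    have "(real n + 1) * \<tau> \<le> real k * \<tau>" using that \<tau> by (intro mult_right_mono) auto
    then show ?thesis using k(2) \<tau> by (simp add: ramp_def distrib_right)
  qed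
  have future: "ramp \<tau> (t - real n * \<tau>) = 0" if "k < n" for n
  proof -
    have "(real k + 1) * \<tau> \<le> real n * \<tau>" using that \<tau> by (intro mult_right_mono) auto
    then have "t - real n * \<tau> \<le> 0" using k(3) by linarith
    then show ?thesis by (simp add: ramp_def)
  qed
  have present: "ramp \<tau> (t - real k * \<tau>) = t - real k * \<tau>"
    using k(2,3) \<tau> by (simp add: ramp_def distrib_right)
  have "(\<Sum>n<stepN \<tau> T. ramp \<tau> (t - real n * \<tau>) *\<^sub>R v n)
      = (\<Sum>n<Suc k. ramp \<tau> (t - real n * \<tau>) *\<^sub>R v n)"
    using k(1) future by (intro sum.mono_neutral_right) auto
  also have "\<dots> = (\<Sum>n<k. \<tau> *\<^sub>R v n) + (t - real k * \<tau>) *\<^sub>R v k"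
    using past present by simp
  also have "(\<Sum>n<k. \<tau> *\<^sub>R v n) = x k - x 0"
    using \<tau> by (simp add: v_def sum_lessThan_telescope)
  finally show ?thesis
    using Gmap_eq_affine[OF k, of x] t by (simp add: v_def)
qed

lemma sum_ramp: "t \<in> {0..T} \<Longrightarrow> (\<Sum>n<stepN \<tau> T. ramp \<tau> (t - real n * \<tau>)) = t"
proof -
  assume t: "t \<in> {0..T}"
  have "Gmap \<tau> T (\<lambda>n. real n * \<tau>) t = t"
    using t \<tau> by (simp add: Gmap_def Let_def field_simps)
  moreover have "Gmap \<tau> T (\<lambda>n. real n * \<tau>) t = (\<Sum>n<stepN \<tau> T. ramp \<tau> (t - real n * \<tau>))"
    unfolding Gmap_eq_ramp_sum[OF t] using \<tau> by (simp add: field_simps)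
  ultimately show ?thesis by simp
qed

lemma Gmap_cong: "(\<And>n. n \<le> stepN \<tau> T \<Longrightarrow> x n = y n) \<Longrightarrow> Gmap \<tau> T x = Gmap \<tau> T y"
proof -
  assume eq: "\<And>n. n \<le> stepN \<tau> T \<Longrightarrow> x n = y n"
  have "n \<le> stepN \<tau> T" "Suc n \<le> stepN \<tau> T" if "n = min m (stepN \<tau> T - 1)" for m n
    using that stepN_pos by auto
  then show ?thesis by (auto simp: Gmap_def Let_def fun_eq_iff eq)
qed

lemma Gmap_measurable:
  "Gmap \<tau> T \<in> measurable (seqM (stepN \<tau> T))
      (pathM T :: (real \<Rightarrow> 'a::{real_normed_vector,second_countable_topology}) measure)"
  unfolding Gmap_def
proof (rule measurable_restrict)
  fix t
  define n where "n = min (nat \<lfloor>t / \<tau>\<rfloor>) (stepN \<tau> T - 1)"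
  have "n \<le> stepN \<tau> T" "Suc n \<le> stepN \<tau> T" using stepN_pos by (auto simp: n_def)
  note [measurable] = this[THEN seqM_component_measurable]
  show "(\<lambda>x. let n = min (nat \<lfloor>t / \<tau>\<rfloor>) (stepN \<tau> T - 1) in
      x n + ((t - real n * \<tau>) / \<tau>) *\<^sub>R (x (Suc n) - x n))
        \<in> measurable (seqM (stepN \<tau> T)) (borel :: 'a measure)"
    unfolding n_def[symmetric] Let_def by measurable
qed

lemma node_measurable:
  "node \<tau> T n \<in> measurable (pathM T)
      (borel :: 'a::{real_normed_vector,second_countable_topology} measure)"
proof -
  have [measurable]: "(\<lambda>\<gamma>. \<gamma> s) \<in> measurable (pathM T) (borel :: 'a measure)" if "s \<in> {0..T}" for s
    using that by (rule measurable_component_singleton)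
  show ?thesis
  proof (cases "n < stepN \<tau> T")
    case True
    then have "real n * \<tau> \<in> {0..T}" using less_stepN_iff[of n] \<tau> by simp
    then show ?thesis using True unfolding node_def[abs_def] by simp
  next
    case False
    have "real (stepN \<tau> T - 1) * \<tau> \<in> {0..T}" "T \<in> {0..T}" using last_node_less T \<tau> by auto
    then show ?thesis using False unfolding node_def[abs_def] Let_def by simp
  qed
qed

end

section \<open>The Euler scheme\<close>

context
  fixes \<Phi> :: "('a::{real_inner,complete_space,second_countable_topology} \<times> 'a) measure"
    and \<tau> :: real
  assumes \<Phi> [measurable_cong]: "sets \<Phi> = sets borel"
begin

lemma distr_Tn_fst: "distr (Tn \<tau> \<Phi>) borel fst = distr \<Phi> borel fst"
  unfolding Tn_def by (subst distr_distr) (auto simp: comp_def)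

lemma distr_Tn_snd: "distr (Tn \<tau> \<Phi>) borel snd = distr \<Phi> borel (\<lambda>p. fst p + \<tau> *\<^sub>R snd p)"
  unfolding Tn_def by (subst distr_distr) (auto simp: comp_def)

lemma distr_Tn_inverse:
  assumes "0 < \<tau>"
  shows "distr (Tn \<tau> \<Phi>) borel (\<lambda>p. (fst p, (1 / \<tau>) *\<^sub>R (snd p - fst p))) = \<Phi>"
  unfolding Tn_def using assms
  by (subst distr_distr) (auto simp: comp_def distr_id2[OF \<Phi>[symmetric]])

end

locale Euler_scheme =
  fixes F :: "('a::{real_inner,complete_space,second_countable_topology} \<times> 'a) measure set"
    and \<mu> :: "'a measure" and \<tau> T L :: real
    and M :: "nat \<Rightarrow> 'a measure" and \<Phi> :: "nat \<Rightarrow> ('a \<times> 'a) measure" and K :: "nat \<Rightarrow> 'a \<Rightarrow> 'a measure"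
  assumes \<tau>: "0 < \<tau>" and T: "0 < T" and MPVF: "is_MPVF F"
    and stable: "Lstable F \<mu> \<tau> T L M \<Phi>"
    and disint_Tn: "n < stepN \<tau> T \<Longrightarrow> disint (distr (Tn \<tau> (\<Phi> n)) borel fst) (Tn \<tau> (\<Phi> n)) (K n)"
begin

abbreviation N :: nat where "N \<equiv> stepN \<tau> T"

lemma
  assumes "n \<le> N"
  shows \<Phi>_in_F: "\<Phi> n \<in> F" and distr_\<Phi>_fst: "distr (\<Phi> n) borel fst = M n"
  using stable assms by (auto simp: Lstable_def fiber_def)

lemma
  assumes "n \<le> N"
  shows \<Phi>_in_P2: "\<Phi> n \<in> P2" and sets_\<Phi>: "sets (\<Phi> n) = sets borel" and prob_\<Phi>: "prob_space (\<Phi> n)"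
  using \<Phi>_in_F[OF assms] MPVF by (auto simp: is_MPVF_def P2_def)

lemma norm2_\<Phi>_le: "n < N \<Longrightarrow> norm2 (\<Phi> n) \<le> L"
  using stable by (simp add: Lstable_def)

sublocale plan_chain "\<lambda>n. Tn \<tau> (\<Phi> n)" K "stepN \<tau> T"
proof (rule plan_chain.intro)
  show "0 < N" by (rule stepN_pos[OF \<tau> T])
  fix n
  show "sets (Tn \<tau> (\<Phi> n)) = sets borel" by (simp add: Tn_def)
  show "disint (distr (Tn \<tau> (\<Phi> n)) borel fst) (Tn \<tau> (\<Phi> n)) (K n)" if "n < N"
    by (rule disint_Tn[OF that])
  show "prob_space (Tn \<tau> (\<Phi> n))" if "n < N"
  proof -
    note [measurable_cong] = sets_\<Phi>[OF less_imp_le[OF that]]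
    show ?thesis unfolding Tn_def
      by (rule prob_space.prob_space_distr[OF prob_\<Phi>]) (use that in simp, measurable)
  qed
  show "distr (Tn \<tau> (\<Phi> n)) borel snd = distr (Tn \<tau> (\<Phi> (Suc n))) borel fst" if "Suc n < N"
  proof -
    have "distr (Tn \<tau> (\<Phi> n)) borel snd = M (Suc n)"
      using that stable by (simp add: distr_Tn_snd[OF sets_\<Phi>] Lstable_def)
    also have "\<dots> = distr (Tn \<tau> (\<Phi> (Suc n))) borel fst"
      using that by (simp add: distr_Tn_fst[OF sets_\<Phi>] distr_\<Phi>_fst)
    finally show ?thesis .
  qed
qed

definition velocity_kernel :: "nat \<Rightarrow> 'a \<Rightarrow> 'a measure" where
  "velocity_kernel n x = distr (K n x) borel (\<lambda>y. (1 / \<tau>) *\<^sub>R (y - x))"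

definition drift :: "nat \<Rightarrow> 'a \<Rightarrow> 'a" where
  "drift n x = (\<integral>v. v \<partial>velocity_kernel n x)"

context
  fixes n assumes n: "n < N"
begin

lemma disint_velocity_kernel: "disint (distr (\<Phi> n) borel fst) (\<Phi> n) (velocity_kernel n)"
proof -
  have "disint (distr (Tn \<tau> (\<Phi> n)) borel fst)
      (distr (Tn \<tau> (\<Phi> n)) borel (\<lambda>p. (fst p, (1 / \<tau>) *\<^sub>R (snd p - fst p)))) (velocity_kernel n)"
    unfolding velocity_kernel_def[abs_def]
    by (rule disint_distr[OF disint_Tn[OF n]]) (simp_all add: sets_plan n)
  then show ?thesis
    using n by (simp add: distr_Tn_fst[OF sets_\<Phi>] distr_Tn_inverse[OF sets_\<Phi> \<tau>])
qed

lemma velocity_kernel_measurable: "velocity_kernel n \<in> measurable borel (subprob_algebra borel)"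
  by (rule disint_kernel[OF disint_velocity_kernel]) simp

lemma drift_measurable: "drift n \<in> borel_measurable borel"
  unfolding drift_def[abs_def] by (rule barycenter_measurable[OF velocity_kernel_measurable])

lemma drift_law_in_barF: "distr (distr (\<Phi> n) borel fst) borel (\<lambda>x. (x, drift n x)) \<in> barF F"
  using \<Phi>_in_F[of n] n disint_velocity_kernel unfolding barF_def drift_def by auto

end

end

locale Euler_path = Euler_scheme F \<mu> \<tau> T L M \<Phi> K + prob_space P
  for F :: "('a::{real_inner,complete_space,second_countable_topology} \<times> 'a) measure set"
    and \<mu> \<tau> T L M \<Phi> K and P :: "'b measure" +
  fixes Z :: "'b \<Rightarrow> real \<Rightarrow> 'a"
  assumes Z_measurable: "Z \<in> measurable P (pathM T)"
    and Z_law: "distr P (pathM T) Z = eta \<tau> T \<Phi> K"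
begin

definition pos :: "nat \<Rightarrow> 'b \<Rightarrow> 'a" where
  "pos n \<omega> = node \<tau> T n (Z \<omega>)"

definition vel :: "nat \<Rightarrow> 'b \<Rightarrow> 'a" where
  "vel n \<omega> = (1 / \<tau>) *\<^sub>R (pos (Suc n) \<omega> - pos n \<omega>)"

definition past :: "nat \<Rightarrow> 'b \<Rightarrow> nat \<Rightarrow> 'a" where
  "past n \<omega> = (\<lambda>i\<in>{0..n}. pos i \<omega>)"

definition interp :: "real \<Rightarrow> 'b \<Rightarrow> 'a" where
  "interp t \<omega> = Gmap \<tau> T (\<lambda>n. pos n \<omega>) t"

lemma pos_measurable [measurable]: "pos n \<in> borel_measurable P"
  unfolding pos_def[abs_def] by (rule measurable_compose[OF Z_measurable node_measurable[OF \<tau> T]])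

lemma vel_measurable [measurable]: "vel n \<in> borel_measurable P"
  unfolding vel_def[abs_def] by measurable

lemma past_measurable [measurable]: "past n \<in> measurable P (seqM n)"
  unfolding past_def[abs_def] by (intro measurable_restrict pos_measurable)

lemma pos_0: "pos 0 \<omega> = Z \<omega> 0"
  using N_pos by (simp add: pos_def node_def)

lemma eta_eq_distr_nodes_law: "eta \<tau> T \<Phi> K = distr (nodes_law N) (pathM T) (Gmap \<tau> T)"
  unfolding eta_def using alpha_eq_nodes_law[of "N - 1"] N_pos by simp

lemma Gmap_nodes_law_measurable: "Gmap \<tau> T \<in> measurable (nodes_law N) (pathM T)"
  unfolding measurable_cong_sets[OF sets_nodes_law refl] by (rule Gmap_measurable[OF \<tau> T])

lemma past_law: "distr P (seqM N) (past N) = nodes_law N"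
proof -
  let ?nodes = "\<lambda>\<gamma>. \<lambda>i\<in>{0..N}. node \<tau> T i \<gamma> :: 'a"
  have nodes: "?nodes \<in> measurable (pathM T) (seqM N)"
    by (intro measurable_restrict node_measurable[OF \<tau> T])
  have "distr P (seqM N) (past N) = distr (distr P (pathM T) Z) (seqM N) ?nodes"
    using distr_distr[OF nodes Z_measurable] by (simp add: comp_def past_def[abs_def] pos_def)
  also have "\<dots> = distr (nodes_law N) (seqM N) (\<lambda>x. ?nodes (Gmap \<tau> T x))"
    unfolding Z_law eta_eq_distr_nodes_law using distr_distr[OF nodes Gmap_nodes_law_measurable]
    by (simp add: comp_def)
  also have "\<dots> = distr (nodes_law N) (nodes_law N) (\<lambda>x. x)"
  proof (rule distr_cong)
    fix x assume "x \<in> space (nodes_law N)"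
    then show "?nodes (Gmap \<tau> T x) = x"
      by (auto simp: space_nodes_law space_PiM PiE_def extensional_def restrict_def
          node_Gmap[OF \<tau> T] fun_eq_iff)
  qed (simp_all add: sets_nodes_law)
  also have "\<dots> = nodes_law N" by simp
  finally show ?thesis .
qed

lemma restrict_past: "m \<le> n \<Longrightarrow> restrict (past n \<omega>) {0..m} = past m \<omega>"
  by (auto simp: past_def fun_eq_iff)

lemma nn_integral_past:
  assumes "f \<in> borel_measurable (seqM N)"
  shows "(\<integral>\<^sup>+\<omega>. f (past N \<omega>) \<partial>P) = (\<integral>\<^sup>+x. f x \<partial>nodes_law N)"
  unfolding past_law[symmetric] using assms
  by (intro nn_integral_distr[symmetric] past_measurable) simp

lemma Z_AE_eq_interp:
  assumes t: "t \<in> {0..T}"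
  shows "AE \<omega> in P. Z \<omega> t = interp t \<omega>"
proof -
  let ?err = "\<lambda>\<gamma>. \<gamma> t - Gmap \<tau> T (\<lambda>n. node \<tau> T n \<gamma>) t :: 'a"
  note [measurable] = node_measurable[OF \<tau> T] measurable_component_singleton[OF t]
  have err: "?err \<in> borel_measurable (pathM T)"
    unfolding Gmap_eq_ramp_sum[OF \<tau> T t] by measurable
  have zero_set: "{\<gamma> \<in> space (pathM T). ?err \<gamma> = 0} \<in> sets (pathM T)"
  proof -
    have "{\<gamma> \<in> space (pathM T). ?err \<gamma> = 0} = ?err -` {0} \<inter> space (pathM T)" by blast
    moreover have "{0::'a} \<in> sets borel" by simp
    ultimately show ?thesis using measurable_sets[OF err] by (simp only:)
  qed
  have "Gmap \<tau> T (\<lambda>n. node \<tau> T n (Gmap \<tau> T x)) = Gmap \<tau> T x" for x :: "nat \<Rightarrow> 'a"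
    by (intro Gmap_cong node_Gmap \<tau> T)
  then have "?err (Gmap \<tau> T x) = 0" for x
    by (simp only: diff_self)
  then have "AE \<gamma> in distr (nodes_law N) (pathM T) (Gmap \<tau> T). ?err \<gamma> = 0"
    unfolding AE_distr_iff[OF Gmap_nodes_law_measurable zero_set] by (rule AE_I2)
  then have "AE \<gamma> in distr P (pathM T) Z. ?err \<gamma> = 0"
    unfolding Z_law eta_eq_distr_nodes_law .
  then have "AE \<omega> in P. ?err (Z \<omega>) = 0"
    unfolding AE_distr_iff[OF Z_measurable zero_set] .
  then show ?thesis by eventually_elim (simp add: interp_def pos_def)
qed

context
  fixes n assumes n: "n < N"
begin

lemma pos_vel_law: "distr P borel (\<lambda>\<omega>. (pos n \<omega>, vel n \<omega>)) = \<Phi> n"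
proof -
  have "(\<lambda>x. (x n, x (Suc n))) \<in> measurable (seqM N) (borel :: ('a \<times> 'a) measure)"
    using n by (intro borel_measurable_Pair seqM_component_measurable) auto
  from distr_distr[OF this past_measurable]
  have "distr P borel (\<lambda>\<omega>. (pos n \<omega>, pos (Suc n) \<omega>)) = Tn \<tau> (\<Phi> n)"
    using nodes_law_plan[OF n] n by (simp add: past_law comp_def past_def)
  then have "distr (distr P borel (\<lambda>\<omega>. (pos n \<omega>, pos (Suc n) \<omega>))) borel
      (\<lambda>p. (fst p, (1 / \<tau>) *\<^sub>R (snd p - fst p))) = \<Phi> n"
    using n by (simp add: distr_Tn_inverse[OF sets_\<Phi> \<tau>])
  then show ?thesis by (subst (asm) distr_distr) (simp_all add: comp_def vel_def)
qed

lemma pos_law: "distr P borel (pos n) = distr (\<Phi> n) borel fst"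
  unfolding pos_vel_law[symmetric] by (subst distr_distr) (simp_all add: comp_def)

lemma pos_L2: "pos n \<in> L2 P"
  and vel_L2: "vel n \<in> L2 P"
  and L2norm_vel_le: "L2norm P (vel n) \<le> L"
proof -
  have pair: "(\<lambda>\<omega>. (pos n \<omega>, vel n \<omega>)) \<in> borel_measurable P" by measurable
  have "\<Phi> n \<in> P2" using n by (intro \<Phi>_in_P2) simp
  from P2_imp_L2[OF this] show "pos n \<in> L2 P" "vel n \<in> L2 P"
    unfolding pos_vel_law[symmetric] by (simp_all add: L2_distr_iff[OF pair])
  have "L2norm P (vel n) = norm2 (\<Phi> n)"
    using L2norm_distr[OF pair, of snd] unfolding pos_vel_law by (simp add: norm2_def L2norm_def)
  then show "L2norm P (vel n) \<le> L" using norm2_\<Phi>_le[OF n] by simp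
qed

lemma velocity_kernel_integral_measurable:
  assumes f: "f \<in> borel_measurable (seqM n \<Otimes>\<^sub>M borel)"
  shows "(\<lambda>x. \<integral>\<^sup>+v. f (x, v) \<partial>velocity_kernel n (x n)) \<in> borel_measurable (seqM n)"
proof (rule nn_integral_measurable_subprob_algebra2)
  show "(\<lambda>x. velocity_kernel n (x n)) \<in> measurable (seqM n) (subprob_algebra borel)"
    by (rule measurable_compose[OF seqM_component_measurable velocity_kernel_measurable[OF n]]) simp
qed (use f in simp)

lemma nn_integral_velocity_kernel:
  assumes "f \<in> borel_measurable borel"
  shows "(\<integral>\<^sup>+v. f v \<partial>velocity_kernel n x) = (\<integral>\<^sup>+y. f ((1 / \<tau>) *\<^sub>R (y - x)) \<partial>K n x)"
  unfolding velocity_kernel_def using assms disint_sets[OF disint_Tn[OF n]]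
  by (intro nn_integral_distr) (simp_all cong: measurable_cong_sets)

lemma nn_integral_past_vel:
  assumes f: "f \<in> borel_measurable (seqM n \<Otimes>\<^sub>M borel)"
  shows "(\<integral>\<^sup>+\<omega>. f (past n \<omega>, vel n \<omega>) \<partial>P)
      = (\<integral>\<^sup>+\<omega>. \<integral>\<^sup>+v. f (past n \<omega>, v) \<partial>velocity_kernel n (pos n \<omega>) \<partial>P)"
proof -
  define h where "h x = f (restrict x {0..n}, (1 / \<tau>) *\<^sub>R (x (Suc n) - x n))" for x
  define k where "k x = (\<integral>\<^sup>+v. f (x, v) \<partial>velocity_kernel n (x n))" for x
  have h: "h \<in> borel_measurable (seqM (Suc n))"
    unfolding h_def[abs_def]
    by (intro measurable_compose[OF measurable_Pair f] seqM_restrict_measurable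
        borel_measurable_scaleR
        borel_measurable_const borel_measurable_diff seqM_component_measurable) auto
  have k: "(\<lambda>x. k (restrict x {0..n})) \<in> borel_measurable (seqM N)"
    unfolding k_def using n
    by (intro measurable_compose[OF seqM_restrict_measurable
        velocity_kernel_integral_measurable[OF f]]) simp
  have "(\<integral>\<^sup>+\<omega>. f (past n \<omega>, vel n \<omega>) \<partial>P) = (\<integral>\<^sup>+\<omega>. h (restrict (past N \<omega>) {0..Suc n}) \<partial>P)"
    using n by (simp add: h_def restrict_past vel_def past_def[of "Suc n"] restrict_restrict
        Int_absorb2)
       (simp add: past_def)
  also have "\<dots> = (\<integral>\<^sup>+x. h (restrict x {0..Suc n}) \<partial>nodes_law N)"
    using n by (intro nn_integral_past measurable_compose[OF seqM_restrict_measurable h]) simp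
  also have "\<dots> = (\<integral>\<^sup>+x. \<integral>\<^sup>+y. h ((restrict x {0..n})(Suc n := y)) \<partial>K n (x n) \<partial>nodes_law N)"
    by (rule nn_integral_nodes_law_Markov[OF n h])
  also have "\<dots> = (\<integral>\<^sup>+x. k (restrict x {0..n}) \<partial>nodes_law N)"
  proof (rule nn_integral_cong)
    fix x :: "nat \<Rightarrow> 'a"
    have "restrict x {0..n} \<in> space (seqM n)" by (simp add: space_PiM PiE_iff)
    from measurable_compose[OF measurable_Pair1'[OF this] f]
    have "(\<lambda>v. f (restrict x {0..n}, v)) \<in> borel_measurable borel" .
    then show "(\<integral>\<^sup>+y. h ((restrict x {0..n})(Suc n := y)) \<partial>K n (x n)) = k (restrict x {0..n})"
      by (simp add: k_def h_def nn_integral_velocity_kernel restrict_fupd)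
  qed
  also have "\<dots> = (\<integral>\<^sup>+\<omega>. k (restrict (past N \<omega>) {0..n}) \<partial>P)"
    by (rule nn_integral_past[OF k, symmetric])
  also have "\<dots> = (\<integral>\<^sup>+\<omega>. \<integral>\<^sup>+v. f (past n \<omega>, v) \<partial>velocity_kernel n (pos n \<omega>) \<partial>P)"
    using n by (simp add: restrict_past k_def) (simp add: past_def)
  finally show ?thesis .
qed

lemma AE_velocity_kernel_finite_mean: "AE \<omega> in P. (\<integral>\<^sup>+v. norm v \<partial>velocity_kernel n (pos n \<omega>)) < \<infinity>"
proof -
  have "(\<integral>\<^sup>+\<omega>. \<integral>\<^sup>+v. norm v \<partial>velocity_kernel n (pos n \<omega>) \<partial>P) = (\<integral>\<^sup>+\<omega>. norm (vel n \<omega>) \<partial>P)"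
    by (subst nn_integral_past_vel[symmetric, of "\<lambda>p. ennreal (norm (snd p))", simplified]) auto
  also have "\<dots> = ennreal (\<integral>\<omega>. norm (vel n \<omega>) \<partial>P)"
    by (intro nn_integral_eq_integral L2_integrable_norm vel_L2 finite_measure_axioms) simp
  finally have "AE \<omega> in P. (\<integral>\<^sup>+v. norm v \<partial>velocity_kernel n (pos n \<omega>)) \<noteq> \<infinity>"
  proof (intro nn_integral_PInf_AE)
    have "(\<lambda>x. \<integral>\<^sup>+v. norm v \<partial>velocity_kernel n x) \<in> borel_measurable borel"
      by (rule measurable_compose[OF velocity_kernel_measurable[OF n]
          nn_integral_measurable_subprob_algebra]) simp
    from measurable_compose[OF pos_measurable this]
    show "(\<lambda>\<omega>. \<integral>\<^sup>+v. norm v \<partial>velocity_kernel n (pos n \<omega>)) \<in> borel_measurable P" .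
  qed simp
  then show ?thesis by eventually_elim (simp add: less_top)
qed

lemma vel_minus_drift_orthogonal_past:
  assumes drift_L2: "(\<lambda>\<omega>. drift n (pos n \<omega>)) \<in> L2 P"
    and G: "G \<in> borel_measurable (seqM n)" "(\<lambda>\<omega>. G (past n \<omega>)) \<in> L2 P"
  shows "L2inner P (\<lambda>\<omega>. vel n \<omega> - drift n (pos n \<omega>)) (\<lambda>\<omega>. G (past n \<omega>)) = 0"
proof -
  define g where "g p = inner (snd p - drift n (fst p n)) (G (fst p))" for p :: "(nat \<Rightarrow> 'a) \<times> 'a"
  have g_eq: "g (past n \<omega>, v) = inner (v - drift n (pos n \<omega>)) (G (past n \<omega>))" for \<omega> v
    by (simp add: g_def past_def)
  have "(\<integral>\<omega>. g (past n \<omega>, vel n \<omega>) \<partial>P) = 0"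
  proof (rule integral_eq_0_if_kernel_centered[OF nn_integral_past_vel])
    have "(\<lambda>p. fst p n) \<in> measurable (seqM n \<Otimes>\<^sub>M borel) (borel :: 'a measure)"
      by (rule measurable_compose[OF measurable_fst seqM_component_measurable]) simp
    then show "g \<in> borel_measurable (seqM n \<Otimes>\<^sub>M borel)"
      unfolding g_def[abs_def]
      by (intro borel_measurable_inner borel_measurable_diff measurable_snd
          measurable_compose[OF measurable_fst G(1)]
          measurable_compose[OF _ drift_measurable[OF n]])
    show "integrable P (\<lambda>\<omega>. g (past n \<omega>, vel n \<omega>))"
      unfolding g_eq by (intro L2_integrable_inner L2_diff vel_L2 drift_L2 G(2))
    show "AE \<omega> in P. has_bochner_integral (velocity_kernel n (pos n \<omega>)) (\<lambda>v. g (past n \<omega>, v)) 0"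
      using AE_velocity_kernel_finite_mean
      by eventually_elim (unfold g_eq drift_def, intro has_bochner_integral_inner_centered
          disint_prob_space[OF disint_velocity_kernel[OF n]]
          disint_sets[OF disint_velocity_kernel[OF n]])
  qed
  then show ?thesis by (simp add: L2inner_def g_eq)
qed

end

end

context Euler_path
begin

lemma interp_eq_affine:
  assumes "n < N" "real n * \<tau> \<le> t" "t \<le> (real n + 1) * \<tau>" "t \<le> T"
  shows "interp t \<omega> = pos n \<omega> + (t - real n * \<tau>) *\<^sub>R vel n \<omega>"
  unfolding interp_def vel_def Gmap_eq_affine[OF \<tau> T assms] by simp

lemma interp_0: "interp 0 = pos 0"
  using interp_eq_affine[OF N_pos, of 0] \<tau> T by (simp add: fun_eq_iff)

lemma interp_eq_ramp_sum:
  "t \<in> {0..T} \<Longrightarrow> interp t \<omega> = pos 0 \<omega> + (\<Sum>n<N. ramp \<tau> (t - real n * \<tau>) *\<^sub>R vel n \<omega>)"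
  unfolding interp_def vel_def by (rule Gmap_eq_ramp_sum[OF \<tau> T])

lemma interp_L2:
  assumes "t \<in> {0..T}"
  shows "interp t \<in> L2 P"
proof -
  have "interp t = (\<lambda>\<omega>. pos 0 \<omega> + (\<Sum>n<N. ramp \<tau> (t - real n * \<tau>) *\<^sub>R vel n \<omega>))"
    using assms by (simp add: interp_eq_ramp_sum fun_eq_iff)
  then show ?thesis by (simp only:) (intro L2_intros vel_L2 pos_L2 N_pos, simp)
qed

lemma L2norm_interp_diff_le:
  assumes st: "s \<in> {0..T}" "t \<in> {0..T}" "s \<le> t"
  shows "L2norm P (\<lambda>\<omega>. interp t \<omega> - interp s \<omega>) \<le> L * (t - s)"
proof -
  define d where "d n = ramp \<tau> (t - real n * \<tau>) - ramp \<tau> (s - real n * \<tau>)" for n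
  have d: "0 \<le> d n" for n using ramp_mono[of "s - real n * \<tau>" "t - real n * \<tau>" \<tau>] st
    by (simp add: d_def)
  have "L2norm P (\<lambda>\<omega>. interp t \<omega> - interp s \<omega>) = L2norm P (\<lambda>\<omega>. \<Sum>n<N. d n *\<^sub>R vel n \<omega>)"
    using st by (simp add: interp_eq_ramp_sum d_def scaleR_left_diff_distrib sum_subtractf)
  also have "\<dots> \<le> (\<Sum>n<N. L2norm P (\<lambda>\<omega>. d n *\<^sub>R vel n \<omega>))"
    by (intro L2norm_sum_le L2_scaleR vel_L2) auto
  also have "\<dots> = (\<Sum>n<N. L2norm P (vel n) * d n)"
    using d by (simp add: L2norm_scaleR mult.commute)
  also have "\<dots> \<le> (\<Sum>n<N. L * d n)"
    using d L2norm_vel_le by (intro sum_mono mult_right_mono) auto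
  also have "\<dots> = L * (\<Sum>n<N. d n)" by (rule sum_distrib_left[symmetric])
  also have "(\<Sum>n<N. d n) = t - s"
    using st by (simp add: d_def sum_subtractf sum_ramp[OF \<tau> T])
  finally show ?thesis .
qed

lemma interp_lipschitz: "L2_lipschitz_on P L {0..T} interp"
  unfolding L2_lipschitz_on_def
proof (intro conjI ballI)
  show "0 \<le> L" using order_trans[OF L2norm_nonneg L2norm_vel_le[OF N_pos]] .
  show "interp t \<in> L2 P" if "t \<in> {0..T}" for t by (rule interp_L2[OF that])
  fix s t assume "s \<in> {0..T}" "t \<in> {0..T}"
  then show "L2norm P (\<lambda>\<omega>. interp s \<omega> - interp t \<omega>) \<le> L * \<bar>s - t\<bar>"
    using L2norm_interp_diff_le[of s t] L2norm_interp_diff_le[of t s]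
      L2norm_minus_commute[of P "interp s" "interp t"]
    by (cases "s \<le> t") auto
qed

lemma interp_has_right_deriv:
  assumes n: "n < N" and t: "real n * \<tau> \<le> t" "t < (real n + 1) * \<tau>" "0 \<le> t" "t < T"
  shows "has_L2_right_deriv P interp (vel n) t"
proof (rule has_L2_right_deriv_affine)
  show "interp t \<in> L2 P" using t by (intro interp_L2) simp
  show "vel n \<in> L2 P" by (rule vel_L2[OF n])
  have "\<forall>\<^sub>F s in at_right t. s \<in> {t<..<min T ((real n + 1) * \<tau>)}"
    using t by (intro eventually_at_right_real) auto
  then show "\<forall>\<^sub>F s in at_right t. interp s = (\<lambda>\<omega>. interp t \<omega> + (s - t) *\<^sub>R vel n \<omega>)"
  proof eventually_elim
    case (elim s)
    then show ?case using t by (simp add: fun_eq_iff interp_eq_affine[OF n] algebra_simps)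
  qed
qed

end

definition Euler_defect :: "real \<Rightarrow> real \<Rightarrow> real \<Rightarrow> real \<Rightarrow> real" where
  "Euler_defect lam \<tau> L C = 2 * \<bar>lam\<bar> * \<tau>\<^sup>2 * L\<^sup>2 + \<tau> * ((L + C) * L)"

lemma Euler_defect_nonneg: "0 \<le> \<tau> \<Longrightarrow> 0 \<le> L \<Longrightarrow> 0 \<le> C \<Longrightarrow> 0 \<le> Euler_defect lam \<tau> L C"
  by (simp add: Euler_defect_def)

definition Euler_error :: "real \<Rightarrow> real \<Rightarrow> real \<Rightarrow> real \<Rightarrow> real \<Rightarrow> real \<Rightarrow> real" where
  "Euler_error lam \<tau> L C T r = exp (4 * \<bar>lam\<bar> * T) * (10 * r\<^sup>2 + 4 * Euler_defect lam \<tau> L C * T)"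

lemma Euler_error_tendsto_0:
  assumes "\<tau> \<longlonglongrightarrow> 0" "r \<longlonglongrightarrow> 0"
  shows "(\<lambda>h. Euler_error lam (\<tau> h) L C T (r h)) \<longlonglongrightarrow> 0"
  unfolding Euler_error_def Euler_defect_def using assms by (auto intro!: tendsto_eq_intros)

text \<open>The abstract form of one step: \<open>y\<close>, \<open>v\<close>, \<open>b\<close> are position, velocity and drift of the scheme,
  \<open>x\<close>, \<open>w\<close> position and velocity of the comparison curve.\<close>

lemma perturbed_dissipation:
  fixes y v b x w :: "'b \<Rightarrow> 'a::{real_inner,second_countable_topology}"
  assumes L2: "y \<in> L2 R" "v \<in> L2 R" "b \<in> L2 R" "x \<in> L2 R" "w \<in> L2 R"
    and orth: "L2inner R (\<lambda>p. v p - b p) y = 0" "L2inner R (\<lambda>p. v p - b p) x = 0"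
    and diss: "L2inner R (\<lambda>p. b p - w p) (\<lambda>p. y p - x p) \<le> lam * (L2norm R (\<lambda>p. y p - x p))\<^sup>2"
    and v: "L2norm R v \<le> L" and w: "L2norm R w \<le> C" and \<delta>: "0 \<le> \<delta>" "\<delta> \<le> \<tau>"
  shows "L2inner R (\<lambda>p. v p - w p) (\<lambda>p. y p + \<delta> *\<^sub>R v p - x p)
    \<le> 2 * \<bar>lam\<bar> * (L2norm R (\<lambda>p. y p + \<delta> *\<^sub>R v p - x p))\<^sup>2 + Euler_defect lam \<tau> L C"
proof -
  define d where "d = L2norm R (\<lambda>p. y p + \<delta> *\<^sub>R v p - x p)"
  have "0 \<le> L" "0 \<le> C" using order_trans[OF L2norm_nonneg v] order_trans[OF L2norm_nonneg w]
    by simp_all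
  have "L2inner R (\<lambda>p. v p - w p) (\<lambda>p. y p - x p)
      = L2inner R (\<lambda>p. v p - b p) (\<lambda>p. y p - x p) + L2inner R (\<lambda>p. b p - w p) (\<lambda>p. y p - x p)"
    by (subst L2inner_add_left[symmetric]) (simp_all add: L2_diff L2)
  also have "L2inner R (\<lambda>p. v p - b p) (\<lambda>p. y p - x p) = 0"
    using orth by (subst L2inner_diff_right) (simp_all add: L2_diff L2)
  finally have "L2inner R (\<lambda>p. v p - w p) (\<lambda>p. y p - x p) \<le> lam * (L2norm R (\<lambda>p. y p - x p))\<^sup>2"
    using diss by simp
  also have "\<dots> \<le> \<bar>lam\<bar> * (2 * d\<^sup>2 + 2 * (\<tau> * L)\<^sup>2)"
  proof (intro mult_mono)
    have "(L2norm R (\<lambda>p. y p - x p))\<^sup>2 \<le> 2 * d\<^sup>2 + 2 * (L2norm R (\<lambda>p. \<delta> *\<^sub>R v p))\<^sup>2"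
      using L2norm_diff_power2_le[of "\<lambda>p. y p + \<delta> *\<^sub>R v p - x p" R "\<lambda>p. \<delta> *\<^sub>R v p"]
      by (simp add: d_def L2_intros L2)
    moreover have "L2norm R (\<lambda>p. \<delta> *\<^sub>R v p) \<le> \<tau> * L"
      using \<delta> v \<open>0 \<le> L\<close> by (simp add: L2norm_scaleR mult_mono)
    ultimately show "(L2norm R (\<lambda>p. y p - x p))\<^sup>2 \<le> 2 * d\<^sup>2 + 2 * (\<tau> * L)\<^sup>2"
      using power_mono[of "L2norm R (\<lambda>p. \<delta> *\<^sub>R v p)" "\<tau> * L" 2] by simp
  qed auto
  finally have diss': "L2inner R (\<lambda>p. v p - w p) (\<lambda>p. y p - x p)
      \<le> \<bar>lam\<bar> * (2 * d\<^sup>2 + 2 * (\<tau> * L)\<^sup>2)" .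
  have "L2inner R (\<lambda>p. v p - w p) v \<le> L2norm R (\<lambda>p. v p - w p) * L2norm R v"
    using L2_Cauchy_Schwarz[OF L2_diff[OF L2(2,5)] L2(2)] by simp
  also have "\<dots> \<le> (L + C) * L"
    using L2norm_diff_le[OF L2(2,5)] v w \<open>0 \<le> L\<close> \<open>0 \<le> C\<close> by (intro mult_mono) auto
  finally have drift: "\<delta> * L2inner R (\<lambda>p. v p - w p) v \<le> \<tau> * ((L + C) * L)"
    using \<delta> \<open>0 \<le> L\<close> \<open>0 \<le> C\<close>
    by (meson add_nonneg_nonneg mult_left_mono mult_nonneg_nonneg mult_right_mono order_trans)
  have "L2inner R (\<lambda>p. v p - w p) (\<lambda>p. y p + \<delta> *\<^sub>R v p - x p)
      = L2inner R (\<lambda>p. v p - w p) (\<lambda>p. (y p - x p) + \<delta> *\<^sub>R v p)"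
    by (simp add: algebra_simps)
  also have "\<dots> = L2inner R (\<lambda>p. v p - w p) (\<lambda>p. y p - x p) + \<delta> * L2inner R (\<lambda>p. v p - w p) v"
    by (subst L2inner_add_right) (simp_all add: L2_intros L2 L2inner_scaleR_right)
  finally show ?thesis
    using diss' drift by (simp add: Euler_defect_def d_def power_mult_distrib algebra_simps)
qed

locale dissipative_Euler_path = Euler_path F \<mu> \<tau> T L M \<Phi> K P Z
  for F :: "('a::{real_inner,complete_space,second_countable_topology} \<times> 'a) measure set"
    and \<mu> \<tau> T L M \<Phi> K and P :: "'b measure" and Z +
  fixes H :: "('a \<times> 'a) measure set" and lam :: real
  assumes extension: "barF F \<subseteq> H" and H_diss: "tdiss lam H" and H_P2: "H \<subseteq> P2"
begin

context
  fixes n assumes n: "n < N"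
begin

lemma pos_drift_measurable: "(\<lambda>\<omega>. (pos n \<omega>, drift n (pos n \<omega>))) \<in> borel_measurable P"
  using measurable_compose[OF pos_measurable drift_measurable[OF n]] by simp

lemma pos_drift_law_in_H: "distr P borel (\<lambda>\<omega>. (pos n \<omega>, drift n (pos n \<omega>))) \<in> H"
proof -
  have "(\<lambda>x. (x, drift n x)) \<in> borel_measurable borel" using drift_measurable[OF n] by simp
  from distr_distr[OF this pos_measurable[of n]]
  have "distr P borel (\<lambda>\<omega>. (pos n \<omega>, drift n (pos n \<omega>)))
      = distr (distr (\<Phi> n) borel fst) borel (\<lambda>x. (x, drift n x))"
    by (simp add: comp_def pos_law[OF n])
  then show ?thesis using drift_law_in_barF[OF n] extension by auto
qed

lemma drift_L2: "(\<lambda>\<omega>. drift n (pos n \<omega>)) \<in> L2 P"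
  using P2_imp_L2(2)[of "distr P borel (\<lambda>\<omega>. (pos n \<omega>, drift n (pos n \<omega>)))"] pos_drift_law_in_H H_P2
  by (auto simp: L2_distr_iff[OF pos_drift_measurable])

lemma pos_drift_in_lagr_op: "(pos n, \<lambda>\<omega>. drift n (pos n \<omega>)) \<in> lagr_op P H"
  by (simp add: lagr_op_def pos_L2[OF n] drift_L2 pos_drift_law_in_H)

lemma vel_minus_drift_orthogonal_pos: "L2inner P (\<lambda>\<omega>. vel n \<omega> - drift n (pos n \<omega>)) (pos n) = 0"
  using vel_minus_drift_orthogonal_past[OF n drift_L2, of "\<lambda>x. x n"] pos_L2[OF n]
  by (simp add: seqM_component_measurable past_def)

lemma vel_minus_drift_orthogonal_cell:
  assumes cell: "cell \<in> measurable borel (count_space UNIV)"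
  shows "L2inner P (\<lambda>\<omega>. vel n \<omega> - drift n (pos n \<omega>)) (\<lambda>\<omega>. if cell (pos 0 \<omega>) = i then e else 0) = 0"
proof -
  define G where "G x = (if cell (x 0) = i then e else 0)" for x :: "nat \<Rightarrow> 'a"
  have [measurable]: "(\<lambda>x. cell (x 0)) \<in> measurable (seqM n) (count_space UNIV)"
    by (rule measurable_compose[OF seqM_component_measurable cell]) simp
  have G: "G \<in> borel_measurable (seqM n)" unfolding G_def by measurable
  have "(\<lambda>\<omega>. G (past n \<omega>)) \<in> L2 P"
    by (rule bounded_measurable_in_L2[OF finite_measure_axioms
        measurable_compose[OF past_measurable G], of "norm e"])
      (simp add: G_def)
  from vel_minus_drift_orthogonal_past[OF n drift_L2 G this] show ?thesis
    by (simp add: G_def past_def)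
qed

end

context
  fixes cell :: "'a \<Rightarrow> nat" and X :: "real \<Rightarrow> 'b \<Rightarrow> 'a" and C :: real and R
  assumes cell: "cell \<in> measurable borel (count_space UNIV)"
    and X: "lipschitz_lagr_curve P H C T X"
  defines "R \<equiv> cell_coupling P (\<lambda>\<omega>. cell (pos 0 \<omega>))"
begin

lemma cell_pos_measurable: "(\<lambda>\<omega>. cell (pos 0 \<omega>)) \<in> measurable P (count_space UNIV)"
  by (rule measurable_compose[OF pos_measurable cell])

lemma prob_space_R: "prob_space R"
  unfolding R_def by (rule prob_space_cell_coupling[OF prob_space_axioms cell_pos_measurable])

lemma fst_R: "measure_preserving R P fst" and snd_R: "measure_preserving R P snd"
  unfolding R_def
  by (rule measure_preserving_cell_coupling[OF prob_space_axioms cell_pos_measurable])+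

lemma coupled_step:
  assumes n: "n < N" and t: "real n * \<tau> \<le> t" "t < (real n + 1) * \<tau>" "0 \<le> t" "t < T"
    and W: "(X t, W) \<in> lagr_op P H" "L2norm P W \<le> C"
  shows "L2inner R (\<lambda>p. vel n (fst p) - W (snd p)) (\<lambda>p. interp t (fst p) - X t (snd p))
    \<le> 2 * \<bar>lam\<bar> * (L2norm R (\<lambda>p. interp t (fst p) - X t (snd p)))\<^sup>2 + Euler_defect lam \<tau> L C"
proof -
  have XW: "X t \<in> L2 P" "W \<in> L2 P"
    using W(1) by (simp_all add: lagr_op_def)
  note L2 = L2_measure_preserving[OF fst_R pos_L2[OF n]]
    L2_measure_preserving[OF fst_R vel_L2[OF n]]
    L2_measure_preserving[OF fst_R drift_L2[OF n]] L2_measure_preserving[OF snd_R XW(1)]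
    L2_measure_preserving[OF snd_R XW(2)]
  have "L2inner R (\<lambda>p. vel n (fst p) - W (snd p))
      (\<lambda>p. pos n (fst p) + (t - real n * \<tau>) *\<^sub>R vel n (fst p) - X t (snd p))
    \<le> 2 * \<bar>lam\<bar> *
      (L2norm R (\<lambda>p. pos n (fst p) + (t - real n * \<tau>) *\<^sub>R vel n (fst p) - X t (snd p)))\<^sup>2
      + Euler_defect lam \<tau> L C"
  proof (rule perturbed_dissipation[OF L2])
    show "L2inner R (\<lambda>p. vel n (fst p) - drift n (pos n (fst p))) (\<lambda>p. pos n (fst p)) = 0"
      using vel_minus_drift_orthogonal_pos[OF n]
        L2inner_measure_preserving[OF fst_R
            L2_measurable[OF L2_diff[OF vel_L2[OF n] drift_L2[OF n]]] pos_measurable]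
      by simp
    show "L2inner R (\<lambda>p. vel n (fst p) - drift n (pos n (fst p))) (\<lambda>p. X t (snd p)) = 0"
      unfolding R_def
      by (rule cell_coupling_L2inner_eq_0[OF prob_space_axioms cell_pos_measurable
          L2_diff[OF vel_L2[OF n] drift_L2[OF n]] XW(1)
            vel_minus_drift_orthogonal_cell[OF n cell]])
    show "L2inner R (\<lambda>p. drift n (pos n (fst p)) - W (snd p)) (\<lambda>p. pos n (fst p) - X t (snd p))
        \<le> lam * (L2norm R (\<lambda>p. pos n (fst p) - X t (snd p)))\<^sup>2"
      by (rule lagr_op_dissipative[OF H_diss prob_space_R fst_R snd_R pos_drift_in_lagr_op[OF n]
          W(1)])
    show "L2norm R (\<lambda>p. vel n (fst p)) \<le> L"
      using L2norm_vel_le[OF n] by (simp add: L2norm_measure_preserving[OF fst_R])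
    show "L2norm R (\<lambda>p. W (snd p)) \<le> C"
      using W(2) by (simp add: L2norm_measure_preserving[OF snd_R] L2_measurable[OF XW(2)])
    show "t - real n * \<tau> \<le> \<tau>" using t(2) by (simp add: distrib_right)
  qed (use t in simp)
  then show ?thesis using t by (simp add: interp_eq_affine[OF n])
qed

lemma X_lip: "L2_lipschitz_on P C {0..T} X"
  using X by (simp add: lipschitz_lagr_curve_def)

lemma defect_nonneg: "0 \<le> Euler_defect lam \<tau> L C"
  using \<tau> L2_lipschitz_onD(1)[OF interp_lipschitz] L2_lipschitz_onD(1)[OF X_lip]
  by (simp add: Euler_defect_nonneg)

lemma coupled_error:
  assumes t: "t \<in> {0..T}"
  shows "(L2norm R (\<lambda>p. interp t (fst p) - X t (snd p)))\<^sup>2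
    \<le> exp (4 * \<bar>lam\<bar> * t) *
      ((L2norm R (\<lambda>p. pos 0 (fst p) - X 0 (snd p)))\<^sup>2 + 2 * Euler_defect lam \<tau> L C * t)"
proof -
  let ?D = "\<lambda>t p. interp t (fst p) - X t (snd p)"
  have lip: "L2_lipschitz_on R (L + C) {0..T} ?D"
    by (intro L2_lipschitz_on_diff L2_lipschitz_on_measure_preserving[OF fst_R] interp_lipschitz
        L2_lipschitz_on_measure_preserving[OF snd_R] X_lip)
  have der: "AE t in lborel. t \<in> {0<..<T} \<longrightarrow> (\<exists>V. has_L2_right_deriv R ?D V t \<and>
      L2inner R V (?D t) \<le> (2 * \<bar>lam\<bar>) * (L2norm R (?D t))\<^sup>2 + Euler_defect lam \<tau> L C)"
    using X[unfolded lipschitz_lagr_curve_def, THEN conjunct2]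
  proof eventually_elim
    case (elim t)
    show ?case
    proof
      assume "t \<in> {0<..<T}"
      then obtain W where W: "(X t, W) \<in> lagr_op P H" "has_L2_right_deriv P X W t"
        and t: "0 \<le> t" "t < T"
        using elim by auto
      then have WC: "L2norm P W \<le> C" by (intro L2norm_right_deriv_le[OF X_lip]) auto
      obtain n where n: "n < N" "real n * \<tau> \<le> t" "t < (real n + 1) * \<tau>"
        using obtain_step[OF \<tau> T t] .
      show "\<exists>V. has_L2_right_deriv R ?D V t \<and>
          L2inner R V (?D t) \<le> (2 * \<bar>lam\<bar>) * (L2norm R (?D t))\<^sup>2 + Euler_defect lam \<tau> L C"
        using coupled_step[OF n t W(1) WC]
          has_L2_right_deriv_diff[OF
              has_L2_right_deriv_measure_preserving[OF fst_R interp_has_right_deriv[OF n t]]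
            has_L2_right_deriv_measure_preserving[OF snd_R W(2)]]
        by blast
    qed
  qed
  from L2_Gronwall[OF lip der _ defect_nonneg t] show ?thesis by (simp add: interp_0)
qed

lemma coupled_contraction:
  assumes t: "t \<in> {0..T}"
  shows "(L2norm R (\<lambda>p. X t (fst p) - X t (snd p)))\<^sup>2
    \<le> exp (2 * \<bar>lam\<bar> * t) * (L2norm R (\<lambda>p. X 0 (fst p) - X 0 (snd p)))\<^sup>2"
  by (rule lipschitz_lagr_curve_contraction[OF H_diss prob_space_R fst_R snd_R X X t])

context
  fixes \<epsilon> :: real
  assumes \<epsilon>: "0 \<le> \<epsilon>" and small: "\<And>x y. cell x = cell y \<Longrightarrow> dist x y \<le> \<epsilon>"
begin

lemma L2norm_coupled_start_le:
  shows "L2norm R (\<lambda>p. pos 0 (fst p) - X 0 (snd p)) \<le> \<epsilon> + L2norm P (\<lambda>\<omega>. pos 0 \<omega> - X 0 \<omega>)"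
    and "L2norm R (\<lambda>p. X 0 (fst p) - X 0 (snd p)) \<le> \<epsilon> + 2 * L2norm P (\<lambda>\<omega>. pos 0 \<omega> - X 0 \<omega>)"
proof -
  let ?r = "L2norm P (\<lambda>\<omega>. pos 0 \<omega> - X 0 \<omega>)"
  note pos = pos_L2[OF N_pos] and X0 = L2_lipschitz_onD(2)[OF X_lip, of 0]
  have "0 \<in> {0..T}" using T by simp
  note pos_X = L2_diff[OF pos X0[OF this]]
  note fst = L2_measure_preserving[OF fst_R] and snd = L2_measure_preserving[OF snd_R]
  have cells: "L2norm R (\<lambda>p. pos 0 (fst p) - pos 0 (snd p)) \<le> \<epsilon>"
  proof (rule L2norm_le_AE_bound[OF prob_space_R L2_diff[OF fst[OF pos] snd[OF pos]] _ \<epsilon>])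
    show "AE p in R. norm (pos 0 (fst p) - pos 0 (snd p)) \<le> \<epsilon>"
      using AE_cell_coupling[OF prob_space_axioms cell_pos_measurable] unfolding R_def
      by eventually_elim (simp add: small flip: dist_norm)
  qed
  have "L2norm R (\<lambda>p. (pos 0 (fst p) - pos 0 (snd p)) + (pos 0 (snd p) - X 0 (snd p)))
      \<le> L2norm R (\<lambda>p. pos 0 (fst p) - pos 0 (snd p)) + L2norm R (\<lambda>p. pos 0 (snd p) - X 0 (snd p))"
    by (intro L2norm_add_le L2_diff fst snd pos snd[OF pos_X])
  then show first: "L2norm R (\<lambda>p. pos 0 (fst p) - X 0 (snd p)) \<le> \<epsilon> + ?r"
    using cells L2norm_measure_preserving[OF snd_R L2_measurable[OF pos_X]] by simp
  have "(\<lambda>p. pos 0 (fst p) - X 0 (snd p)) \<in> L2 R"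
    using T by (intro L2_diff fst[OF pos] snd[OF X0]) simp
  from L2norm_diff_le[OF this fst[OF pos_X]]
  show "L2norm R (\<lambda>p. X 0 (fst p) - X 0 (snd p)) \<le> \<epsilon> + 2 * ?r"
    using first L2norm_measure_preserving[OF fst_R L2_measurable[OF pos_X]] by simp
qed

lemma interp_error_cells:
  assumes t: "t \<in> {0..T}"
  defines "r \<equiv> L2norm P (\<lambda>\<omega>. pos 0 \<omega> - X 0 \<omega>)"
  shows "(L2norm P (\<lambda>\<omega>. interp t \<omega> - X t \<omega>))\<^sup>2
    \<le> exp (4 * \<bar>lam\<bar> * T) * (2 * ((\<epsilon> + r)\<^sup>2 + 2 * Euler_defect lam \<tau> L C * T) + 2 * (\<epsilon> + 2 * r)\<^sup>2)"
proof -
  let ?A = "\<lambda>p. interp t (fst p) - X t (snd p)" and ?B = "\<lambda>p. X t (fst p) - X t (snd p)"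
  have A: "?A \<in> L2 R" and B: "?B \<in> L2 R"
    by (intro L2_diff L2_measure_preserving[OF fst_R] L2_measure_preserving[OF snd_R] interp_L2
        L2_lipschitz_onD(2)[OF X_lip] t)+
  have "L2norm P (\<lambda>\<omega>. interp t \<omega> - X t \<omega>) = L2norm R (\<lambda>p. ?A p - ?B p)"
    using L2norm_measure_preserving[OF fst_R
        L2_measurable[OF L2_diff[OF interp_L2[OF t] L2_lipschitz_onD(2)[OF X_lip t]]]]
    by simp
  then have "(L2norm P (\<lambda>\<omega>. interp t \<omega> - X t \<omega>))\<^sup>2 = (L2norm R (\<lambda>p. ?A p - ?B p))\<^sup>2" by simp
  also have "\<dots> \<le> 2 * (L2norm R ?A)\<^sup>2 + 2 * (L2norm R ?B)\<^sup>2"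
    by (rule L2norm_diff_power2_le[OF A B])
  also have "(L2norm R ?A)\<^sup>2 \<le> exp (4 * \<bar>lam\<bar> * T) * ((\<epsilon> + r)\<^sup>2 + 2 * Euler_defect lam \<tau> L C * T)"
    using t defect_nonneg L2norm_coupled_start_le(1)
    by (intro order_trans[OF coupled_error[OF t]] mult_mono add_mono power_mono)
      (auto simp: r_def mult_left_mono)
  also have "(L2norm R ?B)\<^sup>2 \<le> exp (4 * \<bar>lam\<bar> * T) * (\<epsilon> + 2 * r)\<^sup>2"
    using t L2norm_coupled_start_le(2)
    by (intro order_trans[OF coupled_contraction[OF t]] mult_mono power_mono)
      (auto simp: r_def mult_mono)
  finally show ?thesis by (simp add: algebra_simps)
qed

end

end

lemma interp_error:
  fixes X :: "real \<Rightarrow> 'b \<Rightarrow> 'a" and C :: real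
  assumes X: "lipschitz_lagr_curve P H C T X" and t: "t \<in> {0..T}"
  shows "(L2norm P (\<lambda>\<omega>. interp t \<omega> - X t \<omega>))\<^sup>2
    \<le> Euler_error lam \<tau> L C T (L2norm P (\<lambda>\<omega>. pos 0 \<omega> - X 0 \<omega>))"
proof -
  define r where "r = L2norm P (\<lambda>\<omega>. pos 0 \<omega> - X 0 \<omega>)"
  define bound where "bound \<epsilon> = exp (4 * \<bar>lam\<bar> * T) *
    (2 * ((\<epsilon> + r)\<^sup>2 + 2 * Euler_defect lam \<tau> L C * T) + 2 * (\<epsilon> + 2 * r)\<^sup>2)" for \<epsilon>
  have "(L2norm P (\<lambda>\<omega>. interp t \<omega> - X t \<omega>))\<^sup>2 \<le> bound \<epsilon>" if "0 < \<epsilon>" for \<epsilon>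
  proof -
    obtain cell :: "'a \<Rightarrow> nat" where "cell \<in> measurable borel (count_space UNIV)"
      "\<And>x y. cell x = cell y \<Longrightarrow> dist x y < \<epsilon>"
      using small_cells[OF \<open>0 < \<epsilon>\<close>] by blast
    then show ?thesis
      unfolding bound_def r_def using \<open>0 < \<epsilon>\<close>
      by (intro interp_error_cells[OF _ X _ _ t]) (auto intro: less_imp_le)
  qed
  moreover have "(bound \<longlongrightarrow> bound 0) (at_right 0)"
    unfolding bound_def by (intro tendsto_intros)
  ultimately have "(L2norm P (\<lambda>\<omega>. interp t \<omega> - X t \<omega>))\<^sup>2 \<le> bound 0"
    by (intro tendsto_lowerbound[OF _ _ trivial_limit_at_right_real])
      (auto simp: eventually_at_filter)
  also have "bound 0 = Euler_error lam \<tau> L C T r"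
    by (simp add: bound_def Euler_error_def power_mult_distrib algebra_simps)
  finally show ?thesis unfolding r_def .
qed

end

lemma Tsol_Lagrangian_error:
  fixes F :: "('a::{real_inner,complete_space,second_countable_topology} \<times> 'a) measure set"
    and Z :: "'b \<Rightarrow> real \<Rightarrow> 'a"
  assumes F: "is_MPVF F" "barF F \<subseteq> H" and H: "tdiss lam H" "H \<subseteq> P2"
    and \<tau>: "0 < \<tau>" and T: "0 < T" and sol: "(M, \<Psi>, \<eta>) \<in> Tsol F \<mu> \<tau> T L"
    and P: "prob_space P" and Z: "Z \<in> measurable P (pathM T)" "distr P (pathM T) Z = \<eta>"
    and X: "lipschitz_lagr_curve P H C T X"
  shows "L2_lipschitz_on P L {0..T} (\<lambda>t \<omega>. Z \<omega> t)"
    and "t \<in> {0..T} \<Longrightarrow> (L2norm P (\<lambda>\<omega>. Z \<omega> t - X t \<omega>))\<^sup>2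
      \<le> Euler_error lam \<tau> L C T (L2norm P (\<lambda>\<omega>. Z \<omega> 0 - X 0 \<omega>))"
proof -
  obtain M' \<Phi> K where "Lstable F \<mu> \<tau> T L M' \<Phi>" "\<eta> = eta \<tau> T \<Phi> K"
    "\<forall>n<stepN \<tau> T. disint (distr (Tn \<tau> (\<Phi> n)) borel fst) (Tn \<tau> (\<Phi> n)) (K n)"
    using sol unfolding Tsol_def by blast
  then interpret dissipative_Euler_path F \<mu> \<tau> T L M' \<Phi> K P Z H lam
    using assms by (intro dissipative_Euler_path.intro Euler_path.intro Euler_scheme.intro
        Euler_path_axioms.intro
        dissipative_Euler_path_axioms.intro) auto
  have Z_t: "(\<lambda>\<omega>. Z \<omega> t) \<in> borel_measurable P" if "t \<in> {0..T}" for t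
    using measurable_compose[OF Z(1) measurable_component_singleton[OF that]] .
  have interp_Z: "AE \<omega> in P. interp t \<omega> = Z \<omega> t" if "t \<in> {0..T}" for t
    using Z_AE_eq_interp[OF that] by eventually_elim simp
  show "L2_lipschitz_on P L {0..T} (\<lambda>t \<omega>. Z \<omega> t)"
    by (rule L2_lipschitz_on_cong_AE[OF interp_lipschitz Z_t interp_Z])
  show "(L2norm P (\<lambda>\<omega>. Z \<omega> t - X t \<omega>))\<^sup>2 \<le> Euler_error lam \<tau> L C T (L2norm P (\<lambda>\<omega>. Z \<omega> 0 - X 0 \<omega>))"
    if t: "t \<in> {0..T}"
  proof -
    have "X t \<in> borel_measurable P"
      using X t unfolding lipschitz_lagr_curve_def by (intro L2_measurable L2_lipschitz_onD(2)) auto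
    then have "L2norm P (\<lambda>\<omega>. Z \<omega> t - X t \<omega>) = L2norm P (\<lambda>\<omega>. interp t \<omega> - X t \<omega>)"
      using interp_Z[OF t] Z_t[OF t] L2_measurable[OF interp_L2[OF t]]
      by (intro L2norm_cong_AE) auto
    then show ?thesis using interp_error[OF X t] by (simp add: pos_0)
  qed
qed

section \<open>Convergence of the Euler scheme\<close>

theorem theorem5p10:
  fixes F :: "('a::{real_inner,complete_space,second_countable_topology} \<times> 'a) measure set"
    and lam T L :: real
    and \<mu> :: "'a measure" and \<mu>h :: "nat \<Rightarrow> 'a measure"
    and \<tau> :: "nat \<Rightarrow> real"
    and Mh :: "nat \<Rightarrow> real \<Rightarrow> 'a measure"
    and Fh :: "nat \<Rightarrow> real \<Rightarrow> ('a \<times> 'a) measure"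
    and \<eta>h :: "nat \<Rightarrow> (real \<Rightarrow> 'a) measure"
    and Fhat :: "('a \<times> 'a) measure set"
    and P :: "'b::polish_space measure"
    and Xb :: "'b \<Rightarrow> 'a" and Xbh :: "nat \<Rightarrow> 'b \<Rightarrow> 'a"
    and Z :: "nat \<Rightarrow> 'b \<Rightarrow> real \<Rightarrow> 'a"
    and Xs :: "'b \<Rightarrow> real \<Rightarrow> 'a"
  assumes F: "is_MPVF F"
    and barF_diss: "tdiss lam (barF F)"
    and mu: "\<mu> \<in> dom_F F" and muh: "\<And>h. \<mu>h h \<in> dom_F F"
    and muh_conv: "(\<lambda>h. W2 (\<mu>h h) \<mu>) \<longlonglongrightarrow> 0"
    and tau_pos: "\<And>h. \<tau> h > 0" and tau_conv: "\<tau> \<longlonglongrightarrow> 0"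
    and T: "T > 0" and L: "L > 0"
    and sol: "\<And>h. (Mh h, Fh h, \<eta>h h) \<in> Tsol F (\<mu>h h) (\<tau> h) T L"
    and Fhat: "barF F \<subseteq> Fhat" "max_tdiss lam Fhat"
    and solvable: "approx_solvable F \<mu> T"
    and P: "prob_space P" "sets P = sets borel" "atomless P"
    and Xb: "Xb \<in> L2 P" "distr P borel Xb = \<mu>"
    and Xbh: "\<And>h. Xbh h \<in> L2 P" "\<And>h. distr P borel (Xbh h) = \<mu>h h"
    and Z: "\<And>h. Z h \<in> L2C P T" "\<And>h. distr P (pathM T) (Z h) = \<eta>h h"
    and Xbh_conv: "AE \<omega> in P. (\<lambda>h. Xbh h \<omega>) \<longlonglongrightarrow> Xb \<omega>"
    and Z0: "\<And>h. AE \<omega> in P. Z h \<omega> 0 = Xbh h \<omega>"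
    and Xs: "lagr_solution P Fhat T Xb Xs"
  shows "(\<lambda>h. L2C_dist2 P T (Z h) Xs) \<longlonglongrightarrow> 0"
proof -
  have Fhat': "tdiss lam Fhat" "Fhat \<subseteq> P2"
    using Fhat(2) by (auto simp: max_tdiss_def is_MPVF_def)
  obtain C where X: "lipschitz_lagr_curve P Fhat C T (\<lambda>t \<omega>. Xs \<omega> t)"
    and X0: "AE \<omega> in P. Xs \<omega> 0 = Xb \<omega>"
    using lagr_solution_imp_lipschitz[OF Xs less_imp_le[OF T]] .
  have "Z h \<in> measurable P (pathM T)" for h using Z(1) by (simp add: L2C_def)
  note euler = Tsol_Lagrangian_error[OF F Fhat(1) Fhat' tau_pos T sol P(1) this Z(2) X]
  have lip: "L2_lipschitz_on P (L + C) {0..T} (\<lambda>t \<omega>. Z h \<omega> t - Xs \<omega> t)" for h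
    using X by (intro L2_lipschitz_on_diff euler(1)) (simp add: lipschitz_lagr_curve_def)
  have "AE \<omega> in P. Z h \<omega> 0 - Xs \<omega> 0 = Xbh h \<omega> - Xb \<omega>" for h
    using Z0[of h] X0 by eventually_elim simp
  then have start: "L2norm P (\<lambda>\<omega>. Z h \<omega> 0 - Xs \<omega> 0) = L2norm P (\<lambda>\<omega>. Xbh h \<omega> - Xb \<omega>)" for h
    using T Xb(1) Xbh(1)
    by (intro L2norm_cong_AE L2_measurable[OF L2_lipschitz_onD(2)[OF lip]]
        L2_measurable[OF L2_diff]) auto
  show ?thesis
  proof (rule L2C_dist2_tendsto_0[OF T])
    show "continuous_on {0..T} (Z h \<omega>)" "continuous_on {0..T} (Xs \<omega>)" for h \<omega>
      using Z(1) Xs by (auto simp: L2C_def lagr_solution_def)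
    show "L2_lipschitz_on P (L + C) {0..T} (\<lambda>t \<omega>. Z h \<omega> t - Xs \<omega> t)" for h by (rule lip)
    show "(L2norm P (\<lambda>\<omega>. Z h \<omega> t - Xs \<omega> t))\<^sup>2
        \<le> Euler_error lam (\<tau> h) L C T (L2norm P (\<lambda>\<omega>. Xbh h \<omega> - Xb \<omega>))" if "t \<in> {0..T}" for h t
      using euler(2)[OF that] start by simp
    show "(\<lambda>h. Euler_error lam (\<tau> h) L C T (L2norm P (\<lambda>\<omega>. Xbh h \<omega> - Xb \<omega>))) \<longlonglongrightarrow> 0"
      using muh_conv Xb Xbh Xbh_conv
      by (intro Euler_error_tendsto_0 tau_conv AE_W2_tendsto_imp_L2_tendsto P(1)) simp_all
  qed
qed

end
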